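(* In the two-tier cache-enabled network model described in the context, the successful access delivery probability $C_{Mp}=\mathbb P(R_{Mp,1}\ge R_0)$ of a tagged user requesting a content from the first (most popular) group is $$C_{Mp}=\int_0^\infty\sum_{l_1=0}^\infty 2\pi\lambda_1 z\,\exp\!\left(-z^\alpha P_1^{-1}\delta_1\sigma^2\right)\exp\!\left(-\pi\lambda_1z^2\Big(G(\delta_1,\alpha)+p_a\hat\lambda_{2,1}\hat P_{2,1}^{2/\alpha}H(\delta_1,\alpha)+1\Big)\right)P_{L_1}(l_1+1)\,dz,$$ where $\delta_1=2^{(l_1+1)R_0/W}-1$, $\hat\lambda_{2,1}=\lambda_2/\lambda_1$ and $\hat P_{2,1}=P_2/P_1$.
   Context: Parameters: path loss exponent $\alpha\in(2,4]$; $\lambda_1,\lambda_2,\lambda_u,P_1,P_2,W,R_0>0$; noise power $\sigma^2\ge 0$; integers $N,N_1,N_2\ge1$ with $N_1<N$ and $N_2\le N-N_1$; $\gamma\ge0$. Contents: content $n\in\{1,\dots,N\}$ is requested with probability $q_n=n^{-\gamma}/\sum_{k=1}^N k^{-\gamma}$. The first group is $\{1,\dots,N_1\}$, stored by every macro base station (MBS); the second group is $\{N_1+1,\dots,N\}$, each content of which is stored by each helper independently with probability $p_{Lp}=N_2/(N-N_1)$. Put $Q_{Mp}=\sum_{n\le N_1}q_n$, $Q_{Lp}=1-Q_{Mp}$. Network: MBSs (tier 1) and helpers (tier 2) form independent homogeneous Poisson point processes $\Phi_1,\Phi_2$ in $\mathbb R^2$ of intensities $\lambda_1,\lambda_2$,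 with transmit powers $P_1,P_2$. A tagged user is at the origin; the base station $x_{i,j}$ at distance $z_{i,j}$ from the origin has received power $P_ih_{i,j}z_{i,j}^{-\alpha}$, with $h_{i,j}$ i.i.d. exponential of mean 1, independent of the locations. Association constants: $A_{Lp,1}=\frac{\lambda_1P_1^{2/\alpha}}{\lambda_1P_1^{2/\alpha}+p_{Lp}\lambda_2P_2^{2/\alpha}}$, $A_{Lp,2}=1-A_{Lp,1}$, $A_1=Q_{Mp}+Q_{Lp}A_{Lp,1}$, $A_2=Q_{Lp}A_{Lp,2}$. Load: the number $L_k$ of users served by the serving base station of tier $k$ (tagged user included) is taken to be independent of locations and fading, with law, for $l\ge 0$, $$P_{L_k}(l+1)=\mathbb P(L_k=l+1)=\frac{3.5^{3.5}}{l!}\frac{\Gamma(l+4.5)}{\Gamma(3.5)}\Big(\frac{A_k\lambda_u}{\lambda_k}\Big)^{l}\Big(3.5+\frac{A_k\lambda_u}{\lambda_k}\Big)^{-(l+4.5)}.$$ Active helpers: only active helpers transmit; non-serving helpers are active independently with probability $p_a=1-\big(1+\frac{A_2\lambda_u}{3.5\lambda_2}\big)^{-3.5}$. First-group request: the user is served by the MBS $x_0$ maximizing $P_1z_{1,j}^{-\alpha}$ (the nearest MBS), at distance $z$ with fading $h$. The signal-to-interference-plus-noise ratio is $\mathrm{SINR}=\frac{P_1hz^{-\alpha}}{I_1+I_2+\sigma^2}$, where $I_1$ is the sum of the received powers from all MBSs other than $x_0$ and $I_2$ is the sum of the received powers from all active helpers. The rate is $R_{Mp,1}=\frac{W}{L_1}\log_2(1+\mathrm{SINR})$.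 Functions: $G(x,\alpha)=\frac{2x}{\alpha-2}\,{}_2F_1\big(1,1-\tfrac2\alpha;2-\tfrac2\alpha;-x\big)$ and $H(x,\alpha)=\frac2\alpha x^{2/\alpha}B\big(\tfrac2\alpha,1-\tfrac2\alpha\big)$, with ${}_2F_1$ the Gauss hypergeometric function and $B$ the Beta function. *)

theory Defs
  imports "HOL-Probability.Probability" "HOL-Complex_Analysis.Complex_Analysis"
begin

subsection \<open>Special functions\<close>

definition slit_plane :: "complex set" where
  "slit_plane = - {z. Im z = 0 \<and> 1 \<le> Re z}"

text \<open>
  The Gauss hypergeometric function is the analytic continuation of its power series from the
  unit disc to the complex plane cut along the real half-line from 1 to infinity. (The series
  alone does not suffice: \<open>G x \<alpha>\<close> below is needed for every \<open>x > 0\<close>.) The value on the cut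
  itself is unspecified.
\<close>

definition hyp2F1 :: "complex \<Rightarrow> complex \<Rightarrow> complex \<Rightarrow> complex \<Rightarrow> complex" where
  "hyp2F1 a b c = (SOME F. F holomorphic_on slit_plane \<and>
     (\<forall>z. norm z < 1 \<longrightarrow>
        (\<lambda>n. pochhammer a n * pochhammer b n / (pochhammer c n * fact n) * z ^ n) sums F z))"

text \<open>
  Existence and uniqueness of the continuation for the parameters that occur in \<open>G\<close>, where
  \<open>a = 1\<close> and \<open>c = b + 1\<close>. The integral is Euler's, after substituting \<open>s = t powr b\<close>.
\<close>

lemma slit_plane_props: "open slit_plane" "connected slit_plane" "ball 0 1 \<subseteq> slit_plane"
proof -
  have "closed ({z. Im z = 0} \<inter> {z. 1 \<le> Re z})"
    by (intro closed_Int closed_halfspace_Re_ge closed_Collect_eq continuous_intros)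
  then show "open slit_plane"
    unfolding slit_plane_def Collect_conj_eq by (rule open_Compl)
  have "starlike slit_plane"
    unfolding starlike_def
  proof (intro bexI[of _ 0] ballI subsetI)
    fix z y assume z: "z \<in> slit_plane" and "y \<in> closed_segment 0 z"
    then obtain u where u: "0 \<le> u" "u \<le> 1" "y = u *\<^sub>R z"
      by (auto simp: in_segment)
    show "y \<in> slit_plane"
    proof (rule ccontr)
      assume "y \<notin> slit_plane"
      then have *: "u * Im z = 0" "1 \<le> u * Re z"
        using u by (auto simp: slit_plane_def)
      then have "Im z = 0" by auto
      moreover have "1 \<le> Re z"
      proof (rule ccontr)
        assume "\<not> 1 \<le> Re z"
        then have "u * Re z < 1"
          using u mult_left_le_one_le[of "Re z" u] mult_nonneg_nonpos[of u "Re z"]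
          by (cases "0 \<le> Re z") auto
        with * show False by simp
      qed
      ultimately show False using z by (simp add: slit_plane_def)
    qed
  qed (auto simp: slit_plane_def)
  then show "connected slit_plane"
    by (rule starlike_imp_connected)
  show "ball 0 1 \<subseteq> slit_plane"
  proof
    fix z :: complex assume "z \<in> ball 0 1"
    then show "z \<in> slit_plane" using complex_Re_le_cmod[of z] by (auto simp: slit_plane_def)
  qed
qed

lemma hyp2F1_eqI:
  assumes "F holomorphic_on slit_plane"
    and "\<And>z. norm z < 1 \<Longrightarrow>
      (\<lambda>n. pochhammer a n * pochhammer b n / (pochhammer c n * fact n) * z ^ n) sums F z"
    and "z \<in> slit_plane"
  shows "hyp2F1 a b c z = F z"
proof -
  let ?P = "\<lambda>F. F holomorphic_on slit_plane \<and> (\<forall>z. norm z < 1 \<longrightarrow>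
    (\<lambda>n. pochhammer a n * pochhammer b n / (pochhammer c n * fact n) * z ^ n) sums F z)"
  have "?P (hyp2F1 a b c)"
    unfolding hyp2F1_def by (rule someI[of ?P F]) (use assms in auto)
  then have F': "hyp2F1 a b c holomorphic_on slit_plane"
    and sums': "\<And>z. norm z < 1 \<Longrightarrow>
      (\<lambda>n. pochhammer a n * pochhammer b n / (pochhammer c n * fact n) * z ^ n) sums hyp2F1 a b c z"
    by blast+
  show ?thesis
  proof (rule analytic_continuation_open[OF _ slit_plane_props(1) _ slit_plane_props(2,3) F' assms(1)])
    show "hyp2F1 a b c w = F w" if "w \<in> ball 0 1" for w
      using that by (intro sums_unique2[OF sums' assms(2)]) auto
  qed (use assms(3) in auto)
qed

lemma hyp2F1_1_eq_integral:
  fixes b :: real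
  assumes b: "0 < b" and z: "z \<in> slit_plane"
  shows "hyp2F1 1 (of_real b) (of_real (b + 1)) z =
    integral {0..1} (\<lambda>s. 1 / (1 - z * of_real (s powr (1 / b))))"
proof -
  define F where "F = (\<lambda>z. integral (cbox 0 1) (\<lambda>s. 1 / (1 - z * complex_of_real (s powr (1 / b)))))"
  have cont_t: "continuous_on (cbox 0 1) (\<lambda>s::real. s powr (1 / b))"
    using b by (intro continuous_on_powr') (auto intro!: continuous_intros)
  have t: "0 \<le> s powr (1 / b)" "s powr (1 / b) \<le> 1" if "s \<in> cbox 0 1" for s :: real
    using that b by (auto intro: powr_le1)
  have nz: "1 - z * complex_of_real (s powr (1 / b)) \<noteq> 0"
    if "z \<in> slit_plane" "s \<in> cbox 0 1" for z s
  proof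
    assume "1 - z * complex_of_real (s powr (1 / b)) = 0"
    then have e: "z * complex_of_real (s powr (1 / b)) = 1" by simp
    define u where "u = s powr (1 / b)"
    have u: "0 \<le> u" "u \<le> 1" using t[OF that(2)] by (auto simp: u_def)
    have "Re z * u = 1" "Im z * u = 0"
      using arg_cong[OF e, of Re] arg_cong[OF e, of Im] by (auto simp: u_def)
    then have "u \<noteq> 0" "Im z = 0" by auto
    moreover from this have "Re z = 1 / u" using \<open>Re z * u = 1\<close> by (simp add: nonzero_eq_divide_eq)
    ultimately show False using u that(1) by (auto simp: slit_plane_def)
  qed
  have cont2: "continuous_on (U \<times> cbox 0 1) (\<lambda>x. complex_of_real (snd x powr (1 / b)))"
    for U :: "complex set"
    by (intro continuous_on_of_real continuous_on_compose2[OF cont_t] continuous_on_snd continuous_on_id) auto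
  have "F holomorphic_on slit_plane"
  proof (subst holomorphic_on_def, rule ballI)
    fix z assume "z \<in> slit_plane"
    then obtain e where e: "0 < e" "ball z e \<subseteq> slit_plane"
      using slit_plane_props(1) openE by blast
    have "F holomorphic_on ball z e"
      unfolding F_def
    proof (rule leibniz_rule_holomorphic)
      show "((\<lambda>x. 1 / (1 - x * complex_of_real (s powr (1 / b)))) has_field_derivative
          complex_of_real (s powr (1 / b)) / (1 - x * complex_of_real (s powr (1 / b)))\<^sup>2)
          (at x within ball z e)" if "x \<in> ball z e" "s \<in> cbox 0 1" for x s
        using nz[of x s] that e
        by (auto intro!: derivative_eq_intros simp: power2_eq_square)
      show "(\<lambda>s. 1 / (1 - x * complex_of_real (s powr (1 / b)))) integrable_on cbox 0 1"
        if "x \<in> ball z e" for x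
        using nz[of x] that e
        by (intro integrable_continuous continuous_on_divide continuous_on_diff continuous_on_mult
            continuous_on_const continuous_on_of_real cont_t) auto
      show "continuous_on (ball z e \<times> cbox 0 1)
          (\<lambda>(x, s). complex_of_real (s powr (1 / b)) / (1 - x * complex_of_real (s powr (1 / b)))\<^sup>2)"
        unfolding case_prod_unfold using nz e
        by (intro continuous_on_divide continuous_on_power continuous_on_diff continuous_on_mult
            continuous_on_const continuous_on_fst continuous_on_id cont2) (auto simp: subset_eq)
    qed auto
    then have "F field_differentiable at z"
      using e by (intro holomorphic_on_imp_differentiable_at[of F "ball z e"]) auto
    then show "F field_differentiable at z within slit_plane"
      by (rule field_differentiable_at_within)
  qed
  moreover have "(\<lambda>n. pochhammer 1 n * pochhammer (of_real b) n /
      (pochhammer (of_real (b + 1)) n * fact n) * z ^ n) sums F z" if z: "norm z < 1" for z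
  proof -
    let ?f = "\<lambda>n s. (z * complex_of_real (s powr (1 / b))) ^ n"
    have bound: "norm (?f n s) \<le> norm z ^ n" if "s \<in> {0..1}" for n s
      using t[of s] that by (auto simp: norm_mult norm_power intro!: power_mono mult_left_le)
    have u0: "uniform_limit {0..1} (\<lambda>n s. \<Sum>i<n. ?f i s) (\<lambda>s. \<Sum>i. ?f i s) sequentially"
      using bound z by (intro Weierstrass_m_test[where M = "\<lambda>n. norm z ^ n"]) (auto intro: summable_geometric)
    have lt: "norm (z * complex_of_real (s powr (1 / b))) < 1" if "s \<in> {0..1}" for s
      using bound[of s 1] that z by simp
    have u: "uniform_limit {0..1} (\<lambda>n s. \<Sum>i<n. ?f i s)
        (\<lambda>s. 1 / (1 - z * complex_of_real (s powr (1 / b)))) sequentially"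
      using u0 by (rule uniform_limit_cong'[THEN iffD1, rotated 2]) (use lt in \<open>auto simp: suminf_geometric\<close>)
    have c: "continuous_on {0..1} (?f i)" for i
      using cont_t
      by (intro continuous_on_power continuous_on_mult continuous_on_const continuous_on_of_real) simp
    obtain I J where IJ: "\<And>n. ((\<lambda>s. \<Sum>i<n. ?f i s) has_integral I n) {0..1}"
      "((\<lambda>s. 1 / (1 - z * complex_of_real (s powr (1 / b)))) has_integral J) {0..1}" "I \<longlonglongrightarrow> J"
      by (rule uniform_limit_integral[OF u]) (auto intro!: continuous_on_sum c)
    have coeff: "pochhammer 1 n * pochhammer (of_real b) n /
      (pochhammer (of_real (b + 1)) n * fact n) = complex_of_real (b / (b + real n))" for n
    proof -
      have p: "pochhammer (b + 1) n \<noteq> 0" using b by (intro less_imp_neq[symmetric] pochhammer_pos) auto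
      have "b * pochhammer (b + 1) n = (b + real n) * pochhammer b n"
        by (simp add: pochhammer_rec[symmetric] pochhammer_rec')
      then have "pochhammer b n / pochhammer (b + 1) n = b / (b + real n)"
        using p b by (simp add: field_simps)
      then have "complex_of_real (pochhammer b n) / complex_of_real (pochhammer (b + 1) n) =
          complex_of_real (b / (b + real n))"
        by (metis of_real_divide)
      moreover have "pochhammer 1 n = (fact n :: complex)" by (simp add: pochhammer_fact)
      moreover have "(fact n :: complex) \<noteq> 0" by simp
      ultimately show ?thesis
        by (simp add: pochhammer_of_real del: of_real_add of_real_divide)
    qed
    have tm: "(?f n has_integral complex_of_real (b / (b + real n)) * z ^ n) {0..1}" for n
    proof -
      have "((\<lambda>s. s powr (real n / b)) has_integral (1 powr (real n / b + 1) / (real n / b + 1))) {0..1}"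
        using b by (intro has_integral_powr_from_0) (auto simp: less_le_trans[of _ 0])
      then have "((\<lambda>s. s powr (real n / b)) has_integral b / (b + real n)) {0..1}"
        using b by (simp add: field_simps)
      then have "((\<lambda>s. z ^ n * complex_of_real (s powr (real n / b))) has_integral
          z ^ n * complex_of_real (b / (b + real n))) {0..1}"
        by (intro has_integral_mult_right has_integral_of_real)
      then have "((\<lambda>s. z ^ n * complex_of_real (s powr (real n / b))) has_integral
          complex_of_real (b / (b + real n)) * z ^ n) {0..1}"
        by (simp only: mult.commute)
      then show ?thesis
      proof (rule has_integral_spike_finite[of "{0}", rotated 2])
        fix s :: real assume "s \<in> {0..1} - {0}"
        then have "(s powr (1 / b)) ^ n = s powr (real n / b)"
          by (simp add: powr_realpow[symmetric] powr_powr)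
        then show "?f n s = z ^ n * complex_of_real (s powr (real n / b))"
          by (simp add: power_mult_distrib flip: of_real_power)
      qed auto
    qed
    have "I n = (\<Sum>i<n. complex_of_real (b / (b + real i)) * z ^ i)" for n
      by (intro has_integral_unique[OF IJ(1)] has_integral_sum finite_lessThan tm)
    then have "I = (\<lambda>n. \<Sum>i<n. complex_of_real (b / (b + real i)) * z ^ i)"
      by (rule ext)
    then have "(\<lambda>i. complex_of_real (b / (b + real i)) * z ^ i) sums J"
      using IJ(3) by (simp only: sums_def)
    moreover have "F z = J"
      using IJ(2) by (simp add: F_def integral_unique)
    ultimately show ?thesis
      by (simp only: coeff)
  qed
  ultimately show ?thesis
    using hyp2F1_eqI[of F 1 "of_real b" "of_real (b + 1)" z] z by (simp add: F_def)
qed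

definition G :: "real \<Rightarrow> real \<Rightarrow> real" where
  "G x \<alpha> = 2 * x / (\<alpha> - 2) *
     Re (hyp2F1 1 (of_real (1 - 2 / \<alpha>)) (of_real (2 - 2 / \<alpha>)) (of_real (- x)))"

definition H :: "real \<Rightarrow> real \<Rightarrow> real" where
  "H x \<alpha> = 2 / \<alpha> * x powr (2 / \<alpha>) * Beta (2 / \<alpha>) (1 - 2 / \<alpha>)"

subsection \<open>Contents and association\<close>

datatype tier = Macro | Helper

definition request_prob :: "nat \<Rightarrow> real \<Rightarrow> nat \<Rightarrow> real" where
  "request_prob N \<gamma> n = real n powr (- \<gamma>) / (\<Sum>k=1..N. real k powr (- \<gamma>))"

definition Q_Mp :: "nat \<Rightarrow> nat \<Rightarrow> real \<Rightarrow> real" where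
  "Q_Mp N N\<^sub>1 \<gamma> = (\<Sum>n=1..N\<^sub>1. request_prob N \<gamma> n)"

definition Q_Lp :: "nat \<Rightarrow> nat \<Rightarrow> real \<Rightarrow> real" where
  "Q_Lp N N\<^sub>1 \<gamma> = 1 - Q_Mp N N\<^sub>1 \<gamma>"

definition p_Lp :: "nat \<Rightarrow> nat \<Rightarrow> nat \<Rightarrow> real" where
  "p_Lp N N\<^sub>1 N\<^sub>2 = real N\<^sub>2 / (real N - real N\<^sub>1)"

definition A_Lp :: "real \<Rightarrow> (tier \<Rightarrow> real) \<Rightarrow> (tier \<Rightarrow> real) \<Rightarrow> real \<Rightarrow> tier \<Rightarrow> real" where
  "A_Lp \<alpha> lam P p i =
     (let A\<^sub>1 = lam Macro * P Macro powr (2 / \<alpha>) /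
        (lam Macro * P Macro powr (2 / \<alpha>) + p * lam Helper * P Helper powr (2 / \<alpha>))
      in case i of Macro \<Rightarrow> A\<^sub>1 | Helper \<Rightarrow> 1 - A\<^sub>1)"

definition assoc_prob ::
  "real \<Rightarrow> (tier \<Rightarrow> real) \<Rightarrow> (tier \<Rightarrow> real) \<Rightarrow> nat \<Rightarrow> nat \<Rightarrow> nat \<Rightarrow> real \<Rightarrow> tier \<Rightarrow> real" where
  "assoc_prob \<alpha> lam P N N\<^sub>1 N\<^sub>2 \<gamma> i =
     (case i of Macro \<Rightarrow> Q_Mp N N\<^sub>1 \<gamma> | Helper \<Rightarrow> 0) +
     Q_Lp N N\<^sub>1 \<gamma> * A_Lp \<alpha> lam P (p_Lp N N\<^sub>1 N\<^sub>2) i"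

text \<open>
  In the next two definitions \<open>a\<close> is the mean number of users per base station of the tier,
  \<open>A\<^sub>k lam\<^sub>u / lam\<^sub>k\<close>; \<open>load_law a l\<close> is the probability that the load equals \<open>l + 1\<close>.
\<close>

definition load_law :: "real \<Rightarrow> nat \<Rightarrow> real" where
  "load_law a l = 3.5 powr 3.5 / fact l * (Gamma (real l + 4.5) / Gamma 3.5) *
     a ^ l * (3.5 + a) powr (- (real l + 4.5))"

definition active_prob :: "real \<Rightarrow> real" where
  "active_prob a = 1 - (1 + a / 3.5) powr (- 3.5)"

subsection \<open>Poisson point processes and independence\<close>

text \<open>
  A point process with almost surely infinitely many points is given by a random enumeration
  \<open>X 0, X 1, \<dots>\<close> of its points. Points are counted in the extended nonnegative reals, so that an
  infinite count is not confused with zero.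
\<close>

definition num_points :: "(nat \<Rightarrow> 'a \<Rightarrow> 'b) \<Rightarrow> 'b set \<Rightarrow> 'a \<Rightarrow> ennreal" where
  "num_points X B \<omega> = emeasure (count_space UNIV) {j. X j \<omega> \<in> B}"

definition (in prob_space) homogeneous_ppp ::
  "real \<Rightarrow> (nat \<Rightarrow> 'a \<Rightarrow> 'b :: euclidean_space) \<Rightarrow> bool" where
  "homogeneous_ppp lam X \<longleftrightarrow>
     (\<forall>j. random_variable borel (X j)) \<and>
     (\<forall>B \<in> sets borel. emeasure lborel B < \<infinity> \<longrightarrow>
        (\<forall>k. prob {\<omega> \<in> space M. num_points X B \<omega> = of_nat k} =
             (lam * measure lborel B) ^ k / fact k * exp (- (lam * measure lborel B)))) \<and>
     (\<forall>B :: nat \<Rightarrow> 'b set. disjoint_family B \<longrightarrow>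
        (\<forall>n. B n \<in> sets borel \<and> emeasure lborel (B n) < \<infinity>) \<longrightarrow>
        indep_vars (\<lambda>_. borel) (\<lambda>n. num_points X (B n)) UNIV)"

definition events_of :: "'a measure \<Rightarrow> ('a \<Rightarrow> 'b) \<Rightarrow> 'b measure \<Rightarrow> 'a set set" where
  "events_of M f N = {f -` B \<inter> space M | B. B \<in> sets N}"

text \<open>
  The random quantities have different types, so their joint independence is expressed as
  independence of the sigma-algebras they generate. The whole enumeration of one tier counts as a
  single source of randomness.
\<close>

datatype source = Locations tier | Fading tier nat | Activity nat | Load

fun source_events ::
  "'a measure \<Rightarrow> (tier \<Rightarrow> nat \<Rightarrow> 'a \<Rightarrow> real^2) \<Rightarrow> (tier \<Rightarrow> nat \<Rightarrow> 'a \<Rightarrow> real) \<Rightarrow>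
   (nat \<Rightarrow> 'a \<Rightarrow> bool) \<Rightarrow> ('a \<Rightarrow> nat) \<Rightarrow> source \<Rightarrow> 'a set set" where
  "source_events M X h act L (Locations i) =
     events_of M (\<lambda>\<omega> j. X i j \<omega>) (Pi\<^sub>M UNIV (\<lambda>_. borel))"
| "source_events M X h act L (Fading i j) = events_of M (h i j) borel"
| "source_events M X h act L (Activity j) = events_of M (act j) (count_space UNIV)"
| "source_events M X h act L Load = events_of M L (count_space UNIV)"

subsection \<open>Signal, interference and rate of a first-group request\<close>

text \<open>
  Outcomes are passed pointwise here: \<open>x i j\<close>, \<open>h i j\<close> and \<open>act j\<close> are the locations, fading
  values and helper activities at one outcome.
\<close>

definition rec_power ::
  "real \<Rightarrow> (tier \<Rightarrow> real) \<Rightarrow> (tier \<Rightarrow> nat \<Rightarrow> real^2) \<Rightarrow> (tier \<Rightarrow> nat \<Rightarrow> real) \<Rightarrow>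
   tier \<Rightarrow> nat \<Rightarrow> real" where
  "rec_power \<alpha> P x h i j = P i * h i j * norm (x i j) powr (- \<alpha>)"

text \<open>
  \<open>LEAST\<close> only breaks ties, which have probability zero.
\<close>

definition serving :: "real \<Rightarrow> (tier \<Rightarrow> real) \<Rightarrow> (tier \<Rightarrow> nat \<Rightarrow> real^2) \<Rightarrow> nat" where
  "serving \<alpha> P x = (LEAST j. \<forall>k. P Macro * norm (x Macro k) powr (- \<alpha>)
                              \<le> P Macro * norm (x Macro j) powr (- \<alpha>))"

text \<open>
  Both interference series converge almost surely since \<open>\<alpha> > 2\<close>; \<open>infsum\<close> returns 0 on the
  exceptional null set.
\<close>

definition interference_Macro ::
  "real \<Rightarrow> (tier \<Rightarrow> real) \<Rightarrow> (tier \<Rightarrow> nat \<Rightarrow> real^2) \<Rightarrow> (tier \<Rightarrow> nat \<Rightarrow> real) \<Rightarrow> real" where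
  "interference_Macro \<alpha> P x h =
     (\<Sum>\<^sub>\<infinity>j\<in>UNIV - {serving \<alpha> P x}. rec_power \<alpha> P x h Macro j)"

definition interference_Helper ::
  "real \<Rightarrow> (tier \<Rightarrow> real) \<Rightarrow> (tier \<Rightarrow> nat \<Rightarrow> real^2) \<Rightarrow> (tier \<Rightarrow> nat \<Rightarrow> real) \<Rightarrow>
   (nat \<Rightarrow> bool) \<Rightarrow> real" where
  "interference_Helper \<alpha> P x h act = (\<Sum>\<^sub>\<infinity>j\<in>{j. act j}. rec_power \<alpha> P x h Helper j)"

definition SINR ::
  "real \<Rightarrow> (tier \<Rightarrow> real) \<Rightarrow> real \<Rightarrow> (tier \<Rightarrow> nat \<Rightarrow> real^2) \<Rightarrow> (tier \<Rightarrow> nat \<Rightarrow> real) \<Rightarrow>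
   (nat \<Rightarrow> bool) \<Rightarrow> real" where
  "SINR \<alpha> P noise x h act =
     rec_power \<alpha> P x h Macro (serving \<alpha> P x) /
     (interference_Macro \<alpha> P x h + interference_Helper \<alpha> P x h act + noise)"

definition rate_Mp ::
  "real \<Rightarrow> (tier \<Rightarrow> real) \<Rightarrow> real \<Rightarrow> real \<Rightarrow> (tier \<Rightarrow> nat \<Rightarrow> real^2) \<Rightarrow> (tier \<Rightarrow> nat \<Rightarrow> real) \<Rightarrow>
   (nat \<Rightarrow> bool) \<Rightarrow> nat \<Rightarrow> real" where
  "rate_Mp \<alpha> P noise W x h act l = W / real l * log 2 (1 + SINR \<alpha> P noise x h act)"

end

theory Submission
  imports Defs
begin

text \<open>
  Given the locations, the fading of the serving station is an exponential variable independent of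
  everything else, so the event that the ratio exceeds \<open>\<delta>\<close> has the probability
  \<open>exp (- s * (I\<^sub>1 + I\<^sub>2 + noise))\<close>, averaged over the remaining fading and the activities.
  This average is an infinite product over the points of both tiers. The helper product is averaged
  with the generating functional of a Poisson process, which is computed for step functions (finitely
  many independent Poisson counts) and extended by monotone convergence.

  For the macro tier the product depends on the distance to the nearest point. Since the
  attenuation factor of the nearest point itself is the constant \<open>1 / (1 + \<delta>)\<close>, the product may be
  taken over all points. The process is then decomposed according to the geometric
  annulus \<open>q ^ k \<le> T < q ^ (k + 1)\<close> that contains the nearest point, where \<open>T\<close> is the area of the
  empty disc. Freezing \<open>T\<close> at either end of the annulus bounds the functional from both sides by
  differences of two generating functionals; by scale invariance the bounds agree up to a factor that
  tends to 1 as \<open>q\<close> tends to 1.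
\<close>

subsection \<open>Infinite products of factors in the unit interval\<close>

text \<open>The classical argument conditions on the distance to the nearest station and uses that
  the remaining points are again Poisson outside the empty disc. But \<open>homogeneous_ppp\<close>
  describes counts in deterministic sets only, and the empty disc is random. The substitute for
  conditioning is a test function that vanishes on a fixed disc: it makes the product zero unless
  that disc is empty, so a single generating functional yields the void event together with the
  product frozen at a constant distance. This is why differences of generating functionals isolate
  an annulus. Radii enter through the area t = pi r^2. Planar Lebesgue measure then becomes Lebesgue
  measure on the half-line, and (z / r)^\<alpha> becomes (c / t)^(\<alpha> / 2), a function of c / t
  alone; hence the integral of 1 - 1 / (1 + \<delta> (c / t)^(\<alpha> / 2)) from t = c is c times
  the constant \<open>G \<delta> \<alpha>\<close>. Helpers may be closer than the serving station,
  so their integral runs over the whole half-line and gives \<open>H\<close>. Products live in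
  \<open>ennreal\<close>, where infima always exist and Tonelli's theorem needs no
  integrability.\<close>

text \<open>For factors in the unit interval the partial products decrease, so the infimum is the limit.\<close>

definition iprod :: "(nat \<Rightarrow> real) \<Rightarrow> ennreal" where
  "iprod a = (INF n. \<Prod>j<n. ennreal (a j))"

lemma iprod_tendsto:
  assumes "\<And>j. 0 \<le> a j" "\<And>j. a j \<le> 1"
  shows "(\<lambda>n. ennreal (\<Prod>j<n. a j)) \<longlonglongrightarrow> iprod a"
proof -
  have "decseq (\<lambda>n. \<Prod>j<n. ennreal (a j))"
    using assms by (intro decseq_SucI) (auto simp: ennreal_le_1 intro!: mult_left_le)
  from LIMSEQ_INF[OF this] show ?thesis
    using assms by (simp add: iprod_def prod_ennreal)
qed

lemma measurable_iprod[measurable (raw)]: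
  assumes [measurable]: "\<And>j. (\<lambda>x. f x j) \<in> borel_measurable M"
  shows "(\<lambda>x. iprod (f x)) \<in> borel_measurable M"
  unfolding iprod_def by measurable

lemma iprod_eventually_const:
  assumes "\<And>j. 0 \<le> a j" "\<And>j. a j \<le> 1" and F: "finite F" "\<And>j. j \<notin> F \<Longrightarrow> a j = 1"
  shows "iprod a = ennreal (\<Prod>j\<in>F. a j)"
proof -
  obtain m where m: "F \<subseteq> {..<m}" using F(1) finite_nat_iff_bounded by auto
  have "(\<Prod>j<n. a j) = (\<Prod>j\<in>F. a j)" if "n \<ge> m" for n
    using m that F(2) by (intro prod.mono_neutral_right) auto
  then have "\<forall>\<^sub>F n in sequentially. ennreal (\<Prod>j<n. a j) = ennreal (\<Prod>j\<in>F. a j)"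
    unfolding eventually_sequentially by (intro exI[of _ m]) auto
  then have "(\<lambda>n. ennreal (\<Prod>j<n. a j)) \<longlonglongrightarrow> ennreal (\<Prod>j\<in>F. a j)"
    by (rule tendsto_eventually)
  from LIMSEQ_unique[OF iprod_tendsto[OF assms(1,2)] this] show ?thesis by simp
qed

lemma iprod_mono:
  assumes "\<And>j. a j \<le> b j"
  shows "iprod a \<le> iprod b"
  unfolding iprod_def using assms by (intro INF_mono' prod_mono_ennreal) (auto intro: ennreal_leI)

text \<open>Two infima commute, and each partial product is continuous in its finitely many factors.
  This continuity from above carries the generating functional from step functions to general
  ones.\<close>

lemma iprod_INF:
  assumes "\<And>n j. a (Suc n) j \<le> a n j" "\<And>n j. 0 \<le> a n j" "\<And>j. (\<lambda>n. a n j) \<longlonglongrightarrow> b j"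
  shows "(INF n. iprod (a n)) = iprod b"
proof -
  have "(INF n. \<Prod>j<k. ennreal (a n j)) = (\<Prod>j<k. ennreal (b j))" for k
  proof (rule LIMSEQ_unique[OF LIMSEQ_INF])
    show "decseq (\<lambda>n. \<Prod>j<k. ennreal (a n j))"
      using assms by (intro decseq_SucI prod_mono_ennreal) (auto intro: ennreal_leI)
    have "0 \<le> b j" for j
      using assms(2,3) by (intro LIMSEQ_le_const[of "\<lambda>n. a n j"]) auto
    then show "(\<lambda>n. \<Prod>j<k. ennreal (a n j)) \<longlonglongrightarrow> (\<Prod>j<k. ennreal (b j))"
      using assms by (simp add: prod_ennreal) (intro tendsto_intros assms(3) tendsto_ennrealI tendsto_prod)
  qed
  then show ?thesis
    unfolding iprod_def by (subst INF_commute) simp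
qed

lemma iprod_eq_0:
  assumes "a i = 0"
  shows "iprod a = 0"
proof -
  have "iprod a \<le> (\<Prod>j<Suc i. ennreal (a j))"
    unfolding iprod_def by (rule INF_lower) simp
  then show ?thesis using assms by (simp add: prod_zero_iff)
qed

lemma iprod_le_1: "iprod f \<le> 1"
proof -
  have "iprod f \<le> (\<Prod>j<0. ennreal (f j))" unfolding iprod_def by (rule INF_lower) simp
  then show ?thesis by simp
qed

text \<open>All partial products beyond \<open>i\<close> contain the factor \<open>f i\<close>, so
  it can be divided out. Later \<open>i\<close> is the serving station, whose factor is 1 / (1 +
  \<delta>) whichever index serves.\<close>

lemma iprod_remove:
  assumes f: "\<And>j. 0 \<le> f j" "\<And>j. f j \<le> 1" and i: "0 < f i"
  shows "iprod (\<lambda>j. if j = i then 1 else f j) = ennreal (1 / f i) * iprod f"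
proof -
  have "(\<Prod>j<n. if j = i then 1 else f j) = 1 / f i * (\<Prod>j<n. f j)" if "i < n" for n
  proof -
    have "(\<Prod>j<n. f j) = f i * (\<Prod>j\<in>{..<n} - {i}. f j)"
      using that by (intro prod.remove) auto
    moreover have "(\<Prod>j<n. if j = i then 1 else f j) = (\<Prod>j\<in>{..<n} - {i}. f j)"
      by (intro prod.mono_neutral_cong_right) (auto split: if_splits)
    ultimately show ?thesis using i by simp
  qed
  then have "\<forall>\<^sub>F n in sequentially. ennreal (1 / f i) * ennreal (\<Prod>j<n. f j) = ennreal (\<Prod>j<n. if j = i then 1 else f j)"
    using i f by (intro eventually_sequentiallyI[of "Suc i"]) (auto simp: ennreal_mult[symmetric] prod_nonneg)
  moreover have "(\<lambda>n. ennreal (1 / f i) * ennreal (\<Prod>j<n. f j)) \<longlonglongrightarrow> ennreal (1 / f i) * iprod f"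
    using i iprod_le_1[of f] by (intro tendsto_mult_ennreal tendsto_const iprod_tendsto f) (auto simp: top_unique)
  ultimately have "(\<lambda>n. ennreal (\<Prod>j<n. if j = i then 1 else f j)) \<longlonglongrightarrow> ennreal (1 / f i) * iprod f"
    by (rule Lim_transform_eventually[rotated])
  moreover have "(\<lambda>n. ennreal (\<Prod>j<n. if j = i then 1 else f j)) \<longlonglongrightarrow> iprod (\<lambda>j. if j = i then 1 else f j)"
    using f by (intro iprod_tendsto) auto
  ultimately show ?thesis by (rule LIMSEQ_unique[symmetric])
qed

text \<open>Since 1 plus a sum is at most the product of the terms 1 + \<kappa> * a k, a positive
  infinite product would bound the partial sums of \<open>a\<close>. Convergence of the path loss
  series is read off from a generating functional in this way.\<close>

lemma iprod_not_summable:
  assumes a: "\<And>k. 0 \<le> a k" "\<not> summable a" and \<kappa>: "0 < \<kappa>"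
  shows "iprod (\<lambda>k. 1 / (1 + \<kappa> * a k)) = 0"
proof (rule ccontr)
  assume nz: "iprod (\<lambda>k. 1 / (1 + \<kappa> * a k)) \<noteq> 0"
  have "iprod (\<lambda>k. 1 / (1 + \<kappa> * a k)) < \<infinity>" using iprod_le_1 by (rule le_less_trans) simp
  then obtain r where r: "iprod (\<lambda>k. 1 / (1 + \<kappa> * a k)) = ennreal r" "0 < r"
    using nz by (cases "iprod (\<lambda>k. 1 / (1 + \<kappa> * a k))") auto
  have "sum a {..<n} \<le> (1 / r - 1) / \<kappa>" for n
  proof -
    have ge: "1 + \<kappa> * sum a {..<n} \<le> (\<Prod>k<n. 1 + \<kappa> * a k)" for n
    proof (induction n)
      case (Suc n)
      have "1 + \<kappa> * sum a {..<Suc n} \<le> (1 + \<kappa> * sum a {..<n}) * (1 + \<kappa> * a n)"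
        using a \<kappa> by (simp add: algebra_simps sum_nonneg)
      also have "\<dots> \<le> (\<Prod>k<n. 1 + \<kappa> * a k) * (1 + \<kappa> * a n)"
        using a \<kappa> by (intro mult_right_mono Suc) auto
      finally show ?case by simp
    qed simp
    have pos: "0 < 1 + \<kappa> * sum a {..<n}" using a \<kappa> by (simp add: add_pos_nonneg sum_nonneg)
    have "ennreal r \<le> (\<Prod>k<n. ennreal (1 / (1 + \<kappa> * a k)))"
      unfolding r(1)[symmetric] iprod_def by (rule INF_lower) simp
    also have "\<dots> = ennreal (1 / (\<Prod>k<n. 1 + \<kappa> * a k))"
      using a \<kappa> by (subst prod_ennreal) (auto simp: prod_dividef)
    also have "\<dots> \<le> ennreal (1 / (1 + \<kappa> * sum a {..<n}))"
      using ge[of n] pos by (intro ennreal_leI divide_left_mono) (auto intro: mult_pos_pos)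
    finally have "r \<le> 1 / (1 + \<kappa> * sum a {..<n})"
      using pos by (subst (asm) ennreal_le_iff) auto
    then show ?thesis using pos r \<kappa> by (simp add: field_simps)
  qed
  then have "summable a" using a(1) by (intro summableI_nonneg_bounded[where x = "(1 / r - 1) / \<kappa>"]) auto
  with a(2) show False by simp
qed

subsection \<open>Generating functional of a Poisson process\<close>

context prob_space
begin

lemma measurable_num_points:
  assumes "homogeneous_ppp lam X" and B: "B \<in> sets borel"
  shows "num_points X B \<in> borel_measurable M"
proof -
  have [measurable]: "X j \<in> borel_measurable M" for j
    using assms by (auto simp: homogeneous_ppp_def)
  have "num_points X B = (\<lambda>\<omega>. \<Sum>j. indicator B (X j \<omega>))"
  proof
    fix \<omega>
    have "num_points X B \<omega> = (\<integral>\<^sup>+j. indicator {j. X j \<omega> \<in> B} j \<partial>count_space UNIV)"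
      by (simp add: num_points_def)
    also have "\<dots> = (\<Sum>j. indicator {j. X j \<omega> \<in> B} j)"
      by (rule nn_integral_count_space_nat)
    finally show "num_points X B \<omega> = (\<Sum>j. indicator B (X j \<omega>))"
      by (simp add: indicator_def)
  qed
  then show ?thesis using B by simp
qed

text \<open>The Poisson weights of the finite counts already sum to 1, which leaves no mass for an
  infinite count. Finiteness matters because \<open>card\<close> of an infinite set is 0. The second
  conclusion is the probability generating function of a Poisson variable.\<close>

lemma poisson_count:
  assumes X: "homogeneous_ppp lam X" and lam: "0 < lam"
    and B: "B \<in> sets borel" "emeasure lborel B < \<infinity>"
  shows "AE \<omega> in M. finite {j. X j \<omega> \<in> B}"
    and "0 \<le> c \<Longrightarrow> c \<le> 1 \<Longrightarrow>
      (\<integral>\<^sup>+\<omega>. ennreal (c ^ card {j. X j \<omega> \<in> B}) \<partial>M) = ennreal (exp (- (lam * (1 - c) * measure lborel B)))"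
proof -
  define m where "m = lam * measure lborel B"
  have m: "0 \<le> m" using lam by (simp add: m_def)
  define A where "A k = {\<omega> \<in> space M. num_points X B \<omega> = of_nat k}" for k
  have [measurable]: "num_points X B \<in> borel_measurable M"
    using X B(1) by (rule measurable_num_points)
  have A[measurable]: "A k \<in> events" for k
    unfolding A_def by measurable
  have pA: "prob (A k) = m ^ k / fact k * exp (- m)" for k
    using X B unfolding homogeneous_ppp_def A_def m_def by blast
  have disj: "disjoint_family A"
    by (auto simp: disjoint_family_on_def A_def)
  have exp_sums: "(\<lambda>k. (c * m) ^ k / fact k * exp (- m)) sums (exp (c * m) * exp (- m))" for c
    using sums_mult2[OF exp_converges[of "c * m"], of "exp (- m)"] by (simp add: field_simps)
  have "(\<lambda>k. prob (A k)) sums 1"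
    using exp_sums[of 1] by (simp add: pA exp_minus)
  moreover have "(\<lambda>k. prob (A k)) sums prob (\<Union>k. A k)"
    using A disj by (intro finite_measure_UNION) auto
  ultimately have "prob (\<Union>k. A k) = 1" by (rule sums_unique2[symmetric])
  then have ae: "AE \<omega> in M. \<omega> \<in> (\<Union>k. A k)"
    by (intro prob_eq_1[THEN iffD1]) auto
  have card: "finite {j. X j \<omega> \<in> B} \<and> card {j. X j \<omega> \<in> B} = k" if "\<omega> \<in> A k" for \<omega> k
  proof -
    have "emeasure (count_space UNIV) {j. X j \<omega> \<in> B} = of_nat k"
      using that by (simp add: A_def num_points_def)
    then show ?thesis
      by (cases "finite {j. X j \<omega> \<in> B}") auto
  qed
  show "AE \<omega> in M. finite {j. X j \<omega> \<in> B}"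
    using ae by eventually_elim (use card in blast)
  assume c: "0 \<le> c" "c \<le> 1"
  have "AE \<omega> in M. ennreal (c ^ card {j. X j \<omega> \<in> B}) = (\<Sum>k. ennreal (c ^ k) * indicator (A k) \<omega>)"
    using ae
  proof eventually_elim
    fix \<omega> assume "\<omega> \<in> (\<Union>k. A k)"
    then obtain k where k: "\<omega> \<in> A k" by blast
    show "ennreal (c ^ card {j. X j \<omega> \<in> B}) = (\<Sum>k. ennreal (c ^ k) * indicator (A k) \<omega>)"
      using suminf_cmult_indicator[OF disj k, of "\<lambda>k. ennreal (c ^ k)"] card[OF k] by simp
  qed
  then have "(\<integral>\<^sup>+\<omega>. ennreal (c ^ card {j. X j \<omega> \<in> B}) \<partial>M) = 
      (\<integral>\<^sup>+\<omega>. (\<Sum>k. ennreal (c ^ k) * indicator (A k) \<omega>) \<partial>M)"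
    by (rule nn_integral_cong_AE)
  also have "\<dots> = (\<Sum>k. ennreal (c ^ k) * emeasure M (A k))"
    by (subst nn_integral_suminf) (auto simp: nn_integral_cmult_indicator)
  also have "\<dots> = (\<Sum>k. ennreal ((c * m) ^ k / fact k * exp (- m)))"
    using c m by (simp add: emeasure_eq_measure pA power_mult_distrib mult.assoc flip: ennreal_mult)
  also have "\<dots> = ennreal (exp (c * m) * exp (- m))"
    using exp_sums[of c] c m by (intro suminf_ennreal_eq) auto
  also have "exp (c * m) * exp (- m) = exp (- (lam * (1 - c) * measure lborel B))"
    by (simp add: m_def algebra_simps flip: exp_add)
  finally show "(\<integral>\<^sup>+\<omega>. ennreal (c ^ card {j. X j \<omega> \<in> B}) \<partial>M) = 
      ennreal (exp (- (lam * (1 - c) * measure lborel B)))" .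
qed

text \<open>Grouping the points by cell turns the product into powers of \<open>c i\<close> whose
  exponents are the counts in \<open>B i\<close>. The counts are independent, so each cell
  contributes one Poisson generating function.\<close>

lemma ppp_generating_functional_step:
  fixes B :: "nat \<Rightarrow> 'b::euclidean_space set"
  assumes X: "homogeneous_ppp lam X" and lam: "0 < lam"
    and B: "disjoint_family B" "\<And>i. B i \<in> sets borel" "\<And>i. emeasure lborel (B i) < \<infinity>"
    and c: "\<And>i. 0 \<le> c i" "\<And>i. c i \<le> 1"
    and u: "\<And>i x. i < m \<Longrightarrow> x \<in> B i \<Longrightarrow> u x = c i" "\<And>x. x \<notin> (\<Union>i<m. B i) \<Longrightarrow> u x = 1"
  shows "(\<integral>\<^sup>+\<omega>. iprod (\<lambda>j. u (X j \<omega>)) \<partial>M) =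
    ennreal (exp (- (lam * (\<Sum>i<m. (1 - c i) * measure lborel (B i)))))"
proof -
  define J where "J i \<omega> = {j. X j \<omega> \<in> B i}" for i \<omega>
  have u01: "0 \<le> u x" "u x \<le> 1" for x
    using u c by (cases "x \<in> (\<Union>i<m. B i)"; force)+
  have "AE \<omega> in M. \<forall>i. finite (J i \<omega>)"
    unfolding J_def by (subst AE_all_countable) (intro allI poisson_count(1)[OF X lam B(2,3)])
  then have "AE \<omega> in M. iprod (\<lambda>j. u (X j \<omega>)) = (\<Prod>i<m. ennreal (c i ^ card (J i \<omega>)))"
  proof eventually_elim
    fix \<omega> assume fin: "\<forall>i. finite (J i \<omega>)"
    have "iprod (\<lambda>j. u (X j \<omega>)) = ennreal (\<Prod>j\<in>(\<Union>i<m. J i \<omega>). u (X j \<omega>))"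
      using u01 fin u(2) by (intro iprod_eventually_const) (auto simp: J_def)
    also have "(\<Prod>j\<in>(\<Union>i<m. J i \<omega>). u (X j \<omega>)) = (\<Prod>i<m. \<Prod>j\<in>J i \<omega>. u (X j \<omega>))"
      using fin B(1) by (intro prod.UNION_disjoint) (auto simp: J_def disjoint_family_on_def)
    also have "\<dots> = (\<Prod>i<m. c i ^ card (J i \<omega>))"
      using u(1) by (intro prod.cong refl) (simp add: J_def)
    finally show "iprod (\<lambda>j. u (X j \<omega>)) = (\<Prod>i<m. ennreal (c i ^ card (J i \<omega>)))"
      using c by (simp add: prod_ennreal)
  qed
  then have "(\<integral>\<^sup>+\<omega>. iprod (\<lambda>j. u (X j \<omega>)) \<partial>M) = (\<integral>\<^sup>+\<omega>. (\<Prod>i<m. ennreal (c i ^ card (J i \<omega>))) \<partial>M)"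
    by (rule nn_integral_cong_AE)
  also have "\<dots> = (\<Prod>i<m. \<integral>\<^sup>+\<omega>. ennreal (c i ^ card (J i \<omega>)) \<partial>M)"
  proof (rule indep_vars_nn_integral)
    have "indep_vars (\<lambda>_. borel) (\<lambda>n. num_points X (B n)) UNIV"
      using X B unfolding homogeneous_ppp_def by blast
    then have "indep_vars (\<lambda>_. borel) (\<lambda>n. num_points X (B n)) {..<m}"
      by (rule indep_vars_subset) auto
    then have "indep_vars (\<lambda>_. borel) (\<lambda>i \<omega>. ennreal (c i ^ nat \<lfloor>enn2real (num_points X (B i) \<omega>)\<rfloor>)) {..<m}"
      by (rule indep_vars_compose2) simp
    \<comment> \<open>For an infinite set both sides are 0, so the identity holds at every outcome
      and independence transfers without an exceptional set.\<close>
    moreover have "nat \<lfloor>enn2real (num_points X (B i) \<omega>)\<rfloor> = card (J i \<omega>)" for i \<omega>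
      by (cases "finite (J i \<omega>)") (auto simp: num_points_def J_def ennreal_of_nat_eq_real_of_nat)
    ultimately show "indep_vars (\<lambda>_. borel) (\<lambda>i \<omega>. ennreal (c i ^ card (J i \<omega>))) {..<m}"
      by simp
  qed auto
  also have "\<dots> = (\<Prod>i<m. ennreal (exp (- (lam * (1 - c i) * measure lborel (B i)))))"
    using poisson_count(2)[OF X lam B(2,3) c] by (simp add: J_def)
  also have "\<dots> = ennreal (exp (- (lam * (\<Sum>i<m. (1 - c i) * measure lborel (B i)))))"
    by (simp add: prod_ennreal exp_sum sum_distrib_left mult.assoc flip: sum_negf)
  finally show ?thesis .
qed

text \<open>Here \<open>d n\<close> rounds 1 - u down to a multiple of 2^(-n) and is cut off outside
  the ball of radius n, so that its level sets have finite volume. As \<open>d n\<close> increases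
  to 1 - u, the products decrease to the product of u and the integrals increase to
  \<open>I\<close>.\<close>

lemma ppp_generating_functional:
  fixes X :: "nat \<Rightarrow> 'a \<Rightarrow> 'b::euclidean_space"
  assumes X: "homogeneous_ppp lam X" and lam: "0 < lam"
    and u[measurable]: "u \<in> borel_measurable borel" and u01: "\<And>x. 0 \<le> u x" "\<And>x. u x \<le> 1"
    and I: "(\<integral>\<^sup>+x. ennreal (1 - u x) \<partial>lborel) = ennreal I" "0 \<le> I"
  shows "(\<integral>\<^sup>+\<omega>. iprod (\<lambda>j. u (X j \<omega>)) \<partial>M) = ennreal (exp (- (lam * I)))"
proof -
  have [measurable]: "X j \<in> borel_measurable M" for j
    using X by (auto simp: homogeneous_ppp_def)
  define k where "k n x = \<lfloor>2 ^ n * (1 - u x)\<rfloor>" for n x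
  define d where "d n x = (if x \<in> ball 0 (real n) then real_of_int (k n x) / 2 ^ n else 0)" for n x
  define B where "B n i = {x \<in> ball 0 (real n). k n x = int i}" for n i
  \<comment> \<open>The maximum affects only indices above 2^n, whose cells are empty; it keeps
    every value in the unit interval.\<close>
  define c where "c n i = max 0 (1 - real i / 2 ^ n)" for n i :: nat
  \<comment> \<open>The index 2^n itself occurs, on the part of the ball where u vanishes, hence the
    range up to \<open>Suc (2 ^ n)\<close>.\<close>
  define S where "S n = (\<Sum>i<Suc (2 ^ n). (1 - c n i) * measure lborel (B n i))" for n
  have [measurable]: "k n \<in> measurable borel (count_space UNIV)" for n
    unfolding k_def by measurable
  have [measurable]: "ball (0::'b) (real n) \<in> sets borel" for n by simp
  have Bm[measurable]: "B n i \<in> sets borel" for n i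
    unfolding B_def by measurable
  have [measurable]: "d n \<in> borel_measurable borel" for n
    unfolding d_def by measurable
  have Bf: "emeasure lborel (B n i) < \<infinity>" for n i
  proof -
    have "B n i \<subseteq> ball 0 (real n)" by (auto simp: B_def)
    then show ?thesis using emeasure_bounded_finite[of "B n i"] bounded_subset[OF bounded_ball] by blast
  qed
  have k0: "0 \<le> k n x" for n x using u01[of x] by (simp add: k_def)
  have k1: "k n x \<le> 2 ^ n" for n x
  proof -
    have "2 ^ n * (1 - u x) \<le> 2 ^ n" using u01[of x] by (simp add: mult_left_le)
    then have "k n x \<le> \<lfloor>2 ^ n :: real\<rfloor>" unfolding k_def by (rule floor_mono)
    also have "\<lfloor>2 ^ n :: real\<rfloor> = 2 ^ n"
      by (metis floor_of_int of_int_numeral of_int_power)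
    finally show ?thesis .
  qed
  have d0: "0 \<le> d n x" for n x using k0[of n x] by (simp add: d_def)
  have d1: "d n x \<le> 1 - u x" for n x
  proof -
    have "real_of_int (k n x) \<le> 2 ^ n * (1 - u x)" by (simp add: k_def)
    then show ?thesis using u01[of x] by (simp add: d_def field_simps)
  qed
  have d_Suc: "d n x \<le> d (Suc n) x" for n x
  proof -
    have "2 * k n x \<le> k (Suc n) x"
      unfolding k_def by (auto simp: le_floor_iff mult.assoc intro!: mult_left_mono)
    then have "real_of_int (2 * k n x) \<le> real_of_int (k (Suc n) x)" by linarith
    then show ?thesis using k0[of "Suc n" x]
      by (auto simp: d_def field_simps)
  qed
  have d_lim: "(\<lambda>n. d n x) \<longlonglongrightarrow> 1 - u x" for x
  proof (rule tendsto_sandwich)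
    show "\<forall>\<^sub>F n in sequentially. 1 - u x - (1/2) ^ n \<le> d n x"
    proof -
      obtain n0 where n0: "norm x < real n0" using reals_Archimedean2 by blast
      have "1 - u x - (1/2) ^ n \<le> d n x" if "n \<ge> n0" for n
      proof -
        have "x \<in> ball 0 (real n)" using n0 that by simp
        moreover have "2 ^ n * (1 - u x) \<le> real_of_int (k n x) + 1" by (simp add: k_def)
        then have "1 - u x \<le> (real_of_int (k n x) + 1) / 2 ^ n"
          by (simp add: pos_le_divide_eq mult.commute)
        ultimately show ?thesis by (simp add: d_def power_divide add_divide_distrib)
      qed
      then show ?thesis by (auto simp: eventually_sequentially)
    qed
    have "(\<lambda>n. 1 - u x - (1/2) ^ n) \<longlonglongrightarrow> 1 - u x - 0"
      by (intro tendsto_intros LIMSEQ_power_zero) auto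
    then show "(\<lambda>n. 1 - u x - (1/2) ^ n) \<longlonglongrightarrow> 1 - u x" by simp
  qed (use d1 in auto)
  have S_eq: "ennreal (S n) = (\<integral>\<^sup>+x. ennreal (d n x) \<partial>lborel)" for n
  proof -
    have *: "ennreal (d n x) = (\<Sum>i<Suc (2 ^ n). ennreal (1 - c n i) * indicator (B n i) x)" for x
    proof (cases "x \<in> ball 0 (real n)")
      case True
      define i where "i = nat (k n x)"
      have i: "k n x = int i" "i \<le> 2 ^ n" using k0[of n x] k1[of n x] by (auto simp: i_def nat_le_iff)
      have "(\<Sum>i<Suc (2 ^ n). ennreal (1 - c n i) * indicator (B n i) x) =
          (\<Sum>i'<Suc (2 ^ n). if i' = i then ennreal (1 - c n i) else 0)"
        using True i by (intro sum.cong refl) (auto simp: B_def indicator_def)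
      also have "\<dots> = ennreal (1 - c n i)" using i by simp
      also have "1 - c n i = d n x"
        using True i by (auto simp: c_def d_def max_def field_simps)
      finally show ?thesis by simp
    qed (simp add: d_def B_def)
    then have "(\<integral>\<^sup>+x. ennreal (d n x) \<partial>lborel) =
        (\<Sum>i<Suc (2 ^ n). ennreal (1 - c n i) * emeasure lborel (B n i))"
      by (simp only: *) (subst nn_integral_sum, auto simp: nn_integral_cmult_indicator simp del: sum.lessThan_Suc)
    also have "\<dots> = (\<Sum>i<Suc (2 ^ n). ennreal ((1 - c n i) * measure lborel (B n i)))"
    proof (intro sum.cong refl)
      fix i
      have "emeasure lborel (B n i) = ennreal (measure lborel (B n i))" "0 \<le> 1 - c n i"
        using Bf[of n i] by (auto simp: c_def emeasure_eq_ennreal_measure)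
      then show "ennreal (1 - c n i) * emeasure lborel (B n i) = ennreal ((1 - c n i) * measure lborel (B n i))"
        by (simp only: ennreal_mult measure_nonneg)
    qed
    also have "\<dots> = ennreal (S n)"
      unfolding S_def by (intro sum_ennreal) (auto simp: c_def)
    finally show ?thesis by simp
  qed
  have "(\<lambda>n. \<integral>\<^sup>+x. ennreal (d n x) \<partial>lborel) \<longlonglongrightarrow> (\<integral>\<^sup>+x. ennreal (1 - u x) \<partial>lborel)"
    using d_Suc d_lim by (intro nn_integral_LIMSEQ incseq_SucI le_funI ennreal_leI tendsto_ennrealI) auto
  then have "(\<lambda>n. ennreal (S n)) \<longlonglongrightarrow> ennreal I" by (simp add: S_eq I)
  moreover have S0: "0 \<le> S n" for n unfolding S_def by (intro sum_nonneg) (auto simp: c_def)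
  ultimately have "S \<longlonglongrightarrow> I" using I(2) by (simp add: tendsto_ennreal_iff)
  then have "(\<lambda>n. ennreal (exp (- (lam * S n)))) \<longlonglongrightarrow> ennreal (exp (- (lam * I)))"
    by (intro tendsto_intros tendsto_ennrealI)
  moreover have "(\<integral>\<^sup>+\<omega>. iprod (\<lambda>j. 1 - d n (X j \<omega>)) \<partial>M) = ennreal (exp (- (lam * S n)))" for n
    unfolding S_def
  proof (rule ppp_generating_functional_step[OF X lam])
    show "disjoint_family (B n)" by (auto simp: disjoint_family_on_def B_def)
    show "1 - d n x = c n i" if "i < Suc (2 ^ n)" "x \<in> B n i" for i x
      using that by (auto simp: d_def B_def c_def max_def field_simps)
    show "1 - d n x = 1" if "x \<notin> (\<Union>i<Suc (2 ^ n). B n i)" for x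
    proof (cases "x \<in> ball 0 (real n)")
      case True
      then have "x \<in> B n (nat (k n x))" using k0[of n x] by (auto simp: B_def)
      moreover have "nat (k n x) < Suc (2 ^ n)" using k1[of n x] by (auto simp: nat_le_iff less_Suc_eq_le)
      ultimately show ?thesis using that by blast
    qed (simp add: d_def)
  qed (use Bf in \<open>auto simp: c_def\<close>)
  ultimately have lim: "(\<lambda>n. \<integral>\<^sup>+\<omega>. iprod (\<lambda>j. 1 - d n (X j \<omega>)) \<partial>M) \<longlonglongrightarrow> ennreal (exp (- (lam * I)))"
    by simp
  have D01: "0 \<le> 1 - d n x" "1 - d n x \<le> 1" for n x
    using d0[of n x] d1[of n x] u01[of x] by linarith+
  have dec: "decseq (\<lambda>n \<omega>. iprod (\<lambda>j. 1 - d n (X j \<omega>)))"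
    using d_Suc by (intro decseq_SucI le_funI iprod_mono) auto
  have "(\<integral>\<^sup>+\<omega>. iprod (\<lambda>j. u (X j \<omega>)) \<partial>M) = (\<integral>\<^sup>+\<omega>. (INF n. iprod (\<lambda>j. 1 - d n (X j \<omega>))) \<partial>M)"
  proof (intro nn_integral_cong iprod_INF[symmetric])
    show "(\<lambda>n. 1 - d n (X j \<omega>)) \<longlonglongrightarrow> u (X j \<omega>)" for j \<omega>
      using tendsto_diff[OF tendsto_const d_lim, of 1 "X j \<omega>"] by simp
  qed (use d_Suc D01 in auto)
  \<comment> \<open>Monotone convergence for a decreasing sequence needs one finite integral; the
    explicit value at n = 0 supplies it.\<close>
  also have "\<dots> = (INF n. \<integral>\<^sup>+\<omega>. iprod (\<lambda>j. 1 - d n (X j \<omega>)) \<partial>M)"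
  proof (rule nn_integral_monotone_convergence_INF_decseq[OF dec, of _ 0])
    show "(\<integral>\<^sup>+\<omega>. iprod (\<lambda>j. 1 - d 0 (X j \<omega>)) \<partial>M) < \<infinity>"
      using \<open>\<And>n. (\<integral>\<^sup>+\<omega>. iprod (\<lambda>j. 1 - d n (X j \<omega>)) \<partial>M) = ennreal (exp (- (lam * S n)))\<close> by simp
  qed measurable
  also have "\<dots> = ennreal (exp (- (lam * I)))"
  proof (rule LIMSEQ_unique[OF LIMSEQ_INF lim])
    show "decseq (\<lambda>n. \<integral>\<^sup>+\<omega>. iprod (\<lambda>j. 1 - d n (X j \<omega>)) \<partial>M)"
      using d_Suc by (intro decseq_SucI nn_integral_mono iprod_mono) auto
  qed
  finally show ?thesis .
qed

end

subsection \<open>Planar and special-function integrals\<close>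

lemma borel_measure_eq_lborel_nonneg:
  fixes \<mu> :: "real measure"
  assumes sets: "sets \<mu> = sets borel" and em: "\<And>t. emeasure \<mu> {..t} = ennreal t"
  shows "\<mu> = density lborel (indicator {0..})"
proof -
  let ?\<nu> = "density lborel (indicator {0::real..})"
  have em': "emeasure ?\<nu> {..t} = ennreal t" for t
  proof -
    have "emeasure ?\<nu> {..t} = emeasure lborel ({0..} \<inter> {..t})"
      by (simp add: emeasure_density indicator_inter_arith[symmetric] del: Int_atMost)
    also have "{0..} \<inter> {..t} = {0..t}" by auto
    finally show "emeasure ?\<nu> {..t} = ennreal t"
      by (cases "0 \<le> t") (auto simp: ennreal_neg)
  qed
  show ?thesis
  proof (rule measure_eqI_generator_eq[where \<Omega>=UNIV and E="range atMost" and A="\<lambda>n. {..real n}"])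
    show "Int_stable (range atMost :: real set set)" by (auto simp: Int_stable_def)
    show "sets \<mu> = sigma_sets UNIV (range atMost)" "sets ?\<nu> = sigma_sets UNIV (range atMost)"
      using sets by (auto simp: borel_eq_atMost[where 'a=real] full_SetCompr_eq)
    show "(\<Union>i. {..real i}) = UNIV" by (auto intro: real_arch_simple)
  qed (use em em' in auto)
qed

text \<open>The preimage of \<open>{..t}\<close> under the area map is a disc of area t, so the
  image of planar Lebesgue measure is Lebesgue measure on the half-line. This takes the place of
  polar coordinates: the Jacobian is absorbed into the coordinate.\<close>

lemma nn_integral_radial:
  fixes f :: "real \<Rightarrow> ennreal"
  assumes [measurable]: "f \<in> borel_measurable borel"
  shows "(\<integral>\<^sup>+x. f (pi * (norm (x :: real^2))\<^sup>2) \<partial>lborel) = (\<integral>\<^sup>+t\<in>{0..}. f t \<partial>lborel)"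
proof -
  let ?g = "\<lambda>x :: real^2. pi * (norm x)\<^sup>2"
  let ?\<mu> = "distr lborel borel ?g"
  have "emeasure ?\<mu> {..t} = ennreal t" for t
  proof -
    have "emeasure ?\<mu> {..t} = emeasure lborel (?g -` {..t})"
      by (subst emeasure_distr) auto
    also have "\<dots> = ennreal t"
    proof (cases "0 \<le> t")
      case True
      have "?g -` {..t} = cball 0 (sqrt (t / pi))"
      proof -
        have "norm x \<le> sqrt y \<longleftrightarrow> (norm x)\<^sup>2 \<le> y" for x :: "real^2" and y
          by (metis abs_norm_cancel real_sqrt_abs real_sqrt_le_iff)
        then show ?thesis by (auto simp: pos_le_divide_eq mult.commute)
      qed
      then have "emeasure lborel (?g -` {..t}) = ennreal (unit_ball_vol 2 * (sqrt (t / pi))\<^sup>2)"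
        using True by (simp add: emeasure_cball)
      also have "unit_ball_vol 2 = pi" by (rule unit_ball_vol_2)
      finally show ?thesis using True by simp
    next
      case False
      have "0 \<le> ?g x" for x by simp
      then have "?g -` {..t} = {}"
        using False order_trans[of 0 "?g _" t] by blast
      then show ?thesis using False by (simp add: ennreal_neg)
    qed
    finally show ?thesis .
  qed
  then have "?\<mu> = density lborel (indicator {0..})"
    by (intro borel_measure_eq_lborel_nonneg) auto
  then have "(\<integral>\<^sup>+t. f t \<partial>?\<mu>) = (\<integral>\<^sup>+t. f t \<partial>density lborel (indicator {0..}))" by simp
  then show ?thesis
    by (simp add: nn_integral_distr nn_integral_density mult.commute)
qed

text \<open>The same comparison of distribution functions in dimension one: the density 2 pi z in
  the radius is the density 1 in the area. The factor 2 pi z of the final integral originates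
  here.\<close>

lemma nn_integral_disc_area:
  fixes f :: "real \<Rightarrow> ennreal"
  assumes [measurable]: "f \<in> borel_measurable borel"
  shows "(\<integral>\<^sup>+z\<in>{0<..}. ennreal (2 * pi * z) * f (pi * z\<^sup>2) \<partial>lborel) = (\<integral>\<^sup>+t\<in>{0<..}. f t \<partial>lborel)"
proof -
  let ?\<mu> = "distr (density lborel (\<lambda>z. ennreal (2 * pi * z) * indicator {0<..} z)) borel (\<lambda>z. pi * z\<^sup>2)"
  have "emeasure ?\<mu> {..t} = ennreal t" for t
  proof (cases "0 \<le> t")
    case True
    have "emeasure ?\<mu> {..t} = (\<integral>\<^sup>+z. ennreal (2 * pi * z) * indicator {0<..} z * indicator ((\<lambda>z. pi * z\<^sup>2) -` {..t}) z \<partial>lborel)"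
    proof -
      have "(\<lambda>z :: real. pi * z\<^sup>2) -` {..t} \<in> sets borel"
        by (rule measurable_sets_borel[of _ borel]) measurable
      then show ?thesis by (simp add: emeasure_distr emeasure_density)
    qed
    also have "\<dots> = (\<integral>\<^sup>+z. ennreal (2 * pi * z) * indicator {0..sqrt (t / pi)} z \<partial>lborel)"
    proof (intro nn_integral_cong)
      fix z :: real
      have "pi * z\<^sup>2 \<le> t \<longleftrightarrow> z \<le> sqrt (t / pi)" if "0 < z"
        using that True real_le_rsqrt[of z "t / pi"] real_sqrt_ge_zero[of "t / pi"]
          power_mono[of z "sqrt (t / pi)" 2] by (auto simp: pos_le_divide_eq mult.commute)
      then show "ennreal (2 * pi * z) * indicator {0<..} z * indicator ((\<lambda>z. pi * z\<^sup>2) -` {..t}) z =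
          ennreal (2 * pi * z) * indicator {0..sqrt (t / pi)} z"
        by (cases "z = 0") (auto simp: indicator_def)
    qed
    also have "\<dots> = ennreal (pi * (sqrt (t / pi))\<^sup>2 - pi * 0\<^sup>2)"
      using True by (intro nn_integral_FTC_Icc) (auto intro!: derivative_eq_intros)
    also have "\<dots> = ennreal t" using True by simp
    finally show ?thesis .
  next
    case False
    moreover have "0 \<le> pi * z\<^sup>2" for z :: real by simp
    ultimately have "(\<lambda>z. pi * z\<^sup>2) -` {..t} = {}"
      using order_trans[of 0 "pi * _\<^sup>2" t] by blast
    then show ?thesis using False by (subst emeasure_distr) (auto simp: ennreal_neg)
  qed
  then have "?\<mu> = density lborel (indicator {0..})"
    by (intro borel_measure_eq_lborel_nonneg) auto
  then have "(\<integral>\<^sup>+t. f t \<partial>?\<mu>) = (\<integral>\<^sup>+t. f t \<partial>density lborel (indicator {0..}))" by simp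
  then have "(\<integral>\<^sup>+z\<in>{0<..}. ennreal (2 * pi * z) * f (pi * z\<^sup>2) \<partial>lborel) = (\<integral>\<^sup>+t\<in>{0..}. f t \<partial>lborel)"
    by (simp add: nn_integral_distr nn_integral_density mult_ac)
  also have "\<dots> = (\<integral>\<^sup>+t\<in>{0<..}. f t \<partial>lborel)"
  proof (rule nn_integral_cong_AE)
    show "AE t in lborel. f t * indicator {0..} t = f t * indicator {0<..} t"
      using AE_lborel_singleton[of "0::real"] by eventually_elim (auto simp: indicator_def)
  qed
  finally show ?thesis .
qed

section \<open>Integral representations of \<open>G\<close> and \<open>H\<close>\<close>

lemma nn_integral_change_of_variables:
  fixes f g g' :: "real \<Rightarrow> real"
  assumes S: "S \<in> sets borel"
    and g: "\<And>x. x \<in> S \<Longrightarrow> (g has_field_derivative g' x) (at x within S)" "inj_on g S"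
    and f: "\<And>x. x \<in> S \<Longrightarrow> 0 \<le> f (g x)"
    and I: "((\<lambda>x. \<bar>g' x\<bar> * f (g x)) has_integral I) S"
    and m: "set_borel_measurable borel (g ` S) f" "g ` S \<in> sets borel"
  shows "(\<integral>\<^sup>+t\<in>g ` S. ennreal (f t) \<partial>lborel) = ennreal I"
proof -
  have "(\<lambda>x. \<bar>g' x\<bar> * f (g x)) absolutely_integrable_on S"
    using I f by (intro nonnegative_absolutely_integrable_1) auto
  then have "f absolutely_integrable_on (g ` S) \<and> integral (g ` S) f = I"
    using has_absolute_integral_change_of_variables_1'[of S g g' f I] S g I by (auto simp: integral_unique)
  then have "(f has_integral I) (g ` S)"
    using has_integral_integrable_integral set_lebesgue_integral_eq_integral(1) by blast
  then have "((\<lambda>t. if t \<in> g ` S then f t else 0) has_integral I) UNIV"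
    by (simp add: has_integral_restrict_UNIV)
  moreover have "(\<lambda>t. if t \<in> g ` S then f t else 0) = (\<lambda>t. indicator (g ` S) t *\<^sub>R f t)"
    by (auto simp: indicator_def)
  ultimately have "(\<integral>\<^sup>+t. ennreal (indicator (g ` S) t *\<^sub>R f t) \<partial>lborel) = ennreal I"
    using m f by (intro nn_integral_has_integral_lborel) (auto simp: set_borel_measurable_def indicator_def)
  moreover have "ennreal (indicator (g ` S) t *\<^sub>R f t) = ennreal (f t) * indicator (g ` S) t" for t
    by (auto simp: indicator_def)
  ultimately show ?thesis by simp
qed

text \<open>The interval is open because the substitution in the next lemma maps 0 to infinity.\<close>

lemma G_eq_integral:
  assumes "2 < \<alpha>" "0 < \<delta>"
  defines "b \<equiv> 1 - 2 / \<alpha>"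
  shows "((\<lambda>s. 1 / (1 + \<delta> * s powr (1 / b))) has_integral (\<alpha> - 2) / (2 * \<delta>) * G \<delta> \<alpha>) {0<..<1}"
proof -
  define f where "f s = 1 / (1 + \<delta> * s powr (1 / b))" for s :: real
  have b: "0 < b" using assms by (simp add: field_simps)
  have pos: "0 < 1 + \<delta> * s powr (1 / b)" for s using assms by (simp add: add_pos_nonneg)
  have "continuous_on {0..1} f"
    unfolding f_def using b pos
    by (intro continuous_intros continuous_on_powr') (auto simp: less_imp_neq[symmetric])
  then have f: "f integrable_on {0..1}" by (rule integrable_continuous_real)
  have "- complex_of_real \<delta> \<in> slit_plane" using assms by (simp add: slit_plane_def)
  then have "hyp2F1 1 (of_real b) (of_real (b + 1)) (- of_real \<delta>) =
      integral {0..1} (\<lambda>s. 1 / (1 - - of_real \<delta> * complex_of_real (s powr (1 / b))))"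
    by (rule hyp2F1_1_eq_integral[OF b])
  also have "\<dots> = integral {0..1} (\<lambda>s. complex_of_real (f s))"
    by (simp add: f_def)
  also have "\<dots> = complex_of_real (integral {0..1} f)"
    using integral_linear[OF f bounded_linear_of_real[where 'a=complex]] by (simp add: o_def)
  finally have "G \<delta> \<alpha> = 2 * \<delta> / (\<alpha> - 2) * integral {0..1} f"
    by (simp add: G_def b_def)
  then have "integral {0..1} f = (\<alpha> - 2) / (2 * \<delta>) * G \<delta> \<alpha>"
    using assms by (simp add: field_simps)
  then show ?thesis
    using f unfolding f_def has_integral_Icc_iff_Ioo[symmetric] by (simp add: has_integral_iff)
qed

text \<open>The substitution t = a s^(-1/c) with c = \<alpha> / 2 - 1 reduces the tail integral to
  Euler's integral for \<open>G\<close>. As the integrand depends on a / t only, \<open>a\<close>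
  enters as a mere factor.\<close>

lemma nn_integral_G:
  assumes "2 < \<alpha>" "0 < \<delta>" "0 < a"
  shows "(\<integral>\<^sup>+t\<in>{a..}. ennreal (1 - 1 / (1 + \<delta> * (a / t) powr (\<alpha> / 2))) \<partial>lborel) = ennreal (a * G \<delta> \<alpha>)"
    and "0 \<le> G \<delta> \<alpha>"
proof -
  define b where "b = 1 - 2 / \<alpha>"
  define c where "c = \<alpha> / 2 - 1"
  have c: "0 < c" using assms by (simp add: c_def)
  have bc: "1 / b = \<alpha> / (2 * c)" "1 / c + 1 = 1 / b"
    using assms by (auto simp: b_def c_def field_simps)
  \<comment> \<open>The exponent is chosen so that the Jacobian power s^(-1/b) cancels the power
    s^(1/b) in the numerator of \<open>f (g s)\<close>; this rests on 1 / c + 1 = 1 / b.\<close>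
  define g where "g s = a * s powr (- 1 / c)" for s :: real
  define g' where "g' s = a * (- 1 / c) * s powr (- 1 / c - 1)" for s :: real
  define f where "f t = 1 - 1 / (1 + \<delta> * (a / t) powr (\<alpha> / 2))" for t
  note int = G_eq_integral[OF assms(1,2), folded b_def]
  have img: "g ` {0<..<1} = {a<..}"
  proof (intro subset_antisym subsetI)
    fix t assume "t \<in> g ` {0<..<1}"
    then obtain s where s: "0 < s" "s < 1" "t = g s" by auto
    have "1 < s powr (- 1 / c)"
      using s c powr01_less_one[of s "1 / c"] by (simp add: powr_minus field_simps)
    then show "t \<in> {a<..}" using assms s by (simp add: g_def)
  next
    fix t assume t: "t \<in> {a<..}"
    have "t = g ((a / t) powr c)"
      using t assms c by (simp add: g_def powr_powr powr_minus divide_simps)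
    moreover have "(a / t) powr c < 1" using t assms c by (subst powr01_less_one) auto
    moreover have "0 < (a / t) powr c" using t assms by simp
    ultimately show "t \<in> g ` {0<..<1}" by auto
  qed
  have fg: "\<bar>g' s\<bar> * f (g s) = a * \<delta> / c * (1 / (1 + \<delta> * s powr (1 / b)))" if s: "s \<in> {0<..<1}" for s
  proof -
    have p: "(a / g s) powr (\<alpha> / 2) = s powr (1 / b)"
    proof -
      have "a / g s = s powr (1 / c)" using s assms by (simp add: g_def powr_minus field_simps)
      then show ?thesis using bc(1) by (simp add: powr_powr mult.commute)
    qed
    have pos: "0 < 1 + \<delta> * s powr (1 / b)" using assms by (simp add: add_pos_nonneg)
    have e: "- 1 / c - 1 = - (1 / b)" unfolding bc(2)[symmetric] by simp
    have "\<bar>g' s\<bar> = a / c * s powr (- (1 / b))"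
      using s assms c unfolding g'_def e by (simp add: abs_mult)
    then have "\<bar>g' s\<bar> * f (g s) = a / c * s powr (- (1 / b)) * (\<delta> * s powr (1 / b) / (1 + \<delta> * s powr (1 / b)))"
      using pos unfolding f_def p by (simp add: field_simps)
    also have "\<dots> = a * \<delta> / c * (1 / (1 + \<delta> * s powr (1 / b))) * (s powr (- (1 / b)) * s powr (1 / b))"
      by (simp add: field_simps)
    also have "s powr (- (1 / b)) * s powr (1 / b) = 1"
      using s by (simp flip: powr_add)
    finally show ?thesis by simp
  qed
  have "((\<lambda>s. a * \<delta> / c * (1 / (1 + \<delta> * s powr (1 / b)))) has_integral a * \<delta> / c * ((\<alpha> - 2) / (2 * \<delta>) * G \<delta> \<alpha>)) {0<..<1}"
    by (intro has_integral_mult_right int)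
  also have "a * \<delta> / c * ((\<alpha> - 2) / (2 * \<delta>) * G \<delta> \<alpha>) = a * G \<delta> \<alpha>"
    using assms by (simp add: c_def field_simps)
  finally have I: "((\<lambda>s. \<bar>g' s\<bar> * f (g s)) has_integral a * G \<delta> \<alpha>) {0<..<1}"
    by (rule has_integral_eq[rotated]) (use fg in auto)
  have "(\<integral>\<^sup>+t\<in>g ` {0<..<1}. ennreal (f t) \<partial>lborel) = ennreal (a * G \<delta> \<alpha>)"
  proof (rule nn_integral_change_of_variables[where g' = g'])
    show "(g has_field_derivative g' x) (at x within {0<..<1})" if "x \<in> {0<..<1}" for x
      unfolding g_def g'_def using that by (auto intro!: derivative_eq_intros)
    show "inj_on g {0<..<1}"
    proof (rule inj_onI)
      fix x y assume "x \<in> {0<..<1}" "y \<in> {0<..<1}" "g x = g y"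
      then have "(x powr (- 1 / c)) powr (- c) = (y powr (- 1 / c)) powr (- c)" "0 < x" "0 < y"
        using assms by (auto simp: g_def)
      then show "x = y" using c by (simp add: powr_powr)
    qed
    show "0 \<le> f (g x)" if "x \<in> {0<..<1}" for x
      using assms by (simp add: f_def divide_le_eq add_pos_nonneg)
    show "set_borel_measurable borel (g ` {0<..<1}) f"
      unfolding img f_def set_borel_measurable_def by measurable
  qed (use I img in auto)
  moreover have "AE t in lborel. t \<noteq> a" by (rule AE_lborel_singleton)
  then have "(\<integral>\<^sup>+t\<in>{a..}. ennreal (f t) \<partial>lborel) = (\<integral>\<^sup>+t\<in>{a<..}. ennreal (f t) \<partial>lborel)"
  proof (intro nn_integral_cong_AE)
    show "AE t in lborel. ennreal (f t) * indicator {a..} t = ennreal (f t) * indicator {a<..} t"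
      using \<open>AE t in lborel. t \<noteq> a\<close> by eventually_elim (auto simp: indicator_def)
  qed
  ultimately show "(\<integral>\<^sup>+t\<in>{a..}. ennreal (1 - 1 / (1 + \<delta> * (a / t) powr (\<alpha> / 2))) \<partial>lborel) = ennreal (a * G \<delta> \<alpha>)"
    unfolding img f_def by simp
  have "0 \<le> (\<alpha> - 2) / (2 * \<delta>) * G \<delta> \<alpha>"
    using int by (rule has_integral_nonneg) (use assms in \<open>simp add: add_nonneg_nonneg\<close>)
  then show "0 \<le> G \<delta> \<alpha>"
    using assms by (simp add: zero_le_mult_iff zero_le_divide_iff)
qed

text \<open>Layer-cake formula: the lengths of the superlevel sets are integrated instead. For 0 < s
  < 1 the set where F exceeds s is an interval starting at 0 of length \<kappa>^b ((1 - s) / s)^b,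
  and integrating this over s is a Beta integral.\<close>

lemma nn_integral_H:
  assumes "2 < \<alpha>" "0 < \<kappa>"
  shows "(\<integral>\<^sup>+t\<in>{0<..}. ennreal (1 - 1 / (1 + \<kappa> * t powr - (\<alpha> / 2))) \<partial>lborel) = ennreal (H \<kappa> \<alpha>)"
proof -
  define b where "b = 2 / \<alpha>"
  have b: "0 < b" "b < 1" "\<alpha> / 2 = 1 / b" using assms by (auto simp: b_def)
  define F where "F t = 1 - 1 / (1 + \<kappa> * t powr - (1 / b))" for t
  define y where "y s = ((1 - s) / s) powr b" for s :: real
  have sub: "F t > s \<longleftrightarrow> t < \<kappa> powr b * y s" if t: "0 < t" and s: "0 < s" "s < 1" for s t
  proof -
    have p: "0 < \<kappa> * t powr - (1 / b)" using t assms by simp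
    have "F t > s \<longleftrightarrow> 1 / (1 + \<kappa> * t powr - (1 / b)) < 1 - s" by (auto simp: F_def)
    also have "\<dots> \<longleftrightarrow> s < (1 - s) * (\<kappa> * t powr - (1 / b))"
      using p s by (simp add: pos_divide_less_eq add_pos_pos) (simp add: algebra_simps)
    also have "\<dots> \<longleftrightarrow> t powr (1 / b) < \<kappa> * ((1 - s) / s)"
      using t s by (simp add: powr_minus field_simps)
    also have "\<dots> \<longleftrightarrow> (t powr (1 / b)) powr b < (\<kappa> * ((1 - s) / s)) powr b"
      (is "?A < ?B \<longleftrightarrow> _")
    proof -
      have "0 < ?A" "0 < ?B" using t s assms by auto
      then show ?thesis using powr_less_mono2[OF b(1), of ?A ?B] powr_less_cancel2[OF b(1), of ?A ?B] by argo
    qed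
    also have "\<dots> \<longleftrightarrow> t < \<kappa> powr b * y s"
    proof -
      have "(\<kappa> * ((1 - s) / s)) powr b = \<kappa> powr b * y s"
        unfolding y_def using s assms by (intro powr_mult)
      then show ?thesis using t b by (simp add: powr_powr)
    qed
    finally show ?thesis .
  qed
  have F01: "0 \<le> F t" "F t < 1" for t
  proof -
    have "0 \<le> \<kappa> * t powr - (1 / b)" using assms by simp
    then show "0 \<le> F t" "F t < 1" by (auto simp: F_def field_simps add_pos_nonneg)
  qed
  have [measurable]: "F \<in> borel_measurable borel" unfolding F_def by measurable
  have "((\<lambda>s. s powr ((1 - b) - 1) * (1 - s) powr ((1 + b) - 1)) has_integral Beta (1 - b) (1 + b)) {0..1}"
    using b by (intro has_integral_Beta_real) auto
  then have "((\<lambda>s. indicator {0..1} s *\<^sub>R (s powr (- b) * (1 - s) powr b)) has_integral Beta (1 - b) (1 + b)) UNIV"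
    by (subst (asm) has_integral_restrict_UNIV[symmetric]) (auto elim!: has_integral_eq[rotated] simp: indicator_def)
  then have B: "(\<integral>\<^sup>+s. ennreal (indicator {0..1} s *\<^sub>R (s powr (- b) * (1 - s) powr b)) \<partial>lborel) = ennreal (Beta (1 - b) (1 + b))"
    by (intro nn_integral_has_integral_lborel) (auto simp: indicator_def)
  have "(\<integral>\<^sup>+t\<in>{0<..}. ennreal (F t) \<partial>lborel) =
      (\<integral>\<^sup>+t. (\<integral>\<^sup>+s. indicator {s. 0 < s \<and> s < F t} s * indicator {0<..} t \<partial>lborel) \<partial>lborel)"
  proof (intro nn_integral_cong)
    fix t
    have "{s. 0 < s \<and> s < F t} = {0<..<F t}" by auto
    then have "(\<integral>\<^sup>+s. indicator {s. 0 < s \<and> s < F t} s * indicator {0<..} t \<partial>lborel) = emeasure lborel {0<..<F t} * indicator {0<..} t"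
      by (simp add: nn_integral_multc del: emeasure_lborel_Ioo)
    then show "ennreal (F t) * indicator {0<..} t = (\<integral>\<^sup>+s. indicator {s. 0 < s \<and> s < F t} s * indicator {0<..} t \<partial>lborel)"
      using F01[of t] by simp
  qed
  also have "\<dots> = (\<integral>\<^sup>+s. (\<integral>\<^sup>+t. indicator {s. 0 < s \<and> s < F t} s * indicator {0<..} t \<partial>lborel) \<partial>lborel)"
    by (rule lborel_pair.Fubini') measurable
  also have "\<dots> = (\<integral>\<^sup>+s. ennreal (\<kappa> powr b) * ennreal (indicator {0..1} s *\<^sub>R (s powr (- b) * (1 - s) powr b)) \<partial>lborel)"
  proof (rule nn_integral_cong_AE)
    have "AE s in lborel. s \<noteq> (1::real)" "AE s in lborel. s \<noteq> (0::real)" by (rule AE_lborel_singleton)+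
    then show "AE s in lborel. (\<integral>\<^sup>+t. indicator {s. 0 < s \<and> s < F t} s * indicator {0<..} t \<partial>lborel) =
      ennreal (\<kappa> powr b) * ennreal (indicator {0..1} s *\<^sub>R (s powr (- b) * (1 - s) powr b))"
    proof eventually_elim
      fix s :: real assume "s \<noteq> 1" "s \<noteq> 0"
      show "(\<integral>\<^sup>+t. indicator {s. 0 < s \<and> s < F t} s * indicator {0<..} t \<partial>lborel) =
        ennreal (\<kappa> powr b) * ennreal (indicator {0..1} s *\<^sub>R (s powr (- b) * (1 - s) powr b))"
      proof (cases "0 < s \<and> s < 1")
        case True
        have "(\<integral>\<^sup>+t. indicator {s. 0 < s \<and> s < F t} s * indicator {0<..} t \<partial>lborel) =
            (\<integral>\<^sup>+t. indicator {0<..<\<kappa> powr b * y s} t \<partial>lborel)"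
          using True sub by (intro nn_integral_cong) (auto simp: indicator_def)
        also have "\<dots> = ennreal (\<kappa> powr b * y s)" by (simp add: y_def)
        also have "y s = s powr (- b) * (1 - s) powr b"
          using True by (simp add: y_def powr_divide powr_minus field_simps)
        finally show ?thesis using True by (simp add: ennreal_mult)
      next
        case False
        then have "indicator {s. 0 < s \<and> s < F t} s = (0 :: ennreal)" for t
          using F01[of t] by (auto simp: indicator_def)
        then show ?thesis using False \<open>s \<noteq> 1\<close> \<open>s \<noteq> 0\<close> by (auto simp: indicator_def)
      qed
    qed
  qed
  also have "\<dots> = ennreal (\<kappa> powr b) * ennreal (Beta (1 - b) (1 + b))"
    by (subst nn_integral_cmult) (simp_all only: B, measurable)
  \<comment> \<open>In the Beta recursion the arguments 1 - b and b add up to 1, so only the factor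
    b = 2 / \<alpha> appears, which is the one in \<open>H\<close>.\<close>
  also have "Beta (1 - b) (1 + b) = b * Beta b (1 - b)"
  proof -
    have "b \<notin> \<int>\<^sub>\<le>\<^sub>0" using b by (auto elim!: nonpos_Ints_cases)
    then have "((1 - b) + b) * Beta (1 - b) (b + 1) = b * Beta (1 - b) b" by (rule Beta_plus1_right)
    then show ?thesis by (simp add: Beta_commute[of b] add.commute[of 1 b])
  qed
  finally show ?thesis
    unfolding F_def b(3)
    by (simp only: ennreal_mult'[symmetric, OF powr_ge_zero]) (simp add: H_def mult.left_commute mult.assoc flip: b_def)
qed

lemma H_nonneg:
  assumes "2 < \<alpha>"
  shows "0 \<le> H x \<alpha>"
proof -
  have "0 \<le> Beta (2 / \<alpha>) (1 - 2 / \<alpha>)"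
    using assms by (intro has_integral_nonneg[OF has_integral_Beta_real]) auto
  then show ?thesis using assms by (simp add: H_def)
qed

subsection \<open>The nearest point\<close>

context prob_space
begin

lemma radial_generating_functional:
  fixes X :: "nat \<Rightarrow> 'a \<Rightarrow> real^2"
  assumes X: "homogeneous_ppp lam X" "0 < lam"
    and u[measurable]: "u \<in> borel_measurable borel" and u01: "\<And>t. 0 \<le> u t" "\<And>t. u t \<le> 1"
    and I: "(\<integral>\<^sup>+t\<in>{0..}. ennreal (1 - u t) \<partial>lborel) = ennreal I" "0 \<le> I"
  shows "(\<integral>\<^sup>+\<omega>. iprod (\<lambda>j. u (pi * (norm (X j \<omega>))\<^sup>2)) \<partial>M) = ennreal (exp (- (lam * I)))"
proof -
  have "(\<integral>\<^sup>+x. ennreal (1 - u (pi * (norm (x :: real^2))\<^sup>2)) \<partial>lborel) = ennreal I"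
    using nn_integral_radial[of "\<lambda>t. ennreal (1 - u t)"] I by simp
  from ppp_generating_functional[OF X _ _ _ this I(2)] show ?thesis
    using u01 by simp
qed

end

section \<open>Bounds on a single annulus\<close>

locale nearest = prob_space +
  fixes X :: "nat \<Rightarrow> 'a \<Rightarrow> real^2" and T :: "'a \<Rightarrow> real" and lam \<alpha> \<delta> :: real
  assumes X: "homogeneous_ppp lam X" and lam: "0 < lam" and \<alpha>: "2 < \<alpha>" and \<delta>: "0 < \<delta>"
    and T[measurable]: "T \<in> borel_measurable M"
    and T_min: "AE \<omega> in M. 0 < T \<omega> \<and> (\<forall>j. T \<omega> \<le> pi * (norm (X j \<omega>))\<^sup>2) \<and> (\<exists>j. T \<omega> = pi * (norm (X j \<omega>))\<^sup>2)"
begin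

text \<open>With c = pi z^2 and t = pi r^2 this is the mean of exp (-\<delta> (z / r)^\<alpha> h)
  over an exponential h: the attenuation due to an interferer at radius r when the serving station
  is at radius z. Dependence on c / t alone is the scale invariance.\<close>

definition w where "w c t = 1 / (1 + \<delta> * (c / t) powr (\<alpha> / 2))"

text \<open>The wanted functional is \<open>W (T \<omega>) \<omega>\<close>, but a generating
  functional is available for constant \<open>c\<close> only; hence the separate parameter.\<close>

definition W where "W c \<omega> = iprod (\<lambda>j. w c (pi * (norm (X j \<omega>))\<^sup>2))"

lemma X_measurable[measurable]: "X j \<in> borel_measurable M"
  using X by (auto simp: homogeneous_ppp_def)

lemma w_measurable[measurable]: "(\<lambda>x. w (f x) (h x)) \<in> borel_measurable N"
  if [measurable]: "f \<in> borel_measurable N" "h \<in> borel_measurable N"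
  unfolding w_def by measurable

lemma W_measurable[measurable]: "(\<lambda>x. W (f x) x) \<in> borel_measurable M"
  if [measurable]: "f \<in> borel_measurable M"
  unfolding W_def by measurable

lemma w_bounds: "0 < w c t" "w c t \<le> 1"
  using \<delta> by (auto simp: w_def add_pos_nonneg)

lemma w_mono: "0 \<le> c \<Longrightarrow> c \<le> c' \<Longrightarrow> 0 < t' \<Longrightarrow> t' \<le> t \<Longrightarrow> w c' t' \<le> w c t"
  unfolding w_def using \<delta> \<alpha>
  by (intro divide_left_mono add_left_mono mult_left_mono powr_mono2 frac_le mult_pos_pos add_pos_nonneg) auto

text \<open>Setting the test function to 0 on the disc of area \<open>a\<close> makes the product
  vanish unless the disc contains no point, that is, unless T is at least \<open>a\<close>. The disc
  adds its area to the exponent, the outside adds \<open>I\<close>.\<close>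

lemma W_tail:
  assumes a: "0 < a" and I: "(\<integral>\<^sup>+t\<in>{a..}. ennreal (1 - w c t) \<partial>lborel) = ennreal I" "0 \<le> I"
  shows "(\<integral>\<^sup>+\<omega>. indicator {a..} (T \<omega>) * W c \<omega> \<partial>M) = ennreal (exp (- (lam * (a + I))))"
proof -
  define u where "u t = (if t < a then 0 else w c t)" for t
  have [measurable]: "u \<in> borel_measurable borel" unfolding u_def by measurable
  have u01: "0 \<le> u t" "u t \<le> 1" for t using w_bounds[of c t] by (auto simp: u_def)
  have "AE \<omega> in M. indicator {a..} (T \<omega>) * W c \<omega> = iprod (\<lambda>j. u (pi * (norm (X j \<omega>))\<^sup>2))"
    using T_min
  proof eventually_elim
    fix \<omega> assume m: "0 < T \<omega> \<and> (\<forall>j. T \<omega> \<le> pi * (norm (X j \<omega>))\<^sup>2) \<and> (\<exists>j. T \<omega> = pi * (norm (X j \<omega>))\<^sup>2)"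
    show "indicator {a..} (T \<omega>) * W c \<omega> = iprod (\<lambda>j. u (pi * (norm (X j \<omega>))\<^sup>2))"
    proof (cases "a \<le> T \<omega>")
      case True
      then have "\<not> pi * (norm (X j \<omega>))\<^sup>2 < a" for j using m by (meson not_le order_trans)
      then show ?thesis using True by (simp add: W_def u_def)
    next
      case False
      then obtain j where "pi * (norm (X j \<omega>))\<^sup>2 < a" using m by (metis not_le)
      then have "iprod (\<lambda>j. u (pi * (norm (X j \<omega>))\<^sup>2)) = 0"
        by (intro iprod_eq_0[of _ j]) (simp add: u_def)
      then show ?thesis using False by simp
    qed
  qed
  then have "(\<integral>\<^sup>+\<omega>. indicator {a..} (T \<omega>) * W c \<omega> \<partial>M) = (\<integral>\<^sup>+\<omega>. iprod (\<lambda>j. u (pi * (norm (X j \<omega>))\<^sup>2)) \<partial>M)"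
    by (rule nn_integral_cong_AE)
  also have "\<dots> = ennreal (exp (- (lam * (a + I))))"
  proof (rule radial_generating_functional[OF X lam _ u01])
    have "(\<integral>\<^sup>+t\<in>{0..}. ennreal (1 - u t) \<partial>lborel) =
        (\<integral>\<^sup>+t. indicator {0..<a} t + ennreal (1 - w c t) * indicator {a..} t \<partial>lborel)"
      using a by (intro nn_integral_cong) (auto simp: u_def indicator_def)
    also have "\<dots> = ennreal (a + I)"
      using a I by (simp add: nn_integral_add ennreal_plus)
    finally show "(\<integral>\<^sup>+t\<in>{0..}. ennreal (1 - u t) \<partial>lborel) = ennreal (a + I)" .
  qed (use a I in auto)
  finally show ?thesis .
qed

lemma W_annulus:
  assumes a: "0 < a" "a \<le> b" and I: "(\<integral>\<^sup>+t\<in>{a..}. ennreal (1 - w c t) \<partial>lborel) = ennreal I" "0 \<le> I"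
    and J: "(\<integral>\<^sup>+t\<in>{b..}. ennreal (1 - w c t) \<partial>lborel) = ennreal J" "0 \<le> J"
  shows "(\<integral>\<^sup>+\<omega>. indicator {a..<b} (T \<omega>) * W c \<omega> \<partial>M) =
    ennreal (exp (- (lam * (a + I))) - exp (- (lam * (b + J))))"
proof -
  let ?E = "\<integral>\<^sup>+\<omega>. indicator {a..<b} (T \<omega>) * W c \<omega> \<partial>M"
  have "ennreal (exp (- (lam * (a + I)))) = (\<integral>\<^sup>+\<omega>. indicator {a..} (T \<omega>) * W c \<omega> \<partial>M)"
    using a I by (simp add: W_tail)
  also have "\<dots> = (\<integral>\<^sup>+\<omega>. indicator {a..<b} (T \<omega>) * W c \<omega> + indicator {b..} (T \<omega>) * W c \<omega> \<partial>M)"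
    using a by (intro nn_integral_cong) (auto simp: indicator_def)
  also have "\<dots> = ?E + ennreal (exp (- (lam * (b + J))))"
    using a J by (simp add: nn_integral_add W_tail)
  finally have "?E = ennreal (exp (- (lam * (a + I)))) - ennreal (exp (- (lam * (b + J))))"
    by (simp add: ennreal_add_diff_cancel_right)
  then show ?thesis by (simp add: ennreal_minus)
qed

lemma nn_integral_w_split:
  assumes "0 < a" "a \<le> b" "0 \<le> c"
  obtains K where "0 \<le> K" "(b - a) * (1 - w c b) \<le> K" "K \<le> (b - a) * (1 - w c a)"
    "(\<integral>\<^sup>+t\<in>{a..}. ennreal (1 - w c t) \<partial>lborel) = ennreal K + (\<integral>\<^sup>+t\<in>{b..}. ennreal (1 - w c t) \<partial>lborel)"
proof -
  let ?K = "\<integral>\<^sup>+t\<in>{a..<b}. ennreal (1 - w c t) \<partial>lborel"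
  have const: "(\<integral>\<^sup>+t\<in>{a..<b}. ennreal r \<partial>lborel) = ennreal ((b - a) * r)" if "0 \<le> r" for r
    using assms that by (simp add: nn_integral_cmult_indicator ennreal_mult mult.commute)
  have "?K \<le> (\<integral>\<^sup>+t\<in>{a..<b}. ennreal (1 - w c a) \<partial>lborel)"
    using assms w_mono[of c c a] by (intro nn_integral_mono) (auto simp: indicator_def intro!: ennreal_leI)
  then have up: "?K \<le> ennreal ((b - a) * (1 - w c a))" using const w_bounds[of c a] by simp
  have "(\<integral>\<^sup>+t\<in>{a..<b}. ennreal (1 - w c b) \<partial>lborel) \<le> ?K"
    using assms w_mono[of c c _ b] by (intro nn_integral_mono) (auto simp: indicator_def intro!: ennreal_leI)
  then have lo: "ennreal ((b - a) * (1 - w c b)) \<le> ?K" using const w_bounds[of c b] by simp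
  obtain K where K: "?K = ennreal K" "0 \<le> K"
    using up by (cases ?K) (auto simp: top_unique)
  have "(\<integral>\<^sup>+t\<in>{a..}. ennreal (1 - w c t) \<partial>lborel) =
      (\<integral>\<^sup>+t. ennreal (1 - w c t) * indicator {a..<b} t + ennreal (1 - w c t) * indicator {b..} t \<partial>lborel)"
    using assms by (intro nn_integral_cong) (auto simp: indicator_def)
  also have "\<dots> = ennreal K + (\<integral>\<^sup>+t\<in>{b..}. ennreal (1 - w c t) \<partial>lborel)"
    by (simp add: nn_integral_add K)
  finally show thesis
    using up lo K w_bounds[of c a] assms by (intro that[of K]) (auto simp: ennreal_le_iff)
qed

lemma nn_integral_w_self:
  "0 < a \<Longrightarrow> (\<integral>\<^sup>+t\<in>{a..}. ennreal (1 - w a t) \<partial>lborel) = ennreal (a * G \<delta> \<alpha>)" "0 \<le> G \<delta> \<alpha>"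
  unfolding w_def by (rule nn_integral_G[OF \<alpha> \<delta>], assumption) (rule nn_integral_G[OF \<alpha> \<delta> zero_less_one])

text \<open>T is frozen at the inner end, so the integral from \<open>a\<close> is exact and the one
  from \<open>b\<close> is smaller by \<open>K\<close>. Then 1 - exp (-y) \<le> y linearizes, and
  the lower bound on \<open>K\<close> leaves \<open>w a b\<close>, which tends to the nearest
  point's own factor 1 / (1 + \<delta>) as the annulus shrinks.\<close>

lemma annulus_upper:
  assumes ab: "0 < a" "a \<le> b"
  shows "(\<integral>\<^sup>+\<omega>. indicator {a..<b} (T \<omega>) * W a \<omega> \<partial>M) \<le>
    ennreal (lam * (b - a) * w a b * exp (- (lam * a * (1 + G \<delta> \<alpha>))))"
proof -
  from ab have "0 \<le> a" by simp
  from nn_integral_w_split[OF ab this] obtain K where K: "0 \<le> K" "(b - a) * (1 - w a b) \<le> K" "K \<le> (b - a) * (1 - w a a)"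
    and e: "(\<integral>\<^sup>+t\<in>{a..}. ennreal (1 - w a t) \<partial>lborel) = ennreal K + (\<integral>\<^sup>+t\<in>{b..}. ennreal (1 - w a t) \<partial>lborel)" .
  note e' = e[unfolded nn_integral_w_self(1)[OF ab(1)]]
  then obtain J where J: "(\<integral>\<^sup>+t\<in>{b..}. ennreal (1 - w a t) \<partial>lborel) = ennreal J" "0 \<le> J"
    by (cases "\<integral>\<^sup>+t\<in>{b..}. ennreal (1 - w a t) \<partial>lborel") auto
  have aG: "0 \<le> a * G \<delta> \<alpha>" using ab nn_integral_w_self(2) by simp
  have KJ: "a * G \<delta> \<alpha> = K + J"
    using e' J K aG by (simp flip: ennreal_plus)
  define v where "v = exp (- (lam * a * (1 + G \<delta> \<alpha>)))"
  define y where "y = lam * (b - a - K)"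
  have "(\<integral>\<^sup>+\<omega>. indicator {a..<b} (T \<omega>) * W a \<omega> \<partial>M) = ennreal (exp (- (lam * (a + a * G \<delta> \<alpha>))) - exp (- (lam * (b + J))))"
    by (rule W_annulus[OF ab nn_integral_w_self(1)[OF ab(1)] aG J])
  also have "exp (- (lam * (a + a * G \<delta> \<alpha>))) = v" by (simp add: v_def algebra_simps)
  also have "exp (- (lam * (b + J))) = v * exp (- y)"
  proof -
    have "b + J = a * (1 + G \<delta> \<alpha>) + (b - a - K)" using KJ by (simp add: algebra_simps)
    then have "- (lam * (b + J)) = - (lam * a * (1 + G \<delta> \<alpha>)) + - y"
      unfolding y_def by (simp only:) (simp add: algebra_simps)
    then show ?thesis unfolding v_def by (simp only: exp_add)
  qed
  also have "v - v * exp (- y) = v * (1 - exp (- y))" by (simp add: algebra_simps)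
  also have "\<dots> \<le> v * y"
    using exp_ge_add_one_self[of "- y"] by (intro mult_left_mono) (auto simp: v_def)
  also have "\<dots> \<le> v * (lam * ((b - a) * w a b))"
    unfolding y_def using K lam by (intro mult_left_mono) (auto simp: v_def algebra_simps)
  finally show ?thesis by (simp add: v_def mult_ac ennreal_leI)
qed

text \<open>Mirror image: T is frozen at the outer end, the exponential at that end is factored out,
  y \<le> exp y - 1 linearizes in the opposite direction, and the upper bound on \<open>K\<close>
  leaves \<open>w b a\<close>.\<close>

lemma annulus_lower:
  assumes ab: "0 < a" "a \<le> b"
  shows "ennreal (lam * (b - a) * w b a * exp (- (lam * b * (1 + G \<delta> \<alpha>)))) \<le>
    (\<integral>\<^sup>+\<omega>. indicator {a..<b} (T \<omega>) * W b \<omega> \<partial>M)"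
proof -
  from ab have b: "0 < b" by simp
  then have "0 \<le> b" by simp
  from nn_integral_w_split[OF ab this] obtain K where K: "0 \<le> K" "(b - a) * (1 - w b b) \<le> K" "K \<le> (b - a) * (1 - w b a)"
    and e: "(\<integral>\<^sup>+t\<in>{a..}. ennreal (1 - w b t) \<partial>lborel) = ennreal K + (\<integral>\<^sup>+t\<in>{b..}. ennreal (1 - w b t) \<partial>lborel)" .
  have bG: "0 \<le> b * G \<delta> \<alpha>" using b nn_integral_w_self(2) by simp
  have I: "(\<integral>\<^sup>+t\<in>{a..}. ennreal (1 - w b t) \<partial>lborel) = ennreal (K + b * G \<delta> \<alpha>)"
    using e K bG by (simp add: nn_integral_w_self(1)[OF b] ennreal_plus)
  define v where "v = exp (- (lam * b * (1 + G \<delta> \<alpha>)))"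
  define y where "y = lam * (b - a - K)"
  have "v * (lam * ((b - a) * w b a)) \<le> v * y"
    unfolding y_def using K lam by (intro mult_left_mono) (auto simp: v_def algebra_simps)
  also have "\<dots> \<le> v * (exp y - 1)"
  proof (intro mult_left_mono)
    show "y \<le> exp y - 1" using exp_ge_add_one_self[of y] by linarith
  qed (simp add: v_def)
  also have "\<dots> = exp (- (lam * (a + (K + b * G \<delta> \<alpha>)))) - exp (- (lam * (b + b * G \<delta> \<alpha>)))"
    by (simp add: v_def y_def algebra_simps flip: exp_add)
  finally have "ennreal (v * (lam * ((b - a) * w b a))) \<le> (\<integral>\<^sup>+\<omega>. indicator {a..<b} (T \<omega>) * W b \<omega> \<partial>M)"
    using K bG by (subst W_annulus[OF ab I _ nn_integral_w_self(1)[OF b] bG]) (auto intro: ennreal_leI)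
  then show ?thesis by (simp add: v_def mult_ac)
qed

end

section \<open>Summation over geometric annuli\<close>

lemma geometric_grid:
  fixes q :: real and A :: "nat \<Rightarrow> real set"
  assumes q: "1 < q"
  defines "A \<equiv> \<lambda>n. {q powr (int_decode n) ..< q * q powr (int_decode n)}"
  shows "disjoint_family A" and "(\<Union>n. A n) = {0<..}"
proof -
  \<comment> \<open>The exponents run over all integers because T can be arbitrarily close to 0, and
    \<open>int_decode\<close> lists them as a sequence. The annulus of t is found by rounding down
    the logarithm.\<close>
  have mem: "t \<in> A n \<longleftrightarrow> 0 < t \<and> int_decode n = \<lfloor>log q t\<rfloor>" for t n
  proof -
    have "t \<in> A n \<longleftrightarrow> 0 < t \<and> q powr (int_decode n) \<le> t \<and> t < q powr (int_decode n + 1)"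
      using q by (auto simp: A_def powr_add mult.commute intro: less_le_trans[of 0 "q powr (int_decode n)"])
    also have "\<dots> \<longleftrightarrow> 0 < t \<and> real_of_int (int_decode n) \<le> log q t \<and> log q t < int_decode n + 1"
      using q by (auto simp: le_log_iff log_less_iff)
    also have "\<dots> \<longleftrightarrow> 0 < t \<and> int_decode n = \<lfloor>log q t\<rfloor>"
      by (auto simp: floor_eq_iff eq_commute[of _ "\<lfloor>_\<rfloor>"])
    finally show ?thesis .
  qed
  show "disjoint_family A"
    unfolding disjoint_family_on_def disjoint_iff using mem by (metis int_decode_eq)
  show "(\<Union>n. A n) = {0<..}"
    unfolding set_eq_iff UN_iff mem by (metis UNIV_I greaterThan_iff int_encode_inverse)
qed

lemma nn_integral_disjoint_cover:
  fixes f :: "'a \<Rightarrow> ennreal" and A :: "nat \<Rightarrow> 'b set"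
  assumes [measurable]: "f \<in> borel_measurable M" "T \<in> measurable M N" "\<And>n. A n \<in> sets N"
    and A: "disjoint_family A" "AE x in M. T x \<in> (\<Union>n. A n)"
  shows "(\<integral>\<^sup>+x. f x \<partial>M) = (\<Sum>n. \<integral>\<^sup>+x. f x * indicator (A n) (T x) \<partial>M)"
proof -
  have "(\<integral>\<^sup>+x. f x \<partial>M) = (\<integral>\<^sup>+x. (\<Sum>n. f x * indicator (A n) (T x)) \<partial>M)"
  proof (rule nn_integral_cong_AE)
    show "AE x in M. f x = (\<Sum>n. f x * indicator (A n) (T x))"
      using A(2)
    proof eventually_elim
      fix x assume "T x \<in> (\<Union>n. A n)"
      then obtain n where "T x \<in> A n" by blast
      from suminf_cmult_indicator[OF A(1) this, of "\<lambda>_. f x"]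
      show "f x = (\<Sum>n. f x * indicator (A n) (T x))" by simp
    qed
  qed
  then show ?thesis by (simp add: nn_integral_suminf del: ennreal_suminf_cmult)
qed

context nearest
begin

text \<open>For z in the annulus from a to b = q a, monotonicity gives F (q z) \<le> F b and F a
  \<le> F (z / q). The sums over annuli thus become integrals of rescaled copies of F over the
  half-line, and rescaling changes such an integral only by a factor q or 1 / q. Monotonicity of g
  replaces any Riemann sum or continuity argument.\<close>

lemma nearest_point_functional:
  assumes g[measurable]: "g \<in> borel_measurable borel" and g0: "\<And>z. 0 \<le> g z"
    and g_mono: "\<And>y z. 0 < y \<Longrightarrow> y \<le> z \<Longrightarrow> g z \<le> g y"
  shows "(\<integral>\<^sup>+\<omega>. ennreal (g (T \<omega>)) * W (T \<omega>) \<omega> \<partial>M) =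
    ennreal (1 / (1 + \<delta>)) * (\<integral>\<^sup>+z\<in>{0<..}. ennreal (lam * g z * exp (- (lam * z * (1 + G \<delta> \<alpha>)))) \<partial>lborel)"
    (is "?E = _ * ?R")
proof -
  define F where "F z = lam * g z * exp (- (lam * z * (1 + G \<delta> \<alpha>)))" for z
  have [measurable]: "F \<in> borel_measurable borel" unfolding F_def by measurable
  have F0: "0 \<le> F z" for z using lam g0 by (simp add: F_def)
  have F_mono: "F z \<le> F y" if "0 < y" "y \<le> z" for y z
    unfolding F_def using that lam g0 g_mono[OF that] nn_integral_w_self(2)
    by (intro mult_mono) (auto intro!: mult_mono)
  have scale: "(\<integral>\<^sup>+z\<in>{0<..}. ennreal (F (s * z)) \<partial>lborel) = ennreal (1 / s) * ?R" if "0 < s" for s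
  proof -
    have "?R = ennreal s * (\<integral>\<^sup>+z. ennreal (F (s * z)) * indicator {0<..} (s * z) \<partial>lborel)"
      using that nn_integral_real_affine[of "\<lambda>z. ennreal (F z) * indicator {0<..} z" s 0] by (simp add: F_def)
    also have "(\<lambda>z. indicator {0<..} (s * z)) = (indicator {0<..} :: real \<Rightarrow> ennreal)"
      using that by (auto simp: indicator_def zero_less_mult_iff)
    finally show ?thesis using that by (simp add: mult.assoc[symmetric] ennreal_mult''[symmetric])
  qed
  have bounds: "ennreal (1 / (1 + \<delta> * q powr (\<alpha> / 2)) / q) * ?R \<le> ?E"
    "?E \<le> ennreal (1 / (1 + \<delta> * (1 / q) powr (\<alpha> / 2)) * q) * ?R" if q: "1 < q" for q
  proof -
    define A where "A n = {q powr (int_decode n) ..< q * q powr (int_decode n)}" for n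
    note grid = geometric_grid[OF q, folded A_def]
    have [measurable]: "A n \<in> sets borel" for n by (simp add: A_def)
    have TA: "AE \<omega> in M. T \<omega> \<in> (\<Union>n. A n)"
      unfolding grid(2) using T_min by eventually_elim auto
    have E: "?E = (\<Sum>n. \<integral>\<^sup>+\<omega>. ennreal (g (T \<omega>)) * W (T \<omega>) \<omega> * indicator (A n) (T \<omega>) \<partial>M)"
      by (rule nn_integral_disjoint_cover[OF _ T _ grid(1) TA]) measurable
    have R: "(\<integral>\<^sup>+z\<in>{0<..}. f z \<partial>lborel) = (\<Sum>n. \<integral>\<^sup>+z\<in>A n. f z \<partial>lborel)"
      if [measurable]: "f \<in> borel_measurable borel" for f :: "real \<Rightarrow> ennreal"
    proof -
      have "(\<integral>\<^sup>+z\<in>{0<..}. f z \<partial>lborel) = (\<integral>\<^sup>+z. f z \<partial>restrict_space lborel {0<..})"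
        by (simp add: nn_integral_restrict_space)
      also have "\<dots> = (\<Sum>n. \<integral>\<^sup>+z. f z * indicator (A n) (id z) \<partial>restrict_space lborel {0<..})"
        by (rule nn_integral_disjoint_cover[where N=borel, OF _ _ _ grid(1)])
          (auto simp: grid(2) AE_restrict_space_iff intro!: measurable_restrict_space1)
      also have "(\<lambda>n. \<integral>\<^sup>+z. f z * indicator (A n) (id z) \<partial>restrict_space lborel {0<..}) = (\<lambda>n. \<integral>\<^sup>+z\<in>A n. f z \<partial>lborel)"
      proof
        fix n
        have "A n \<subseteq> {0<..}" using grid(2) by blast
        then show "(\<integral>\<^sup>+z. f z * indicator (A n) (id z) \<partial>restrict_space lborel {0<..}) = (\<integral>\<^sup>+z\<in>A n. f z \<partial>lborel)"
          by (simp add: nn_integral_restrict_space) (intro nn_integral_cong, auto simp: indicator_def)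
      qed
      finally show ?thesis .
    qed
    have piece: "ennreal (1 / (1 + \<delta> * q powr (\<alpha> / 2))) * (\<integral>\<^sup>+z\<in>A n. ennreal (F (q * z)) \<partial>lborel) \<le>
        (\<integral>\<^sup>+\<omega>. ennreal (g (T \<omega>)) * W (T \<omega>) \<omega> * indicator (A n) (T \<omega>) \<partial>M)" (is "?l1 \<le> ?e")
      "(\<integral>\<^sup>+\<omega>. ennreal (g (T \<omega>)) * W (T \<omega>) \<omega> * indicator (A n) (T \<omega>) \<partial>M) \<le>
        ennreal (1 / (1 + \<delta> * (1 / q) powr (\<alpha> / 2))) * (\<integral>\<^sup>+z\<in>A n. ennreal (F (1 / q * z)) \<partial>lborel)" for n
    proof -
      define a where "a = q powr (int_decode n)"
      define b where "b = q * a"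
      have a: "0 < a" and b: "0 < b" and ab: "a \<le> b" and An: "A n = {a..<b}"
        using q by (auto simp: a_def b_def A_def)
      have W_mono: "W c \<omega> \<le> W c' \<omega>" if "0 < c'" "c' \<le> c" "\<forall>j. 0 < pi * (norm (X j \<omega>))\<^sup>2" for c c' \<omega>
        unfolding W_def using that by (intro iprod_mono w_mono) auto
      \<comment> \<open>Only the ratio q of the ends enters, so the factor is common to all annuli
        and can leave the sum.\<close>
      have wq: "w b a = 1 / (1 + \<delta> * q powr (\<alpha> / 2))" "w a b = 1 / (1 + \<delta> * (1 / q) powr (\<alpha> / 2))"
        using a by (auto simp: w_def b_def)
      have const: "(\<integral>\<^sup>+z\<in>A n. ennreal r \<partial>lborel) = ennreal ((b - a) * r)" if "0 \<le> r" for r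
        using ab that by (simp add: An nn_integral_cmult_indicator ennreal_mult mult.commute)
      have pos: "AE \<omega> in M. \<forall>j. 0 < pi * (norm (X j \<omega>))\<^sup>2"
        using T_min by eventually_elim (auto intro: less_le_trans)
      have "?l1 \<le> ennreal (w b a) * (\<integral>\<^sup>+z\<in>A n. ennreal (F b) \<partial>lborel)"
        unfolding wq using a b q by (intro mult_left_mono nn_integral_mono)
          (auto simp: An indicator_def b_def intro!: ennreal_leI F_mono)
      also have "\<dots> = ennreal (g b) * ennreal (lam * (b - a) * w b a * exp (- (lam * b * (1 + G \<delta> \<alpha>))))"
        unfolding const[OF F0] using w_bounds[of b a] F0[of b] lam g0 ab
        by (simp add: F_def mult_ac flip: ennreal_mult)
      also have "\<dots> \<le> ennreal (g b) * (\<integral>\<^sup>+\<omega>. indicator {a..<b} (T \<omega>) * W b \<omega> \<partial>M)"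
        by (intro mult_left_mono annulus_lower a ab) simp
      also have "\<dots> = (\<integral>\<^sup>+\<omega>. ennreal (g b) * (indicator {a..<b} (T \<omega>) * W b \<omega>) \<partial>M)"
        by (rule nn_integral_cmult[symmetric]) measurable
      also have "\<dots> \<le> ?e"
        using pos
      proof (intro nn_integral_mono_AE, eventually_elim)
        fix \<omega> assume "\<forall>j. 0 < pi * (norm (X j \<omega>))\<^sup>2"
        then show "ennreal (g b) * (indicator {a..<b} (T \<omega>) * W b \<omega>) \<le> ennreal (g (T \<omega>)) * W (T \<omega>) \<omega> * indicator (A n) (T \<omega>)"
          using a b by (auto simp: An indicator_def intro!: mult_mono ennreal_leI g_mono W_mono)
      qed
      finally show "?l1 \<le> ?e" .
      have "?e \<le> (\<integral>\<^sup>+\<omega>. ennreal (g a) * (indicator {a..<b} (T \<omega>) * W a \<omega>) \<partial>M)"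
        using pos
      proof (intro nn_integral_mono_AE, eventually_elim)
        fix \<omega> assume "\<forall>j. 0 < pi * (norm (X j \<omega>))\<^sup>2"
        then show "ennreal (g (T \<omega>)) * W (T \<omega>) \<omega> * indicator (A n) (T \<omega>) \<le> ennreal (g a) * (indicator {a..<b} (T \<omega>) * W a \<omega>)"
          using a b by (auto simp: An indicator_def intro!: mult_mono ennreal_leI g_mono W_mono)
      qed
      also have "\<dots> = ennreal (g a) * (\<integral>\<^sup>+\<omega>. indicator {a..<b} (T \<omega>) * W a \<omega> \<partial>M)"
        by (rule nn_integral_cmult) measurable
      also have "\<dots> \<le> ennreal (g a) * ennreal (lam * (b - a) * w a b * exp (- (lam * a * (1 + G \<delta> \<alpha>))))"
        by (intro mult_left_mono annulus_upper a ab) simp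
      also have "\<dots> = ennreal (w a b) * (\<integral>\<^sup>+z\<in>A n. ennreal (F a) \<partial>lborel)"
        unfolding const[OF F0] using w_bounds[of a b] F0[of a] lam g0 ab
        by (simp add: F_def mult_ac flip: ennreal_mult)
      also have "\<dots> \<le> ennreal (w a b) * (\<integral>\<^sup>+z\<in>A n. ennreal (F (1 / q * z)) \<partial>lborel)"
        using a b q by (intro mult_left_mono nn_integral_mono)
          (auto simp: An indicator_def b_def field_simps intro!: ennreal_leI F_mono)
      finally show "?e \<le> ennreal (1 / (1 + \<delta> * (1 / q) powr (\<alpha> / 2))) * (\<integral>\<^sup>+z\<in>A n. ennreal (F (1 / q * z)) \<partial>lborel)"
        by (simp only: wq)
    qed
    have "ennreal (1 / (1 + \<delta> * q powr (\<alpha> / 2)) / q) * ?R =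
        ennreal (1 / (1 + \<delta> * q powr (\<alpha> / 2))) * (\<integral>\<^sup>+z\<in>{0<..}. ennreal (F (q * z)) \<partial>lborel)"
      using q \<delta> by (subst scale) (auto simp: mult.assoc[symmetric] add_nonneg_nonneg simp flip: ennreal_mult)
    also have "\<dots> \<le> ?E"
      unfolding E by (subst R, simp, subst ennreal_suminf_cmult[symmetric]) (intro suminf_le piece summableI)
    finally show "ennreal (1 / (1 + \<delta> * q powr (\<alpha> / 2)) / q) * ?R \<le> ?E" .
    have "?E \<le> ennreal (1 / (1 + \<delta> * (1 / q) powr (\<alpha> / 2))) * (\<integral>\<^sup>+z\<in>{0<..}. ennreal (F (1 / q * z)) \<partial>lborel)"
      unfolding E by (subst R, simp, subst ennreal_suminf_cmult[symmetric]) (intro suminf_le piece summableI)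
    also have "\<dots> = ennreal (1 / (1 + \<delta> * (1 / q) powr (\<alpha> / 2)) * q) * ?R"
      using q \<delta> by (subst scale) (auto simp: mult.assoc[symmetric] add_nonneg_nonneg simp flip: ennreal_mult)
    finally show "?E \<le> ennreal (1 / (1 + \<delta> * (1 / q) powr (\<alpha> / 2)) * q) * ?R" .
  qed
  define q where "q n = 1 + 1 / real (Suc n)" for n
  have q: "1 < q n" for n by (simp add: q_def)
  have "q \<longlonglongrightarrow> 1 + 0" unfolding q_def by (intro tendsto_intros LIMSEQ_inverse_real_of_nat[unfolded inverse_eq_divide])
  then have q_lim: "q \<longlonglongrightarrow> 1" by simp
  have d: "1 + \<delta> * 1 powr (\<alpha> / 2) \<noteq> 0" using \<delta> by simp
  \<comment> \<open>\<open>?R\<close> may be infinite at this point; the limit still passes because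
    the limit of the coefficients is neither 0 nor infinite.\<close>
  have "(\<lambda>n. ennreal (1 / (1 + \<delta> * q n powr (\<alpha> / 2)) / q n) * ?R) \<longlonglongrightarrow> ennreal (1 / (1 + \<delta> * 1 powr (\<alpha> / 2)) / 1) * ?R"
    using \<delta> d by (intro tendsto_mult_ennreal tendsto_ennrealI tendsto_intros q_lim) auto
  then have lower: "ennreal (1 / (1 + \<delta>)) * ?R \<le> ?E"
    using bounds(1)[OF q] by (intro LIMSEQ_le_const2) auto
  have "(\<lambda>n. ennreal (1 / (1 + \<delta> * (1 / q n) powr (\<alpha> / 2)) * q n) * ?R) \<longlonglongrightarrow> ennreal (1 / (1 + \<delta> * (1 / 1) powr (\<alpha> / 2)) * 1) * ?R"
    using \<delta> d by (intro tendsto_mult_ennreal tendsto_ennrealI tendsto_intros q_lim) auto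
  then have upper: "?E \<le> ennreal (1 / (1 + \<delta>)) * ?R"
    using bounds(2)[OF q] by (intro LIMSEQ_le_const) auto
  from lower upper show ?thesis by (rule antisym[rotated])
qed

end

subsection \<open>Fading\<close>

text \<open>Fubini with both variables kept on M: the inner integral averages V over an independent
  outcome while U is frozen. Later steps that fix some of the sources use this form of
  conditioning.\<close>

lemma (in prob_space) nn_integral_indep_var:
  assumes UV: "indep_var N1 U N2 V" and f[measurable]: "f \<in> borel_measurable (N1 \<Otimes>\<^sub>M N2)"
  shows "(\<integral>\<^sup>+\<omega>. f (U \<omega>, V \<omega>) \<partial>M) = (\<integral>\<^sup>+\<omega>. \<integral>\<^sup>+\<omega>'. f (U \<omega>, V \<omega>') \<partial>M \<partial>M)"
proof -
  have [measurable]: "U \<in> measurable M N1" "V \<in> measurable M N2"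
    and eq: "distr M N1 U \<Otimes>\<^sub>M distr M N2 V = distr M (N1 \<Otimes>\<^sub>M N2) (\<lambda>x. (U x, V x))"
    using UV by (simp_all add: indep_var_distribution_eq)
  interpret U: prob_space "distr M N1 U" by (rule prob_space_distr) measurable
  interpret V: prob_space "distr M N2 V" by (rule prob_space_distr) measurable
  have "(\<integral>\<^sup>+\<omega>. f (U \<omega>, V \<omega>) \<partial>M) = (\<integral>\<^sup>+z. f z \<partial>distr M (N1 \<Otimes>\<^sub>M N2) (\<lambda>x. (U x, V x)))"
    by (simp add: nn_integral_distr)
  also have "\<dots> = (\<integral>\<^sup>+u. \<integral>\<^sup>+v. f (u, v) \<partial>distr M N2 V \<partial>distr M N1 U)"
    unfolding eq[symmetric] by (rule V.nn_integral_fst[symmetric]) measurable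
  also have "\<dots> = (\<integral>\<^sup>+\<omega>. \<integral>\<^sup>+v. f (U \<omega>, v) \<partial>distr M N2 V \<partial>M)"
    by (simp add: nn_integral_distr)
  also have "\<dots> = (\<integral>\<^sup>+\<omega>. \<integral>\<^sup>+\<omega>'. f (U \<omega>, V \<omega>') \<partial>M \<partial>M)"
  proof (rule nn_integral_cong)
    fix \<omega> assume "\<omega> \<in> space M"
    then have "U \<omega> \<in> space N1" by (intro measurable_space[of U M N1]) auto
    then have "(\<lambda>v. f (U \<omega>, v)) \<in> borel_measurable N2" by measurable
    then show "(\<integral>\<^sup>+v. f (U \<omega>, v) \<partial>distr M N2 V) = (\<integral>\<^sup>+\<omega>'. f (U \<omega>, V \<omega>') \<partial>M)"
      by (simp add: nn_integral_distr)
  qed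
  finally show ?thesis .
qed

section \<open>Exponential variables\<close>

context prob_space
begin

lemma exponential_tail_le:
  assumes X: "distributed M lborel X (exponential_density 1)" and q: "0 \<le> q"
  shows "emeasure M {\<omega> \<in> space M. q \<le> X \<omega>} = ennreal (exp (- q))"
proof -
  have [measurable]: "X \<in> borel_measurable M" using distributed_measurable[OF X] by simp
  have "emeasure M (X -` {q} \<inter> space M) = 0"
    using distributed_emeasure[OF X, of "{q}"] by (simp add: nn_integral_cmult_indicator mult.commute)
  then have "AE \<omega> in M. X \<omega> \<noteq> q"
    by (intro AE_I[of _ _ "X -` {q} \<inter> space M"]) auto
  then have "emeasure M {\<omega> \<in> space M. q \<le> X \<omega>} = emeasure M {\<omega> \<in> space M. q < X \<omega>}"
    by (intro emeasure_eq_AE) auto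
  also have "\<dots> = ennreal (exp (- q))"
    using exponential_distributedD_gt[OF X q] by (simp add: emeasure_eq_measure)
  finally show ?thesis .
qed

text \<open>Multiplying the density exp (-x) by exp (-a x) gives 1 / (1 + a) times the exponential
  density of rate 1 + a, whose total mass is 1.\<close>

lemma exponential_laplace:
  assumes X: "distributed M lborel X (exponential_density 1)" and a: "0 \<le> a"
  shows "(\<integral>\<^sup>+\<omega>. ennreal (exp (- (a * X \<omega>))) \<partial>M) = ennreal (1 / (1 + a))"
proof -
  interpret E: prob_space "density lborel (exponential_density (1 + a))"
    by (rule prob_space_exponential_density) (use a in simp)
  have "1 = emeasure (density lborel (exponential_density (1 + a))) UNIV"
    using E.emeasure_space_1 by simp
  also have "\<dots> = (\<integral>\<^sup>+x. ennreal (exponential_density (1 + a) x) \<partial>lborel)"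
    by (subst emeasure_density) auto
  finally have one: "(\<integral>\<^sup>+x. ennreal (exponential_density (1 + a) x) \<partial>lborel) = 1" ..
  have "(\<integral>\<^sup>+\<omega>. ennreal (exp (- (a * X \<omega>))) \<partial>M) =
      (\<integral>\<^sup>+x. ennreal (exponential_density 1 x) * ennreal (exp (- (a * x))) \<partial>lborel)"
    by (rule distributed_nn_integral[OF X, symmetric]) simp
  also have "\<dots> = (\<integral>\<^sup>+x. ennreal (1 / (1 + a)) * ennreal (exponential_density (1 + a) x) \<partial>lborel)"
  proof (rule nn_integral_cong)
    fix x
    have "exp (- x) * exp (- (a * x)) = 1 / (1 + a) * ((1 + a) * exp (- x * (1 + a)))"
      using a by (simp add: add_nonneg_eq_0_iff) (simp add: algebra_simps flip: exp_add)
    then show "ennreal (exponential_density 1 x) * ennreal (exp (- (a * x))) =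
        ennreal (1 / (1 + a)) * ennreal (exponential_density (1 + a) x)"
      using a by (simp add: exponential_density_def flip: ennreal_mult)
  qed
  also have "\<dots> = ennreal (1 / (1 + a))"
    by (subst nn_integral_cmult) (simp_all add: one)
  finally show ?thesis .
qed

lemma exponential_mean:
  assumes X: "distributed M lborel X (exponential_density 1)"
  shows "(\<integral>\<^sup>+\<omega>. ennreal (X \<omega>) \<partial>M) = 1" and "AE \<omega> in M. 0 < X \<omega>"
proof -
  have [measurable]: "X \<in> borel_measurable M" using distributed_measurable[OF X] by simp
  have "prob {\<omega> \<in> space M. 0 < X \<omega>} = 1"
    using exponential_distributedD_gt[OF X order_refl] by simp
  then show pos: "AE \<omega> in M. 0 < X \<omega>" by (subst (asm) prob_Collect_eq_1) auto
  have "integrable M X" "expectation X = 1"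
    using exponential_distributed_expectation[OF zero_less_one X] not_integrable_integral_eq[of M X] by auto
  then show "(\<integral>\<^sup>+\<omega>. ennreal (X \<omega>) \<partial>M) = 1"
    using pos by (subst nn_integral_eq_integral) (auto elim!: eventually_mono)
qed

text \<open>Each fading variable has mean 1, so the expectation of the series is the sum of
  \<open>r\<close>; a nonnegative series with finite mean converges almost surely.\<close>

lemma AE_summable_exponential:
  assumes h: "\<And>k. distributed M lborel (h k) (exponential_density 1)" and r: "summable r" "\<And>k. 0 \<le> r k"
  shows "AE \<omega> in M. summable (\<lambda>k. r k * h k \<omega>)"
proof -
  have [measurable]: "h k \<in> borel_measurable M" for k using distributed_measurable[OF h] by simp
  have "(\<integral>\<^sup>+\<omega>. (\<Sum>k. ennreal (r k * h k \<omega>)) \<partial>M) = (\<Sum>k. ennreal (r k))"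
    using r(2) by (subst nn_integral_suminf) (auto simp: ennreal_mult' nn_integral_cmult exponential_mean(1)[OF h])
  also have "\<dots> \<noteq> \<infinity>" using r by (simp add: suminf_ennreal2)
  finally have "AE \<omega> in M. (\<Sum>k. ennreal (r k * h k \<omega>)) \<noteq> \<infinity>"
    by (intro nn_integral_PInf_AE) auto
  moreover have "AE \<omega> in M. \<forall>k. 0 < h k \<omega>"
    by (subst AE_all_countable) (use exponential_mean(2)[OF h] in blast)
  ultimately show ?thesis
  proof eventually_elim
    fix \<omega> assume "(\<Sum>k. ennreal (r k * h k \<omega>)) \<noteq> \<infinity>" "\<forall>k. 0 < h k \<omega>"
    then show "summable (\<lambda>k. r k * h k \<omega>)"
      using r(2) by (intro summable_suminf_not_top) (auto simp: less_imp_le)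
  qed
qed

end

text \<open>The locations are deterministic while fading is averaged, so their coordinates of
  \<open>Z\<close> are constant. Activity and load are coded as reals to give the family one value
  type.\<close>

locale fading = prob_space +
  fixes h :: "tier \<Rightarrow> nat \<Rightarrow> 'a \<Rightarrow> real" and act :: "nat \<Rightarrow> 'a \<Rightarrow> bool" and L :: "'a \<Rightarrow> nat"
    and Z :: "source \<Rightarrow> 'a \<Rightarrow> real" and p :: real
  defines "Z \<equiv> \<lambda>s \<omega>. case s of Locations i \<Rightarrow> 0 | Fading i j \<Rightarrow> h i j \<omega>
      | Activity j \<Rightarrow> of_bool (act j \<omega>) | Load \<Rightarrow> real (L \<omega>)"
  assumes indep_Z: "indep_vars (\<lambda>_. borel) Z UNIV"
    and h: "\<And>i j. distributed M lborel (h i j) (exponential_density 1)"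
    and p: "\<And>j. prob {\<omega> \<in> space M. act j \<omega>} = p"
begin

lemma Z_source[simp]: "Z (Fading i j) = h i j" "Z (Activity j) = (\<lambda>\<omega>. of_bool (act j \<omega>))" "Z Load = (\<lambda>\<omega>. real (L \<omega>))"
  by (auto simp: Z_def)

lemma Z_measurable[measurable]: "Z s \<in> borel_measurable M"
  using indep_Z by (auto simp: indep_vars_def)

lemma h_measurable[measurable]: "h i j \<in> borel_measurable M"
  using Z_measurable[of "Fading i j"] by simp

lemma act_measurable[measurable]: "Measurable.pred M (act j)"
proof -
  have "Measurable.pred M (\<lambda>\<omega>. Z (Activity j) \<omega> = 1)" by measurable
  then show ?thesis by simp
qed

lemma L_measurable[measurable]: "L \<in> measurable M (count_space UNIV)"
proof -
  have "(\<lambda>\<omega>. nat \<lfloor>Z Load \<omega>\<rfloor>) \<in> measurable M (count_space UNIV)" by measurable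
  then show ?thesis by simp
qed

lemma p01: "0 \<le> p" "p \<le> 1"
  using p[of 0] by auto

text \<open>Given the activity, the transform is 1 / (1 + b) for an active helper and 1 for a silent
  one; averaging over the activity mixes the two.\<close>

lemma helper_laplace:
  assumes b: "0 \<le> b"
  shows "(\<integral>\<^sup>+\<omega>. ennreal (exp (- (of_bool (act k \<omega>) * b * h Helper k \<omega>))) \<partial>M) = ennreal (1 - p + p / (1 + b))"
proof -
  let ?A = "{Activity k}" and ?B = "{Fading Helper k}"
  let ?f = "\<lambda>(u :: source \<Rightarrow> real, v :: source \<Rightarrow> real). ennreal (exp (- (u (Activity k) * b * v (Fading Helper k))))"
  have UV: "indep_var (PiM ?A (\<lambda>_. borel)) (\<lambda>\<omega>. restrict (\<lambda>i. Z i \<omega>) ?A) (PiM ?B (\<lambda>_. borel)) (\<lambda>\<omega>. restrict (\<lambda>i. Z i \<omega>) ?B)"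
    by (rule indep_var_restrict[OF indep_Z]) auto
  have [measurable]: "(\<lambda>u. u (Activity k)) \<in> borel_measurable (PiM ?A (\<lambda>_. borel))"
    "(\<lambda>u. u (Fading Helper k)) \<in> borel_measurable (PiM ?B (\<lambda>_. borel))"
    by (auto intro: measurable_component_singleton)
  have "(\<integral>\<^sup>+\<omega>. ennreal (exp (- (of_bool (act k \<omega>) * b * h Helper k \<omega>))) \<partial>M) =
      (\<integral>\<^sup>+\<omega>. \<integral>\<^sup>+\<omega>'. ennreal (exp (- (of_bool (act k \<omega>) * b * h Helper k \<omega>'))) \<partial>M \<partial>M)"
    using nn_integral_indep_var[OF UV, of ?f] by simp
  also have "\<dots> = (\<integral>\<^sup>+\<omega>. ennreal (1 / (1 + of_bool (act k \<omega>) * b)) \<partial>M)"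
    using b by (simp add: exponential_laplace[OF h])
  also have "\<dots> = (\<integral>\<^sup>+\<omega>. indicator {\<omega>\<in>space M. \<not> act k \<omega>} \<omega> + ennreal (1 / (1 + b)) * indicator {\<omega>\<in>space M. act k \<omega>} \<omega> \<partial>M)"
    by (intro nn_integral_cong) (auto simp: indicator_def)
  also have "\<dots> = ennreal (1 - p) + ennreal (1 / (1 + b)) * ennreal p"
    by (simp add: nn_integral_add nn_integral_cmult emeasure_eq_measure p prob_neg)
  also have "\<dots> = ennreal (1 - p + p / (1 + b))"
    using b p01 by (simp flip: ennreal_mult ennreal_plus)
  finally show ?thesis .
qed

lemma finite_fading_product:
  assumes A: "finite A" and a: "\<And>k. 0 \<le> a k" and b: "\<And>k. 0 \<le> b k"
  shows "(\<integral>\<^sup>+\<omega>. indicator {l} (L \<omega>) * (\<Prod>k\<in>A. ennreal (exp (- (a k * h Macro k \<omega>)))) *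
      (\<Prod>k<n. ennreal (exp (- (of_bool (act k \<omega>) * b k * h Helper k \<omega>)))) \<partial>M) =
    emeasure M {\<omega> \<in> space M. L \<omega> = l} * (\<Prod>k\<in>A. ennreal (1 / (1 + a k))) * (\<Prod>k<n. ennreal (1 - p + p / (1 + b k)))"
    (is "?lhs = _")
proof -
  \<comment> \<open>The fading of a helper occurs only in a product with its activity, so the two
    form one block. Activities are no representatives in \<open>J\<close>, which keeps the blocks
    disjoint.\<close>
  define K where "K s = (case s of Fading Helper k \<Rightarrow> {s, Activity k} | _ \<Rightarrow> {s})" for s
  define J where "J = insert Load (Fading Macro ` A \<union> Fading Helper ` {..<n})"
  define \<phi> where "\<phi> s v = (case s of Load \<Rightarrow> indicator {real l} (v Load)
      | Fading Macro k \<Rightarrow> ennreal (exp (- (a k * v s)))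
      | Fading Helper k \<Rightarrow> ennreal (exp (- (v (Activity k) * b k * v s))) | _ \<Rightarrow> 1)" for s and v :: "source \<Rightarrow> real"
  have \<phi>: "\<phi> s \<in> borel_measurable (PiM (K s) (\<lambda>_. borel))" for s
  proof -
    have [measurable]: "(\<lambda>v. v i) \<in> borel_measurable (PiM (K s) (\<lambda>_. borel))" if "i \<in> K s" for i
      using that by (auto intro: measurable_component_singleton)
    show ?thesis
    proof (cases s)
      case (Fading i k)
      have "s \<in> K s" by (auto simp: K_def split: source.split tier.split)
      then show ?thesis using Fading
        by (cases i) (auto simp: \<phi>_def[abs_def] K_def)
    qed (auto simp: \<phi>_def[abs_def] K_def)
  qed
  have "indep_vars (\<lambda>j. PiM (K j) (\<lambda>_. borel)) (\<lambda>j \<omega>. restrict (\<lambda>i. Z i \<omega>) (K j)) J"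
    by (rule indep_vars_restrict[OF indep_Z])
      (auto simp: disjoint_family_on_def J_def K_def split: source.splits tier.splits)
  from indep_vars_compose2[OF this, of \<phi> "\<lambda>_. borel"] \<phi>
  have ind: "indep_vars (\<lambda>_. borel) (\<lambda>s \<omega>. \<phi> s (restrict (\<lambda>i. Z i \<omega>) (K s))) J" by auto
  have prod_J: "(\<Prod>s\<in>J. f s) = f Load * (\<Prod>k\<in>A. f (Fading Macro k)) * (\<Prod>k<n. f (Fading Helper k))" for f :: "source \<Rightarrow> ennreal"
  proof -
    have "(\<Prod>s\<in>J. f s) = f Load * (\<Prod>s\<in>Fading Macro ` A \<union> Fading Helper ` {..<n}. f s)"
      unfolding J_def using A by (intro prod.insert) auto
    also have "(\<Prod>s\<in>Fading Macro ` A \<union> Fading Helper ` {..<n}. f s) = (\<Prod>s\<in>Fading Macro ` A. f s) * (\<Prod>s\<in>Fading Helper ` {..<n}. f s)"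
      using A by (intro prod.union_disjoint) auto
    also have "\<dots> = (\<Prod>k\<in>A. f (Fading Macro k)) * (\<Prod>k<n. f (Fading Helper k))"
      by (simp add: prod.reindex inj_on_def)
    finally show ?thesis by (simp add: mult.assoc)
  qed
  have "?lhs = (\<integral>\<^sup>+\<omega>. (\<Prod>s\<in>J. \<phi> s (restrict (\<lambda>i. Z i \<omega>) (K s))) \<partial>M)"
    by (intro nn_integral_cong) (simp add: prod_J \<phi>_def K_def indicator_def)
  also have "\<dots> = (\<Prod>s\<in>J. \<integral>\<^sup>+\<omega>. \<phi> s (restrict (\<lambda>i. Z i \<omega>) (K s)) \<partial>M)"
    using A by (intro indep_vars_nn_integral ind) (auto simp: J_def)
  also have "\<dots> = (\<integral>\<^sup>+\<omega>. indicator {\<omega>\<in>space M. L \<omega> = l} \<omega> \<partial>M) * (\<Prod>k\<in>A. ennreal (1 / (1 + a k))) * (\<Prod>k<n. ennreal (1 - p + p / (1 + b k)))"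
    unfolding prod_J
  proof (intro arg_cong2[of _ _ _ _ "(*)"] prod.cong refl)
    show "(\<integral>\<^sup>+\<omega>. \<phi> Load (\<lambda>i\<in>K Load. Z i \<omega>) \<partial>M) = (\<integral>\<^sup>+\<omega>. indicator {\<omega>\<in>space M. L \<omega> = l} \<omega> \<partial>M)"
      by (intro nn_integral_cong) (simp add: \<phi>_def K_def indicator_def)
  qed (simp_all add: \<phi>_def K_def exponential_laplace[OF h a] helper_laplace[OF b])
  finally show ?thesis by simp
qed

text \<open>
  The interference enters only through its partial sums, so that neither summability nor an infinite
  product of random variables has to be considered.
\<close>

lemma success_probability:
  fixes a b :: "nat \<Rightarrow> real" and c :: real and \<sigma> l :: nat
  assumes a: "\<And>k. 0 \<le> a k" and b: "\<And>k. 0 \<le> b k" and c: "0 \<le> c"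
  defines "Q \<equiv> \<lambda>n \<omega>. c + (\<Sum>k\<in>{..<n} - {\<sigma>}. a k * h Macro k \<omega>) + (\<Sum>k<n. of_bool (act k \<omega>) * b k * h Helper k \<omega>)"
  shows "emeasure M {\<omega> \<in> space M. L \<omega> = l \<and> (\<forall>n. Q n \<omega> \<le> h Macro \<sigma> \<omega>)} =
    emeasure M {\<omega> \<in> space M. L \<omega> = l} * ennreal (exp (- c)) *
    (iprod (\<lambda>k. if k = \<sigma> then 1 else 1 / (1 + a k)) * iprod (\<lambda>k. 1 - p + p / (1 + b k)))"
proof -
  have [measurable]: "Q n \<in> borel_measurable M" for n unfolding Q_def by measurable
  have pos: "AE \<omega> in M. \<forall>i k. 0 < h i k \<omega>"
  proof -
    have "AE \<omega> in M. \<forall>k. 0 < h i k \<omega>" for i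
      by (subst AE_all_countable) (use exponential_mean(2)[OF h] in blast)
    from this[of Macro] this[of Helper] show ?thesis
      by eventually_elim (metis tier.exhaust)
  qed
  have meas: "(\<lambda>\<omega>. indicator {l} (L \<omega>) * (\<Prod>k\<in>{..<n} - {\<sigma>}. ennreal (exp (- (a k * h Macro k \<omega>)))) *
      (\<Prod>k<n. ennreal (exp (- (of_bool (act k \<omega>) * b k * h Helper k \<omega>))))) \<in> borel_measurable M" for n
    by (intro borel_measurable_times_ennreal borel_measurable_prod_ennreal measurable_compose[OF L_measurable, of "indicator {l}"]) auto
  have finite_n: "emeasure M {\<omega> \<in> space M. L \<omega> = l \<and> Q n \<omega> \<le> h Macro \<sigma> \<omega>} =
      emeasure M {\<omega> \<in> space M. L \<omega> = l} * ennreal (exp (- c)) *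
      (ennreal (\<Prod>k<n. if k = \<sigma> then 1 else 1 / (1 + a k)) * ennreal (\<Prod>k<n. 1 - p + p / (1 + b k)))" for n
  proof -
    \<comment> \<open>\<open>Q n\<close> omits the fading of \<sigma>, so this fading is independent
      of \<open>Q n\<close> and of the load, and its exponential tail can be inserted for frozen
      values of the rest.\<close>
    let ?B = "{Fading Macro \<sigma>}" let ?A = "- ?B"
    define Q' where "Q' u = c + (\<Sum>k\<in>{..<n} - {\<sigma>}. a k * u (Fading Macro k)) + (\<Sum>k<n. u (Activity k) * b k * u (Fading Helper k))" for u :: "source \<Rightarrow> real"
    let ?f = "\<lambda>(u :: source \<Rightarrow> real, v :: source \<Rightarrow> real). indicator {real l} (u Load) * indicator {q. 0 \<le> q} (v (Fading Macro \<sigma>) - Q' u) :: ennreal"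
    have UV: "indep_var (PiM ?A (\<lambda>_. borel)) (\<lambda>\<omega>. restrict (\<lambda>i. Z i \<omega>) ?A) (PiM ?B (\<lambda>_. borel)) (\<lambda>\<omega>. restrict (\<lambda>i. Z i \<omega>) ?B)"
      by (rule indep_var_restrict[OF indep_Z]) auto
    have comp: "(\<lambda>u. u i) \<in> borel_measurable (PiM ?A (\<lambda>_. borel))" if "i \<in> ?A" for i
      using that by (auto intro: measurable_component_singleton)
    have [measurable]: "(\<lambda>u. u (Fading Macro \<sigma>)) \<in> borel_measurable (PiM ?B (\<lambda>_. borel))"
      by (auto intro: measurable_component_singleton)
    have [measurable]: "Q' \<in> borel_measurable (PiM ?A (\<lambda>_. borel))"
      unfolding Q'_def by (intro borel_measurable_add borel_measurable_sum borel_measurable_times borel_measurable_const comp) auto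
    have [measurable]: "(\<lambda>u. u Load) \<in> borel_measurable (PiM ?A (\<lambda>_. borel))"
      by (intro comp) auto
    have Q': "Q' (restrict (\<lambda>i. Z i \<omega>) ?A) = Q n \<omega>" for \<omega>
      unfolding Q'_def Q_def by (intro arg_cong2[of _ _ _ _ "(+)"] sum.cong refl) auto
    have "emeasure M {\<omega> \<in> space M. L \<omega> = l \<and> Q n \<omega> \<le> h Macro \<sigma> \<omega>} =
        (\<integral>\<^sup>+\<omega>. ?f (restrict (\<lambda>i. Z i \<omega>) ?A, restrict (\<lambda>i. Z i \<omega>) ?B) \<partial>M)"
      by (subst nn_integral_indicator[symmetric], measurable, intro nn_integral_cong)
        (simp add: Q' indicator_def)
    also have "\<dots> = (\<integral>\<^sup>+\<omega>. \<integral>\<^sup>+\<omega>'. ?f (restrict (\<lambda>i. Z i \<omega>) ?A, restrict (\<lambda>i. Z i \<omega>') ?B) \<partial>M \<partial>M)"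
      by (rule nn_integral_indep_var[OF UV]) measurable
    also have "\<dots> = (\<integral>\<^sup>+\<omega>. ennreal (exp (- c)) * (indicator {l} (L \<omega>) * (\<Prod>k\<in>{..<n} - {\<sigma>}. ennreal (exp (- (a k * h Macro k \<omega>)))) *
      (\<Prod>k<n. ennreal (exp (- (of_bool (act k \<omega>) * b k * h Helper k \<omega>))))) \<partial>M)"
      using pos
    proof (intro nn_integral_cong_AE, eventually_elim)
      fix \<omega> assume pos: "\<forall>i k. 0 < h i k \<omega>"
      have Q0: "0 \<le> Q n \<omega>"
        unfolding Q_def using pos a b c by (intro add_nonneg_nonneg sum_nonneg mult_nonneg_nonneg) (auto simp: less_imp_le)
      have "(\<integral>\<^sup>+\<omega>'. ?f (restrict (\<lambda>i. Z i \<omega>) ?A, restrict (\<lambda>i. Z i \<omega>') ?B) \<partial>M) =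
          (\<integral>\<^sup>+\<omega>'. indicator {l} (L \<omega>) * indicator {\<omega>' \<in> space M. Q n \<omega> \<le> h Macro \<sigma> \<omega>'} \<omega>' \<partial>M)"
        by (intro nn_integral_cong) (simp add: Q' indicator_def)
      also have "\<dots> = indicator {l} (L \<omega>) * ennreal (exp (- Q n \<omega>))"
        by (subst nn_integral_cmult) (simp_all add: exponential_tail_le[OF h Q0])
      also have "ennreal (exp (- Q n \<omega>)) = ennreal (exp (- c)) * ((\<Prod>k\<in>{..<n} - {\<sigma>}. ennreal (exp (- (a k * h Macro k \<omega>)))) *
          (\<Prod>k<n. ennreal (exp (- (of_bool (act k \<omega>) * b k * h Helper k \<omega>)))))"
      proof -
        have e: "(\<Prod>k\<in>K. ennreal (exp (- f k))) = ennreal (exp (- (\<Sum>k\<in>K. f k)))" if "finite K" for K :: "nat set" and f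
          using that by (simp add: prod_ennreal exp_sum[symmetric] sum_negf)
        have "exp (- Q n \<omega>) = exp (- c) * (exp (- (\<Sum>k\<in>{..<n} - {\<sigma>}. a k * h Macro k \<omega>)) *
            exp (- (\<Sum>k<n. of_bool (act k \<omega>) * b k * h Helper k \<omega>)))"
          unfolding Q_def exp_add[symmetric] by (intro arg_cong[of _ _ exp]) linarith
        then show ?thesis
          by (simp only: e finite_lessThan finite_Diff ennreal_mult exp_ge_zero mult_nonneg_nonneg)
      qed
      finally show "(\<integral>\<^sup>+\<omega>'. ?f (restrict (\<lambda>i. Z i \<omega>) ?A, restrict (\<lambda>i. Z i \<omega>') ?B) \<partial>M) =
          ennreal (exp (- c)) * (indicator {l} (L \<omega>) * (\<Prod>k\<in>{..<n} - {\<sigma>}. ennreal (exp (- (a k * h Macro k \<omega>)))) *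
      (\<Prod>k<n. ennreal (exp (- (of_bool (act k \<omega>) * b k * h Helper k \<omega>)))))"
        by (simp only: mult_ac)
    qed
    also have "\<dots> = ennreal (exp (- c)) * (emeasure M {\<omega> \<in> space M. L \<omega> = l} * (\<Prod>k\<in>{..<n} - {\<sigma>}. ennreal (1 / (1 + a k))) * (\<Prod>k<n. ennreal (1 - p + p / (1 + b k))))"
      by (rule trans[OF nn_integral_cmult[OF meas]])
        (intro arg_cong[of _ _ "\<lambda>x. _ * x"] finite_fading_product finite_Diff finite_lessThan a b)
    also have "(\<Prod>k\<in>{..<n} - {\<sigma>}. ennreal (1 / (1 + a k))) = ennreal (\<Prod>k<n. if k = \<sigma> then 1 else 1 / (1 + a k))"
      using a by (subst prod_ennreal, simp) (auto intro!: arg_cong[of _ _ ennreal] prod.mono_neutral_cong_left split: if_splits)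
    also have "(\<Prod>k<n. ennreal (1 - p + p / (1 + b k))) = ennreal (\<Prod>k<n. 1 - p + p / (1 + b k))"
      using b p01 by (intro prod_ennreal) (simp add: add_nonneg_nonneg)
    finally show ?thesis by (simp only: mult_ac)
  qed
  \<comment> \<open>Requiring all earlier inequalities makes the events decrease at every outcome,
    whereas \<open>Q\<close> is known to increase in n only where the fading values are
    positive.\<close>
  define E where "E n = {\<omega> \<in> space M. L \<omega> = l \<and> (\<forall>m\<le>n. Q m \<omega> \<le> h Macro \<sigma> \<omega>)}" for n
  have E_eq: "emeasure M (E n) = emeasure M {\<omega> \<in> space M. L \<omega> = l \<and> Q n \<omega> \<le> h Macro \<sigma> \<omega>}" for n
    unfolding E_def
  proof (rule emeasure_eq_AE)
    show "AE \<omega> in M. \<omega> \<in> {\<omega> \<in> space M. L \<omega> = l \<and> (\<forall>m\<le>n. Q m \<omega> \<le> h Macro \<sigma> \<omega>)} \<longleftrightarrow>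
        \<omega> \<in> {\<omega> \<in> space M. L \<omega> = l \<and> Q n \<omega> \<le> h Macro \<sigma> \<omega>}"
      using pos
    proof eventually_elim
      fix \<omega> assume pos: "\<forall>i k. 0 < h i k \<omega>"
      have "Q m \<omega> \<le> Q n \<omega>" if "m \<le> n" for m
        unfolding Q_def using that pos a b
        by (intro add_mono sum_mono2 order_refl mult_nonneg_nonneg) (auto simp: less_imp_le)
      then show "\<omega> \<in> {\<omega> \<in> space M. L \<omega> = l \<and> (\<forall>m\<le>n. Q m \<omega> \<le> h Macro \<sigma> \<omega>)} \<longleftrightarrow>
        \<omega> \<in> {\<omega> \<in> space M. L \<omega> = l \<and> Q n \<omega> \<le> h Macro \<sigma> \<omega>}"
        by (auto intro: order_trans)
    qed
  qed measurable
  have "(\<lambda>n. emeasure M (E n)) \<longlonglongrightarrow> emeasure M (\<Inter>n. E n)"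
    by (rule Lim_emeasure_decseq) (auto simp: E_def decseq_def)
  moreover have "(\<Inter>n. E n) = {\<omega> \<in> space M. L \<omega> = l \<and> (\<forall>n. Q n \<omega> \<le> h Macro \<sigma> \<omega>)}"
    by (auto simp: E_def)
  moreover have "(\<lambda>n. emeasure M (E n)) \<longlonglongrightarrow> emeasure M {\<omega> \<in> space M. L \<omega> = l} * ennreal (exp (- c)) *
    (iprod (\<lambda>k. if k = \<sigma> then 1 else 1 / (1 + a k)) * iprod (\<lambda>k. 1 - p + p / (1 + b k)))"
  proof -
    have 1: "(\<lambda>n. ennreal (\<Prod>k<n. if k = \<sigma> then 1 else 1 / (1 + a k))) \<longlonglongrightarrow> iprod (\<lambda>k. if k = \<sigma> then 1 else 1 / (1 + a k))"
      using a by (intro iprod_tendsto) (auto simp: divide_le_eq_1_pos add_pos_nonneg)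
    have "p / (1 + b k) \<le> p / 1" for k
      using b[of k] p01 by (intro divide_left_mono) auto
    then have le: "1 - p + p / (1 + b k) \<le> 1" for k by simp
    have ge: "0 \<le> 1 - p + p / (1 + b k)" for k
      using b[of k] p01 by (intro add_nonneg_nonneg divide_nonneg_nonneg) auto
    have 2: "(\<lambda>n. ennreal (\<Prod>k<n. 1 - p + p / (1 + b k))) \<longlonglongrightarrow> iprod (\<lambda>k. 1 - p + p / (1 + b k))"
      by (intro iprod_tendsto le ge)
    have fin: "iprod f \<noteq> \<infinity>" for f using iprod_le_1[of f] by (auto simp: top_unique)
    show ?thesis
      unfolding E_eq finite_n using fin
      by (intro tendsto_mult_ennreal tendsto_const 1 2) (auto simp: ennreal_mult_eq_top_iff emeasure_eq_measure)
  qed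
  ultimately show ?thesis by (auto intro: LIMSEQ_unique)
qed

end

subsection \<open>Received power and rate\<close>

text \<open>For real series unconditional and absolute convergence coincide, so the default value 0
  of \<open>infsum\<close> is taken exactly when the absolute series is infinite. In this form the
  sum is built from measurable operations.\<close>

lemma infsum_nat_eq_suminf:
  fixes f :: "nat \<Rightarrow> real"
  shows "infsum f {j. Q j} = (let g = \<lambda>j. if Q j then f j else 0 in
    if (\<Sum>j. ennreal \<bar>g j\<bar>) = \<infinity> then 0 else suminf g)"
proof -
  define g where "g j = (if Q j then f j else 0)" for j
  have "infsum f {j. Q j} = infsum g UNIV"
    by (rule infsum_cong_neutral) (auto simp: g_def)
  also have "\<dots> = (if (\<Sum>j. ennreal \<bar>g j\<bar>) = \<infinity> then 0 else suminf g)"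
  proof (cases "summable (\<lambda>j. \<bar>g j\<bar>)")
    case True
    then have "(g has_sum suminf g) UNIV"
      by (intro norm_summable_imp_has_sum summable_sums) (auto dest: summable_rabs_cancel)
    then show ?thesis using True by (simp add: infsumI suminf_ennreal2)
  next
    case False
    then have "\<not> g summable_on UNIV"
      using summable_on_iff_abs_summable_on_real[of g UNIV] summable_on_imp_summable[of "\<lambda>j. norm (g j)"] by auto
    moreover have "(\<Sum>j. ennreal \<bar>g j\<bar>) = \<infinity>"
      using False summable_suminf_not_top[of "\<lambda>j. \<bar>g j\<bar>", OF abs_ge_zero]
      unfolding infinity_ennreal_def by blast
    ultimately show ?thesis by (simp add: infsum_not_exists)
  qed
  finally show ?thesis by (simp add: g_def[abs_def] Let_def)
qed

lemma infsum_eq_suminf: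
  fixes f :: "nat \<Rightarrow> real"
  assumes "\<And>j. Q j \<Longrightarrow> 0 \<le> f j" "summable (\<lambda>j. if Q j then f j else 0)"
  shows "infsum f {j. Q j} = (\<Sum>j. if Q j then f j else 0)"
proof -
  have e: "(\<lambda>j. \<bar>if Q j then f j else 0\<bar>) = (\<lambda>j. if Q j then f j else 0)" using assms(1) by auto
  then have "(\<Sum>j. ennreal \<bar>if Q j then f j else 0\<bar>) = ennreal (\<Sum>j. if Q j then f j else 0)"
    using assms by (subst suminf_ennreal2) auto
  then show ?thesis unfolding infsum_nat_eq_suminf Let_def by simp
qed

lemma measurable_infsum_nat:
  fixes f :: "nat \<Rightarrow> 'a \<Rightarrow> real"
  assumes [measurable]: "\<And>j. f j \<in> borel_measurable N" "\<And>j. Measurable.pred N (Q j)"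
  shows "(\<lambda>\<omega>. infsum (\<lambda>j. f j \<omega>) {j. Q j \<omega>}) \<in> borel_measurable N"
  unfolding infsum_nat_eq_suminf Let_def by measurable

lemma measurable_rate_Mp:
  fixes x :: "tier \<Rightarrow> nat \<Rightarrow> 'a \<Rightarrow> real^2"
  assumes [measurable]: "\<And>i j. x i j \<in> borel_measurable N" "\<And>i j. h i j \<in> borel_measurable N"
    "\<And>j. Measurable.pred N (act j)" "L \<in> measurable N (count_space UNIV)"
  shows "(\<lambda>\<omega>. rate_Mp \<alpha> P noise W (\<lambda>i j. x i j \<omega>) (\<lambda>i j. h i j \<omega>) (\<lambda>j. act j \<omega>) (L \<omega>)) \<in> borel_measurable N"
proof -
  have rec: "(\<lambda>\<omega>. rec_power \<alpha> P (\<lambda>i j. x i j \<omega>) (\<lambda>i j. h i j \<omega>) i j) \<in> borel_measurable N" for i j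
    unfolding rec_power_def by measurable
  have \<sigma>: "(\<lambda>\<omega>. serving \<alpha> P (\<lambda>i j. x i j \<omega>)) \<in> measurable N (count_space UNIV)"
    unfolding serving_def by measurable
  have "(\<lambda>\<omega>. rec_power \<alpha> P (\<lambda>i j. x i j \<omega>) (\<lambda>i j. h i j \<omega>) Macro (serving \<alpha> P (\<lambda>i j. x i j \<omega>))) \<in> borel_measurable N"
    by (rule measurable_compose_countable[OF rec \<sigma>])
  moreover have "(\<lambda>\<omega>. interference_Macro \<alpha> P (\<lambda>i j. x i j \<omega>) (\<lambda>i j. h i j \<omega>)) \<in> borel_measurable N"
  proof -
    have "UNIV - {s} = {j. j \<noteq> s}" for s :: nat by auto
    moreover have "Measurable.pred N (\<lambda>\<omega>. j \<noteq> serving \<alpha> P (\<lambda>i j. x i j \<omega>))" for j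
      using \<sigma> by measurable
    ultimately show ?thesis
      unfolding interference_Macro_def by (simp only: measurable_infsum_nat rec)
  qed
  moreover have "(\<lambda>\<omega>. interference_Helper \<alpha> P (\<lambda>i j. x i j \<omega>) (\<lambda>i j. h i j \<omega>) (\<lambda>j. act j \<omega>)) \<in> borel_measurable N"
    unfolding interference_Helper_def by (intro measurable_infsum_nat rec) measurable
  ultimately have "(\<lambda>\<omega>. SINR \<alpha> P noise (\<lambda>i j. x i j \<omega>) (\<lambda>i j. h i j \<omega>) (\<lambda>j. act j \<omega>)) \<in> borel_measurable N"
    unfolding SINR_def by measurable
  then show ?thesis
    unfolding rate_Mp_def by measurable
qed

section \<open>Almost sure properties of the point processes\<close>

context prob_space
begin

text \<open>The count in a null set is 0 with probability exp 0 = 1. A station at the origin must be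
  excluded because 0 powr (-\<alpha>) = 0 would give it no power at all.\<close>

lemma ppp_points_nonzero:
  fixes X :: "nat \<Rightarrow> 'a \<Rightarrow> 'b::euclidean_space"
  assumes X: "homogeneous_ppp lam X"
  shows "AE \<omega> in M. \<forall>j. X j \<omega> \<noteq> 0"
proof -
  have [measurable]: "num_points X {0::'b} \<in> borel_measurable M"
    by (rule measurable_num_points[OF X]) simp
  have "prob {\<omega> \<in> space M. num_points X {0::'b} \<omega> = of_nat 0} = (lam * measure lborel {0::'b}) ^ 0 / fact 0 * exp (- (lam * measure lborel {0::'b}))"
  proof -
    have "{0::'b} \<in> sets borel" "emeasure lborel {0::'b} < \<infinity>" by auto
    with X show ?thesis unfolding homogeneous_ppp_def by blast
  qed
  then have "prob {\<omega> \<in> space M. num_points X {0::'b} \<omega> = 0} = 1" by simp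
  then have "AE \<omega> in M. num_points X {0::'b} \<omega> = 0"
    by (subst (asm) prob_Collect_eq_1) auto
  then show ?thesis
    by eventually_elim (auto simp: num_points_def emeasure_count_space_eq_0)
qed

text \<open>One minus the factor of a helper is p times the integrand of \<open>H\<close>, so random
  activity acts like a reduction of the intensity by the factor p.\<close>

lemma helper_generating_functional:
  fixes X :: "nat \<Rightarrow> 'a \<Rightarrow> real^2"
  assumes X: "homogeneous_ppp lam X" "0 < lam" and \<alpha>: "2 < \<alpha>" and \<kappa>: "0 < \<kappa>" and p: "0 \<le> p" "p \<le> 1"
  shows "(\<integral>\<^sup>+\<omega>. iprod (\<lambda>j. 1 - p + p / (1 + \<kappa> * norm (X j \<omega>) powr - \<alpha>)) \<partial>M) =
    ennreal (exp (- (lam * p * pi * H \<kappa> \<alpha>)))"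
proof -
  \<comment> \<open>The power of pi converts from radius to area; since \<open>H\<close> is
    homogeneous of degree 2 / \<alpha> in its first argument, it reappears as the factor pi in the
    result.\<close>
  define K where "K = \<kappa> * pi powr (\<alpha> / 2)"
  have K: "0 < K" using \<kappa> by (simp add: K_def)
  define u where "u t = 1 - p + p / (1 + K * t powr - (\<alpha> / 2))" for t
  have pos: "0 < 1 + K * t powr - (\<alpha> / 2)" for t using K by (simp add: add_pos_nonneg)
  have u1: "1 - u t = p * (1 - 1 / (1 + K * t powr - (\<alpha> / 2)))" for t
    by (simp add: u_def algebra_simps)
  have v: "0 \<le> 1 - 1 / (1 + K * t powr - (\<alpha> / 2))" "1 - 1 / (1 + K * t powr - (\<alpha> / 2)) \<le> 1" for t
    using K pos[of t] by (auto simp: divide_le_eq_1)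
  have u01: "0 \<le> u t" "u t \<le> 1" for t
    using u1[of t] mult_nonneg_nonneg[OF p(1) v(1)[of t]] mult_le_one[OF p(2) v[of t]] by linarith+
  have eq: "\<kappa> * norm (x :: real^2) powr - \<alpha> = K * (pi * (norm x)\<^sup>2) powr - (\<alpha> / 2)" for x
  proof (cases "x = 0")
    case False
    then have "(pi * (norm x)\<^sup>2) powr - (\<alpha> / 2) = pi powr - (\<alpha> / 2) * norm x powr - \<alpha>"
      by (simp add: powr_mult powr_powr flip: powr_numeral)
    then show ?thesis by (simp add: K_def powr_minus field_simps)
  qed simp
  have H: "H K \<alpha> = pi * H \<kappa> \<alpha>"
    using \<kappa> \<alpha> by (simp add: H_def K_def powr_mult powr_powr)
  have H0: "0 \<le> H K \<alpha>" using \<alpha> by (rule H_nonneg)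
  have "(\<integral>\<^sup>+t\<in>{0..}. ennreal (1 - u t) \<partial>lborel) =
      (\<integral>\<^sup>+t. ennreal p * (ennreal (1 - 1 / (1 + K * t powr - (\<alpha> / 2))) * indicator {0<..} t) \<partial>lborel)"
    using p v by (intro nn_integral_cong) (auto simp: u1 ennreal_mult indicator_def)
  also have "\<dots> = ennreal p * ennreal (H K \<alpha>)"
    by (subst nn_integral_cmult) (auto simp: nn_integral_H[OF \<alpha> K])
  also have "\<dots> = ennreal (p * H K \<alpha>)" using p H0 by (simp add: ennreal_mult)
  finally have I: "(\<integral>\<^sup>+t\<in>{0..}. ennreal (1 - u t) \<partial>lborel) = ennreal (p * H K \<alpha>)" .
  have "(\<integral>\<^sup>+\<omega>. iprod (\<lambda>j. u (pi * (norm (X j \<omega>))\<^sup>2)) \<partial>M) = ennreal (exp (- (lam * (p * H K \<alpha>))))"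
    by (rule radial_generating_functional[OF X _ u01 I]) (use p H0 in \<open>auto simp: u_def\<close>)
  then show ?thesis by (simp add: u_def eq H mult_ac)
qed

text \<open>Where the series diverges, the product of the factors 1 / (1 + k r) is 0 for every k >
  0. Hence the generating functional exp (- lam pi H k), with all points active, is a lower bound
  for the probability of convergence, and it tends to 1 as k tends to 0.\<close>

lemma ppp_path_loss_summable:
  fixes X :: "nat \<Rightarrow> 'a \<Rightarrow> real^2"
  assumes X: "homogeneous_ppp lam X" "0 < lam" and \<alpha>: "2 < \<alpha>"
  shows "AE \<omega> in M. summable (\<lambda>j. norm (X j \<omega>) powr - \<alpha>)"
proof -
  have [measurable]: "X j \<in> borel_measurable M" for j
    using X by (auto simp: homogeneous_ppp_def)
  define S where "S = {\<omega> \<in> space M. (\<Sum>j. ennreal (norm (X j \<omega>) powr - \<alpha>)) \<noteq> \<infinity>}"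
  have [measurable]: "S \<in> events" unfolding S_def by measurable
  have S: "summable (\<lambda>j. norm (X j \<omega>) powr - \<alpha>)" if "\<omega> \<in> S" for \<omega>
    using that summable_suminf_not_top[of "\<lambda>j. norm (X j \<omega>) powr - \<alpha>", OF powr_ge_zero]
    unfolding S_def infinity_ennreal_def by blast
  have not_S: "\<not> summable (\<lambda>j. norm (X j \<omega>) powr - \<alpha>)" if "\<omega> \<in> space M - S" for \<omega>
  proof
    assume "summable (\<lambda>j. norm (X j \<omega>) powr - \<alpha>)"
    then have "(\<Sum>j. ennreal (norm (X j \<omega>) powr - \<alpha>)) = ennreal (\<Sum>j. norm (X j \<omega>) powr - \<alpha>)"
      by (intro suminf_ennreal2 powr_ge_zero)
    then have "(\<Sum>j. ennreal (norm (X j \<omega>) powr - \<alpha>)) \<noteq> \<infinity>" by (simp only: infinity_ennreal_def ennreal_neq_top not_False_eq_True)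
    with that show False unfolding S_def by blast
  qed
  define k where "k n = 1 / real (Suc n)" for n
  have k: "0 < k n" for n by (simp add: k_def)
  have "ennreal (exp (- (lam * 1 * pi * H (k n) \<alpha>))) \<le> ennreal (prob S)" for n
  proof -
    have "ennreal (exp (- (lam * 1 * pi * H (k n) \<alpha>))) = (\<integral>\<^sup>+\<omega>. iprod (\<lambda>j. 1 - 1 + 1 / (1 + k n * norm (X j \<omega>) powr - \<alpha>)) \<partial>M)"
      by (rule helper_generating_functional[OF X \<alpha> k, symmetric]) auto
    also have "\<dots> \<le> (\<integral>\<^sup>+\<omega>. indicator S \<omega> \<partial>M)"
    proof (rule nn_integral_mono)
      fix \<omega> assume \<omega>: "\<omega> \<in> space M"
      show "iprod (\<lambda>j. 1 - 1 + 1 / (1 + k n * norm (X j \<omega>) powr - \<alpha>)) \<le> indicator S \<omega>"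
        using iprod_le_1 iprod_not_summable[OF _ not_S k, of \<omega> n] \<omega> by (cases "\<omega> \<in> S") auto
    qed
    finally show ?thesis by (simp add: emeasure_eq_measure)
  qed
  then have le: "exp (- (lam * 1 * pi * H (k n) \<alpha>)) \<le> prob S" for n
    by (simp add: ennreal_le_iff)
  have "k \<longlonglongrightarrow> 0" unfolding k_def using LIMSEQ_inverse_real_of_nat by (simp add: inverse_eq_divide)
  then have "(\<lambda>n. k n powr (2 / \<alpha>)) \<longlonglongrightarrow> 0 powr (2 / \<alpha>)"
    using \<alpha> k by (intro tendsto_powr' tendsto_const) (auto simp: less_imp_le)
  then have "(\<lambda>n. exp (- (lam * 1 * pi * (2 / \<alpha> * k n powr (2 / \<alpha>) * Beta (2 / \<alpha>) (1 - 2 / \<alpha>))))) \<longlonglongrightarrow>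
      exp (- (lam * 1 * pi * (2 / \<alpha> * 0 * Beta (2 / \<alpha>) (1 - 2 / \<alpha>))))"
    using \<alpha> by (intro tendsto_intros) simp
  then have "1 \<le> prob S"
    using le by (intro LIMSEQ_le_const2[of _ 1 "prob S"]) (auto simp: H_def)
  then have "prob S = 1" using prob_le_1[of S] by linarith
  then have "AE \<omega> in M. \<omega> \<in> S" by (subst (asm) prob_eq_1) auto
  then show ?thesis by eventually_elim (rule S)
qed

end

text \<open>The terms of a convergent series tend to 0, so all but finitely many powers lie below
  the first one and the maximum is attained. Without a maximizer \<open>LEAST\<close> would be
  unspecified.\<close>

lemma serving_nearest:
  fixes x :: "tier \<Rightarrow> nat \<Rightarrow> real^2"
  assumes "0 < \<alpha>" "0 < P Macro" and nz: "\<And>k. x Macro k \<noteq> 0"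
    and sum: "summable (\<lambda>k. norm (x Macro k) powr - \<alpha>)"
  shows "norm (x Macro (serving \<alpha> P x)) \<le> norm (x Macro k)"
proof -
  define r where "r k = norm (x Macro k) powr - \<alpha>" for k
  have "0 < r 0" using nz by (simp add: r_def)
  moreover have "r \<longlonglongrightarrow> 0" using summable_LIMSEQ_zero[OF sum] by (simp add: r_def[abs_def])
  ultimately have "\<forall>\<^sub>F k in sequentially. r k < r 0" by (rule order_tendstoD(2)[rotated])
  then obtain n where n: "\<And>k. n \<le> k \<Longrightarrow> r k < r 0" by (auto simp: eventually_sequentially)
  obtain j where j: "j \<le> n" "r j = Max (r ` {..n})"
    using Max_in[of "r ` {..n}"] by fastforce
  have "r k \<le> r j" for k
  proof (cases "k \<le> n")
    case True then show ?thesis unfolding j(2) by (intro Max_ge) auto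
  next
    case False
    then have "r k < r 0" by (intro n) simp
    also have "r 0 \<le> r j" unfolding j(2) by (intro Max_ge) auto
    finally show ?thesis by simp
  qed
  then have "\<exists>j. \<forall>k. P Macro * norm (x Macro k) powr - \<alpha> \<le> P Macro * norm (x Macro j) powr - \<alpha>"
    using assms by (auto simp: r_def intro!: exI[of _ j])
  from LeastI_ex[OF this] have "norm (x Macro k) powr - \<alpha> \<le> norm (x Macro (serving \<alpha> P x)) powr - \<alpha>"
    unfolding serving_def[symmetric] using assms by simp
  then show ?thesis
    using powr_less_mono2_neg[of "- \<alpha>" "norm (x Macro k)" "norm (x Macro (serving \<alpha> P x))"] assms by force
qed

section \<open>Success probability at fixed locations\<close>

context fading
begin

text \<open>Almost surely the rate reaches the target if and only if the fading of the serving
  station is at least s times interference plus noise, where s = \<delta> z^\<alpha> / P Macro. The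
  factor 1 + \<delta> compensates for letting the first product run over all stations, the serving
  one included.\<close>

lemma success_given_locations:
  fixes x :: "tier \<Rightarrow> nat \<Rightarrow> real^2" and P :: "tier \<Rightarrow> real" and \<alpha> noise W R\<^sub>0 :: real and l :: nat
  assumes \<alpha>: "0 < \<alpha>" and P: "\<And>i. 0 < P i" and "0 < W" "0 < R\<^sub>0" "0 \<le> noise" "0 < l"
    and nz: "\<And>i k. x i k \<noteq> 0" and sum: "\<And>i. summable (\<lambda>k. norm (x i k) powr - \<alpha>)"
  defines "\<delta> \<equiv> 2 powr (real l * R\<^sub>0 / W) - 1" and "z \<equiv> norm (x Macro (serving \<alpha> P x))"
  shows "emeasure M {\<omega> \<in> space M. L \<omega> = l \<and> R\<^sub>0 \<le> rate_Mp \<alpha> P noise W x (\<lambda>i j. h i j \<omega>) (\<lambda>j. act j \<omega>) l} =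
    emeasure M {\<omega> \<in> space M. L \<omega> = l} * ennreal (exp (- (\<delta> * z powr \<alpha> / P Macro * noise))) *
    (ennreal (1 + \<delta>) * iprod (\<lambda>k. 1 / (1 + \<delta> * (z / norm (x Macro k)) powr \<alpha>)) *
     iprod (\<lambda>k. 1 - p + p / (1 + \<delta> * z powr \<alpha> / P Macro * P Helper * norm (x Helper k) powr - \<alpha>)))"
proof -
  define \<sigma> where "\<sigma> = serving \<alpha> P x"
  define s where "s = \<delta> * z powr \<alpha> / P Macro"
  define a where "a k = s * P Macro * norm (x Macro k) powr - \<alpha>" for k
  define b where "b k = s * P Helper * norm (x Helper k) powr - \<alpha>" for k
  define c where "c = s * noise"
  define Q where "Q n \<omega> = c + (\<Sum>k\<in>{..<n} - {\<sigma>}. a k * h Macro k \<omega>) + (\<Sum>k<n. of_bool (act k \<omega>) * b k * h Helper k \<omega>)" for n \<omega>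
  have \<delta>: "0 < \<delta>" unfolding \<delta>_def using assms by (simp add: gr_one_powr)
  have z: "0 < z" unfolding z_def using nz by simp
  have s: "0 < s" unfolding s_def using \<delta> z P by simp
  have a_eq: "a k = \<delta> * (z / norm (x Macro k)) powr \<alpha>" for k
    using z P[of Macro] nz by (simp add: a_def s_def powr_divide powr_minus field_simps)
  have a0: "0 \<le> a k" and b0: "0 \<le> b k" and c0: "0 \<le> c" for k
    using s P[of Macro] P[of Helper] \<open>0 \<le> noise\<close> unfolding a_def b_def c_def
    by (intro mult_nonneg_nonneg powr_ge_zero; simp add: less_imp_le)+
  have [measurable]: "Q n \<in> borel_measurable M" for n unfolding Q_def by measurable
  have [measurable]: "(\<lambda>\<omega>. rate_Mp \<alpha> P noise W x (\<lambda>i j. h i j \<omega>) (\<lambda>j. act j \<omega>) l) \<in> borel_measurable M"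
    by (rule measurable_rate_Mp[of "\<lambda>i j _. x i j" M h act "\<lambda>_. l"]) auto
  have pos: "AE \<omega> in M. \<forall>k. 0 < h i k \<omega>" for i
    by (subst AE_all_countable) (use exponential_mean(2)[OF h] in blast)
  have summ: "AE \<omega> in M. summable (\<lambda>k. norm (x i k) powr - \<alpha> * h i k \<omega>)" for i
    by (rule AE_summable_exponential[OF h sum]) simp
  have "AE \<omega> in M. R\<^sub>0 \<le> rate_Mp \<alpha> P noise W x (\<lambda>i j. h i j \<omega>) (\<lambda>j. act j \<omega>) l \<longleftrightarrow> (\<forall>n. Q n \<omega> \<le> h Macro \<sigma> \<omega>)"
    using pos[of Macro] pos[of Helper] summ[of Macro] summ[of Helper]
  proof eventually_elim
    fix \<omega> assume pos: "\<forall>k. 0 < h Macro k \<omega>" "\<forall>k. 0 < h Helper k \<omega>"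
      and summ: "summable (\<lambda>k. norm (x Macro k) powr - \<alpha> * h Macro k \<omega>)" "summable (\<lambda>k. norm (x Helper k) powr - \<alpha> * h Helper k \<omega>)"
    define rp where "rp i k = rec_power \<alpha> P x (\<lambda>i j. h i j \<omega>) i k" for i k
    have rp_eq: "rp i k = P i * (norm (x i k) powr - \<alpha> * h i k \<omega>)" for i k
      by (simp add: rp_def rec_power_def)
    have rp0: "0 < rp i k" for i k
      using pos P[of i] nz by (cases i) (auto simp: rp_eq)
    have rp_sum: "summable (rp i)" for i
      unfolding rp_eq using summ by (cases i) (auto intro: summable_mult)
    define F where "F k = (if k \<noteq> \<sigma> then rp Macro k else 0)" for k
    define F' where "F' k = (if act k \<omega> then rp Helper k else 0)" for k
    have F0: "0 \<le> F k" "0 \<le> F' k" for k using rp0 by (auto simp: F_def F'_def less_imp_le)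
    have F_sum: "summable F" "summable F'"
      using rp0 by (auto intro!: summable_comparison_test'[OF rp_sum, of 0] simp: F_def F'_def less_imp_le)
    have I1: "interference_Macro \<alpha> P x (\<lambda>i j. h i j \<omega>) = suminf F"
    proof -
      have "UNIV - {\<sigma>} = {j. j \<noteq> \<sigma>}" by auto
      then show ?thesis
        unfolding interference_Macro_def \<sigma>_def[symmetric] rp_def[symmetric] using F_sum(1) rp0
        by (simp only: F_def[abs_def]) (intro infsum_eq_suminf, auto simp: less_imp_le)
    qed
    have I2: "interference_Helper \<alpha> P x (\<lambda>i j. h i j \<omega>) (\<lambda>j. act j \<omega>) = suminf F'"
      unfolding interference_Helper_def rp_def[symmetric] using F_sum(2) rp0
      by (simp only: F'_def[abs_def]) (intro infsum_eq_suminf, auto simp: less_imp_le)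
    define D where "D = suminf F + suminf F' + noise"
    \<comment> \<open>The station \<open>Suc \<sigma>\<close> always interferes, so the denominator
      is positive even without noise and the quotient is not the default 0.\<close>
    have "0 < suminf F"
      using F_sum(1) F0(1) rp0 by (intro suminf_pos2[where i = "Suc \<sigma>"]) (auto simp: F_def)
    moreover have "0 \<le> suminf F'" using F_sum F0 by (intro suminf_nonneg) auto
    ultimately have D: "0 < D" using assms by (simp add: D_def)
    have SINR: "SINR \<alpha> P noise x (\<lambda>i j. h i j \<omega>) (\<lambda>j. act j \<omega>) = rp Macro \<sigma> / D" (is "?S = _")
      unfolding SINR_def I1 I2 D_def \<sigma>_def rp_def ..
    have S0: "0 \<le> rp Macro \<sigma> / D" using rp0[of Macro \<sigma>] D by (simp add: less_imp_le)
    have "R\<^sub>0 \<le> rate_Mp \<alpha> P noise W x (\<lambda>i j. h i j \<omega>) (\<lambda>j. act j \<omega>) l \<longleftrightarrow> real l * R\<^sub>0 / W \<le> log 2 (1 + rp Macro \<sigma> / D)"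
      unfolding rate_Mp_def SINR using assms by (simp add: field_simps)
    also have "\<dots> \<longleftrightarrow> \<delta> \<le> rp Macro \<sigma> / D"
      using S0 by (subst le_log_iff) (auto simp: \<delta>_def)
    also have "\<dots> \<longleftrightarrow> \<delta> * D \<le> P Macro * h Macro \<sigma> \<omega> * z powr - \<alpha>"
      using D by (simp add: pos_le_divide_eq rp_eq z_def \<sigma>_def mult_ac)
    also have "\<dots> \<longleftrightarrow> s * D \<le> h Macro \<sigma> \<omega>"
      using z P[of Macro] by (simp add: s_def powr_minus field_simps)
    \<comment> \<open>The partial sums converge to \<open>s * D\<close> from below, so a number
      bounds the limit if and only if it bounds all of them.\<close>
    also have "\<dots> \<longleftrightarrow> (\<forall>n. Q n \<omega> \<le> h Macro \<sigma> \<omega>)"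
    proof -
      have Q_eq: "Q n \<omega> = c + s * (\<Sum>k<n. F k) + s * (\<Sum>k<n. F' k)" for n
      proof -
        have "s * (\<Sum>k<n. F k) = (\<Sum>k\<in>{..<n} - {\<sigma>}. a k * h Macro k \<omega>)"
          unfolding sum_distrib_left
          by (rule sum.mono_neutral_cong_right) (auto simp: F_def a_def rp_eq)
        moreover have "s * (\<Sum>k<n. F' k) = (\<Sum>k<n. of_bool (act k \<omega>) * b k * h Helper k \<omega>)"
          unfolding sum_distrib_left by (intro sum.cong refl) (auto simp: F'_def b_def rp_eq)
        ultimately show ?thesis by (simp add: Q_def)
      qed
      have sD: "s * D = c + s * suminf F + s * suminf F'" by (simp add: D_def c_def algebra_simps)
      have "(\<lambda>n. Q n \<omega>) \<longlonglongrightarrow> s * D"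
        unfolding Q_eq sD by (intro tendsto_intros summable_LIMSEQ F_sum)
      moreover have "Q n \<omega> \<le> s * D" for n
        unfolding Q_eq sD using s F0 F_sum by (intro add_mono mult_left_mono sum_le_suminf) auto
      ultimately show ?thesis by (auto intro: LIMSEQ_le_const2 order_trans)
    qed
    finally show "R\<^sub>0 \<le> rate_Mp \<alpha> P noise W x (\<lambda>i j. h i j \<omega>) (\<lambda>j. act j \<omega>) l \<longleftrightarrow> (\<forall>n. Q n \<omega> \<le> h Macro \<sigma> \<omega>)" .
  qed
  then have "emeasure M {\<omega> \<in> space M. L \<omega> = l \<and> R\<^sub>0 \<le> rate_Mp \<alpha> P noise W x (\<lambda>i j. h i j \<omega>) (\<lambda>j. act j \<omega>) l} =
      emeasure M {\<omega> \<in> space M. L \<omega> = l \<and> (\<forall>n. Q n \<omega> \<le> h Macro \<sigma> \<omega>)}"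
    by (intro emeasure_eq_AE) (auto elim!: eventually_mono)
  also have "\<dots> = emeasure M {\<omega> \<in> space M. L \<omega> = l} * ennreal (exp (- c)) *
    (iprod (\<lambda>k. if k = \<sigma> then 1 else 1 / (1 + a k)) * iprod (\<lambda>k. 1 - p + p / (1 + b k)))"
    unfolding Q_def by (rule success_probability[OF a0 b0 c0])
  also have "iprod (\<lambda>k. if k = \<sigma> then 1 else 1 / (1 + a k)) = ennreal (1 + \<delta>) * iprod (\<lambda>k. 1 / (1 + a k))"
  proof -
    \<comment> \<open>The serving station is compared with its own distance, so the ratio is
      1.\<close>
    have "a \<sigma> = \<delta>" using z by (simp add: a_eq z_def \<sigma>_def)
    moreover have "1 / (1 + a k) \<le> 1" for k using a0[of k] by (simp add: divide_le_eq_1)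
    ultimately show ?thesis
      using a0 \<delta> iprod_remove[of "\<lambda>k. 1 / (1 + a k)" \<sigma>] by simp
  qed
  finally show ?thesis by (simp only: a_eq b_def c_def s_def)
qed

end

section \<open>Average over the locations of both tiers\<close>

context prob_space
begin

text \<open>With the macro tier frozen, averaging over the helpers gives exp (- lam Macro * C * T):
  the first argument of \<open>H\<close> is proportional to z^\<alpha>, and degree 2 / \<alpha>
  turns this into z^2. Together with the noise term it forms a decreasing function g of T, as
  \<open>nearest_point_functional\<close> requires.\<close>

lemma mean_success_over_locations:
  fixes XM XH :: "nat \<Rightarrow> 'a \<Rightarrow> real^2" and lam P :: "tier \<Rightarrow> real" and \<alpha> \<delta> noise p :: real
  assumes M: "homogeneous_ppp (lam Macro) XM" and H: "homogeneous_ppp (lam Helper) XH"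
    and ind: "indep_var (PiM UNIV (\<lambda>_. borel)) (\<lambda>\<omega> j. XM j \<omega>) (PiM UNIV (\<lambda>_. borel)) (\<lambda>\<omega> j. XH j \<omega>)"
    and \<alpha>: "2 < \<alpha>" and lam: "\<And>i. 0 < lam i" and P: "\<And>i. 0 < P i" and \<delta>: "0 < \<delta>" and noise: "0 \<le> noise"
    and p: "0 \<le> p" "p \<le> 1"
  defines "z \<equiv> \<lambda>\<omega>. norm (XM (serving \<alpha> P (\<lambda>_ j. XM j \<omega>)) \<omega>)"
  shows "(\<integral>\<^sup>+\<omega>. ennreal (exp (- (\<delta> * z \<omega> powr \<alpha> / P Macro * noise))) *
    (ennreal (1 + \<delta>) * iprod (\<lambda>k. 1 / (1 + \<delta> * (z \<omega> / norm (XM k \<omega>)) powr \<alpha>)) *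
     iprod (\<lambda>k. 1 - p + p / (1 + \<delta> * z \<omega> powr \<alpha> / P Macro * P Helper * norm (XH k \<omega>) powr - \<alpha>))) \<partial>M) =
    (\<integral>\<^sup>+z\<in>{0<..}. ennreal (2 * pi * lam Macro * z *
            exp (- (z powr \<alpha> * inverse (P Macro) * \<delta> * noise)) *
            exp (- (pi * lam Macro * z\<^sup>2 *
              (G \<delta> \<alpha> + p * (lam Helper / lam Macro) * (P Helper / P Macro) powr (2 / \<alpha>) * H \<delta> \<alpha> + 1)))) \<partial>lborel)"
    (is "?lhs = ?rhs")
proof -
  let ?S = "PiM UNIV (\<lambda>_. borel) :: (nat \<Rightarrow> real^2) measure"
  have [measurable]: "XM j \<in> borel_measurable M" "XH j \<in> borel_measurable M" for j
    using M H by (auto simp: homogeneous_ppp_def)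
  have lam_pos: "0 < lam Macro" "0 < lam Helper" by (rule lam)+
  \<comment> \<open>The independence argument needs the serving distance as a measurable function on
    the space of macro configurations. \<open>serving\<close> reads only the macro tier, so the tier
    argument can be ignored.\<close>
  define zf where "zf y = norm (y (serving \<alpha> P (\<lambda>_. y)))" for y :: "nat \<Rightarrow> real^2"
  have z_zf: "z \<omega> = zf (\<lambda>j. XM j \<omega>)" for \<omega> by (simp add: z_def zf_def)
  have comp[measurable]: "(\<lambda>y. y j) \<in> borel_measurable ?S" for j
    by (rule measurable_component_singleton) simp
  have loss: "(\<lambda>y. P Macro * norm (y j) powr - \<alpha>) \<in> borel_measurable ?S" for j
    by (rule measurable_compose[OF comp, of "\<lambda>v. P Macro * norm v powr - \<alpha>"]) measurable
  have \<sigma>: "(\<lambda>y. serving \<alpha> P (\<lambda>_. y)) \<in> measurable ?S (count_space UNIV)"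
    unfolding serving_def
    by (intro measurable_Least pred_intros_countable) (unfold pred_def, intro borel_measurable_le loss)
  have "(\<lambda>y. y (serving \<alpha> P (\<lambda>_. y))) \<in> borel_measurable ?S"
    by (rule measurable_compose_countable[OF comp \<sigma>])
  then have zf[measurable]: "zf \<in> borel_measurable ?S" unfolding zf_def by measurable
  have XMs[measurable]: "(\<lambda>\<omega> j. XM j \<omega>) \<in> measurable M ?S"
    by (rule measurable_PiM_single') auto
  have zm[measurable]: "z \<in> borel_measurable M" unfolding z_zf by measurable
  define s where "s \<omega> = \<delta> * z \<omega> powr \<alpha> / P Macro" for \<omega>
  define \<Phi> where "\<Phi> \<omega> = ennreal (exp (- (\<delta> * z \<omega> powr \<alpha> / P Macro * noise))) *
    (ennreal (1 + \<delta>) * iprod (\<lambda>k. 1 / (1 + \<delta> * (z \<omega> / norm (XM k \<omega>)) powr \<alpha>)))" for \<omega>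
  have [measurable]: "\<Phi> \<in> borel_measurable M" unfolding \<Phi>_def by measurable
  have near: "AE \<omega> in M. 0 < z \<omega> \<and> (\<forall>j. z \<omega> \<le> norm (XM j \<omega>)) \<and> (\<exists>j. z \<omega> = norm (XM j \<omega>))"
    using ppp_points_nonzero[OF M] ppp_path_loss_summable[OF M lam \<alpha>]
  proof eventually_elim
    fix \<omega> assume "\<forall>j. XM j \<omega> \<noteq> 0" "summable (\<lambda>j. norm (XM j \<omega>) powr - \<alpha>)"
    then show "0 < z \<omega> \<and> (\<forall>j. z \<omega> \<le> norm (XM j \<omega>)) \<and> (\<exists>j. z \<omega> = norm (XM j \<omega>))"
      using serving_nearest[of \<alpha> P "\<lambda>_ j. XM j \<omega>"] P \<alpha> by (auto simp: z_def)
  qed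
  define T where "T \<omega> = pi * (z \<omega>)\<^sup>2" for \<omega>
  define C where "C = p * (lam Helper / lam Macro) * (P Helper / P Macro) powr (2 / \<alpha>) * H \<delta> \<alpha>"
  define g where "g t = exp (- (\<delta> * (t / pi) powr (\<alpha> / 2) / P Macro * noise)) * exp (- (lam Macro * C * t))" for t
  have Tn: "nearest M XM T (lam Macro) \<alpha> \<delta>"
  proof (unfold_locales)
    show "T \<in> borel_measurable M" unfolding T_def by measurable
    show "AE \<omega> in M. 0 < T \<omega> \<and> (\<forall>j. T \<omega> \<le> pi * (norm (XM j \<omega>))\<^sup>2) \<and> (\<exists>j. T \<omega> = pi * (norm (XM j \<omega>))\<^sup>2)"
      using near by eventually_elim (auto simp: T_def)
  qed (use M lam \<alpha> \<delta> in auto)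
  interpret N: nearest M XM T "lam Macro" \<alpha> \<delta> by (rule Tn)
  have H0: "0 \<le> H \<delta> \<alpha>" using \<alpha> by (rule H_nonneg)
  have C0: "0 \<le> C" unfolding C_def using p lam_pos(1) lam_pos(2) H0
    by (intro mult_nonneg_nonneg divide_nonneg_nonneg powr_ge_zero) auto
  let ?f = "\<lambda>(y, y'). ennreal (exp (- (\<delta> * zf y powr \<alpha> / P Macro * noise))) *
    (ennreal (1 + \<delta>) * iprod (\<lambda>k. 1 / (1 + \<delta> * (zf y / norm (y k)) powr \<alpha>)) *
     iprod (\<lambda>k. 1 - p + p / (1 + \<delta> * zf y powr \<alpha> / P Macro * P Helper * norm (y' k :: real^2) powr - \<alpha>)))"
  have "?lhs = (\<integral>\<^sup>+\<omega>. ?f (\<lambda>j. XM j \<omega>, \<lambda>j. XH j \<omega>) \<partial>M)"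
    by (simp add: z_zf)
  also have "\<dots> = (\<integral>\<^sup>+\<omega>. \<integral>\<^sup>+\<omega>'. ?f (\<lambda>j. XM j \<omega>, \<lambda>j. XH j \<omega>') \<partial>M \<partial>M)"
    by (rule nn_integral_indep_var[OF ind]) measurable
  also have "\<dots> = (\<integral>\<^sup>+\<omega>. ennreal (1 + \<delta>) * (ennreal (g (T \<omega>)) * N.W (T \<omega>) \<omega>) \<partial>M)"
    using near
  proof (intro nn_integral_cong_AE, eventually_elim)
    fix \<omega> assume z: "0 < z \<omega> \<and> (\<forall>j. z \<omega> \<le> norm (XM j \<omega>)) \<and> (\<exists>j. z \<omega> = norm (XM j \<omega>))"
    define \<kappa> where "\<kappa> = \<delta> * z \<omega> powr \<alpha> / P Macro * P Helper"
    have \<kappa>: "0 < \<kappa>" using z \<delta> P by (simp add: \<kappa>_def)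
    have "H \<kappa> \<alpha> = (z \<omega>)\<^sup>2 * (P Helper / P Macro) powr (2 / \<alpha>) * H \<delta> \<alpha>"
    proof -
      have "\<kappa> = \<delta> * ((P Helper / P Macro) * z \<omega> powr \<alpha>)" by (simp add: \<kappa>_def)
      also have "\<dots> powr (2 / \<alpha>) = \<delta> powr (2 / \<alpha>) * ((P Helper / P Macro) powr (2 / \<alpha>) * (z \<omega>)\<^sup>2)"
        using z \<delta> \<alpha> P[of Macro] P[of Helper] by (simp add: powr_mult powr_divide powr_powr less_imp_le)
      finally show ?thesis by (simp add: H_def)
    qed
    then have e: "lam Helper * p * pi * H \<kappa> \<alpha> = lam Macro * C * T \<omega>"
      using lam_pos(1) by (simp add: C_def T_def)
    have pw: "(T \<omega> / pi) powr (\<alpha> / 2) = z \<omega> powr \<alpha>"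
      using z by (simp add: T_def powr_powr flip: powr_numeral)
    have w: "N.w (T \<omega>) (pi * (norm (XM k \<omega>))\<^sup>2) = 1 / (1 + \<delta> * (z \<omega> / norm (XM k \<omega>)) powr \<alpha>)" for k
    proof -
      have "0 < norm (XM k \<omega>)" using z by (meson less_le_trans)
      then have "T \<omega> / (pi * (norm (XM k \<omega>))\<^sup>2) = (z \<omega> / norm (XM k \<omega>)) powr 2"
        using z by (simp add: T_def power_divide)
      then have "(T \<omega> / (pi * (norm (XM k \<omega>))\<^sup>2)) powr (\<alpha> / 2) = (z \<omega> / norm (XM k \<omega>)) powr \<alpha>"
        by (simp only: powr_powr) simp
      then show ?thesis by (simp add: N.w_def)
    qed
    have "(\<integral>\<^sup>+\<omega>'. ?f (\<lambda>j. XM j \<omega>, \<lambda>j. XH j \<omega>') \<partial>M) =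
        (\<integral>\<^sup>+\<omega>'. \<Phi> \<omega> * iprod (\<lambda>k. 1 - p + p / (1 + \<kappa> * norm (XH k \<omega>') powr - \<alpha>)) \<partial>M)"
      by (simp add: \<Phi>_def \<kappa>_def z_zf mult.assoc)
    also have "\<dots> = \<Phi> \<omega> * ennreal (exp (- (lam Helper * p * pi * H \<kappa> \<alpha>)))"
      by (subst nn_integral_cmult) (simp_all add: helper_generating_functional[OF H lam_pos(2) \<alpha> \<kappa> p])
    also have "\<dots> = ennreal (1 + \<delta>) * (ennreal (g (T \<omega>)) * N.W (T \<omega>) \<omega>)"
      unfolding e g_def pw N.W_def w \<Phi>_def by (simp add: ennreal_mult' mult_ac)
    finally show "(\<integral>\<^sup>+\<omega>'. ?f (\<lambda>j. XM j \<omega>, \<lambda>j. XH j \<omega>') \<partial>M) = ennreal (1 + \<delta>) * (ennreal (g (T \<omega>)) * N.W (T \<omega>) \<omega>)" .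
  qed
  also have "\<dots> = ennreal (1 + \<delta>) * (\<integral>\<^sup>+\<omega>. ennreal (g (T \<omega>)) * N.W (T \<omega>) \<omega> \<partial>M)"
    by (rule nn_integral_cmult) (unfold g_def, measurable)
  also have "(\<integral>\<^sup>+\<omega>. ennreal (g (T \<omega>)) * N.W (T \<omega>) \<omega> \<partial>M) =
    ennreal (1 / (1 + \<delta>)) * (\<integral>\<^sup>+t\<in>{0<..}. ennreal (lam Macro * g t * exp (- (lam Macro * t * (1 + G \<delta> \<alpha>)))) \<partial>lborel)"
  proof (rule N.nearest_point_functional)
    show "g \<in> borel_measurable borel" unfolding g_def by measurable
    show "0 \<le> g t" for t by (simp add: g_def)
    show "g t \<le> g y" if "0 < y" "y \<le> t" for y t
    proof -
      have "(y / pi) powr (\<alpha> / 2) \<le> (t / pi) powr (\<alpha> / 2)"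
        using that \<alpha> by (intro powr_mono2) (auto intro: divide_right_mono)
      then have "\<delta> * (y / pi) powr (\<alpha> / 2) / P Macro * noise \<le> \<delta> * (t / pi) powr (\<alpha> / 2) / P Macro * noise"
        using \<delta> noise P[of Macro] by (intro mult_right_mono divide_right_mono mult_left_mono) auto
      moreover have "lam Macro * C * y \<le> lam Macro * C * t"
        using that C0 lam_pos(1) by (intro mult_left_mono) auto
      ultimately show ?thesis unfolding g_def by (intro mult_mono) auto
    qed
  qed
  \<comment> \<open>Back from area to radius. The factor 2 pi lam z and the part exp (- lam pi z^2)
    of the integrand are together the density of the nearest distance.\<close>
  also have "(\<integral>\<^sup>+t\<in>{0<..}. ennreal (lam Macro * g t * exp (- (lam Macro * t * (1 + G \<delta> \<alpha>)))) \<partial>lborel) =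
      (\<integral>\<^sup>+z\<in>{0<..}. ennreal (2 * pi * z) * ennreal (lam Macro * g (pi * z\<^sup>2) * exp (- (lam Macro * (pi * z\<^sup>2) * (1 + G \<delta> \<alpha>)))) \<partial>lborel)"
    by (rule nn_integral_disc_area[symmetric]) (unfold g_def, measurable)
  also have "\<dots> = ?rhs"
  proof (rule nn_integral_cong)
    fix z :: real
    show "ennreal (2 * pi * z) * ennreal (lam Macro * g (pi * z\<^sup>2) * exp (- (lam Macro * (pi * z\<^sup>2) * (1 + G \<delta> \<alpha>)))) * indicator {0<..} z =
      ennreal (2 * pi * lam Macro * z *
            exp (- (z powr \<alpha> * inverse (P Macro) * \<delta> * noise)) *
            exp (- (pi * lam Macro * z\<^sup>2 *
              (G \<delta> \<alpha> + p * (lam Helper / lam Macro) * (P Helper / P Macro) powr (2 / \<alpha>) * H \<delta> \<alpha> + 1)))) * indicator {0<..} z"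
    proof (cases "0 < z")
      case True
      then have pw: "(pi * z\<^sup>2 / pi) powr (\<alpha> / 2) = z powr \<alpha>"
        by (simp add: powr_powr flip: powr_numeral)
      have "2 * pi * z * (lam Macro * g (pi * z\<^sup>2) * exp (- (lam Macro * (pi * z\<^sup>2) * (1 + G \<delta> \<alpha>)))) =
        2 * pi * lam Macro * z * exp (- (z powr \<alpha> * inverse (P Macro) * \<delta> * noise)) *
        (exp (- (lam Macro * C * (pi * z\<^sup>2))) * exp (- (lam Macro * (pi * z\<^sup>2) * (1 + G \<delta> \<alpha>))))"
        unfolding g_def pw by (simp add: field_simps)
      also have "exp (- (lam Macro * C * (pi * z\<^sup>2))) * exp (- (lam Macro * (pi * z\<^sup>2) * (1 + G \<delta> \<alpha>))) =
        exp (- (pi * lam Macro * z\<^sup>2 * (G \<delta> \<alpha> + C + 1)))"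
        by (simp add: algebra_simps flip: exp_add)
      finally show ?thesis
        using True lam_pos(1) by (simp add: C_def ennreal_mult'[symmetric])
    qed simp
  qed
  finally have "?lhs = ennreal (1 + \<delta>) * (ennreal (1 / (1 + \<delta>)) * ?rhs)" .
  \<comment> \<open>The correction 1 + \<delta> for the serving station cancels the limit 1 / (1 +
    \<delta>) of the annulus factors.\<close>
  also have "\<dots> = ?rhs"
  proof -
    have "ennreal (1 + \<delta>) * ennreal (1 / (1 + \<delta>)) = 1"
      using \<delta> by (subst ennreal_mult[symmetric]) auto
    then show ?thesis by (simp only: mult.assoc[symmetric] mult_1)
  qed
  finally show ?thesis .
qed

end

subsection \<open>Averaging over all sources\<close>

text \<open>
  All sources are embedded into one value type, so that their independence can be expressed by
  \<open>indep_vars\<close> and split by \<open>indep_var_restrict\<close>.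
\<close>

definition source_value ::
  "(tier \<Rightarrow> nat \<Rightarrow> 'a \<Rightarrow> real^2) \<Rightarrow> (tier \<Rightarrow> nat \<Rightarrow> 'a \<Rightarrow> real) \<Rightarrow> (nat \<Rightarrow> 'a \<Rightarrow> bool) \<Rightarrow>
    ('a \<Rightarrow> nat) \<Rightarrow> source \<Rightarrow> 'a \<Rightarrow> (nat \<Rightarrow> real^2) \<times> real" where
  "source_value X h act L s \<omega> = (case s of Locations i \<Rightarrow> (\<lambda>j. X i j \<omega>, 0)
     | Fading i j \<Rightarrow> (\<lambda>_. 0, h i j \<omega>) | Activity j \<Rightarrow> (\<lambda>_. 0, of_bool (act j \<omega>)) | Load \<Rightarrow> (\<lambda>_. 0, real (L \<omega>)))"

abbreviation "source_space \<equiv> PiM UNIV (\<lambda>_ :: nat. borel :: (real^2) measure) \<Otimes>\<^sub>M (borel :: real measure)"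

text \<open>Each value is a source followed by a measurable embedding, so its preimages are events
  of that source, and independence passes to smaller families of events.\<close>

lemma (in prob_space) indep_vars_source_value:
  assumes "indep_sets (source_events M X h act L) UNIV"
  shows "indep_vars (\<lambda>_. source_space) (source_value X h act L) UNIV"
proof -
  have pull: "(\<phi> \<circ> f) -` A \<inter> space M \<in> events_of M f N"
    if "\<phi> \<in> measurable N source_space" "space N = UNIV" "A \<in> sets source_space" for \<phi> and f :: "'a \<Rightarrow> 'c" and N A
  proof -
    have "\<phi> -` A \<in> sets N" using measurable_sets[OF that(1,3)] that(2) by simp
    then show ?thesis unfolding events_of_def vimage_comp[symmetric] by blast
  qed
  have zero: "(\<lambda>_. 0) \<in> space (PiM UNIV (\<lambda>_ :: nat. borel :: (real^2) measure))"
    by (simp add: space_PiM)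
  have sv: "source_value X h act L (Locations i) = (\<lambda>y. (y, 0)) \<circ> (\<lambda>\<omega> j. X i j \<omega>)"
    "source_value X h act L (Fading i j) = (\<lambda>r. (\<lambda>_. 0, r)) \<circ> h i j"
    "source_value X h act L (Activity j) = (\<lambda>b. (\<lambda>_. 0, of_bool b)) \<circ> act j"
    "source_value X h act L Load = (\<lambda>n. (\<lambda>_. 0, real n)) \<circ> L" for i j
    by (auto simp: source_value_def)
  have ev: "source_value X h act L s -` A \<inter> space M \<in> source_events M X h act L s" if A: "A \<in> sets source_space" for s A
    by (cases s; simp only: sv source_events.simps; rule pull[OF _ _ A])
      (auto simp: space_PiM space_pair_measure intro!: measurable_Pair measurable_const zero)
  have "indep_sets (\<lambda>s. {source_value X h act L s -` A \<inter> space M | A. A \<in> sets source_space}) UNIV"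
    by (rule indep_sets_mono_sets[OF assms]) (use ev in blast)
  moreover have "random_variable source_space (source_value X h act L s)" for s
  proof (rule measurableI)
    fix A assume "A \<in> sets source_space"
    from ev[OF this, of s] assms show "source_value X h act L s -` A \<inter> space M \<in> events"
      unfolding indep_sets_def by blast
  qed (simp add: space_pair_measure space_PiM)
  ultimately show ?thesis unfolding indep_vars_def2 by blast
qed

theorem lemma2:
  fixes M :: "'a measure"
    and lam P :: "tier \<Rightarrow> real" and \<alpha> lam\<^sub>u W R\<^sub>0 noise \<gamma> :: real and N N\<^sub>1 N\<^sub>2 :: nat
    and X :: "tier \<Rightarrow> nat \<Rightarrow> 'a \<Rightarrow> real^2" and h :: "tier \<Rightarrow> nat \<Rightarrow> 'a \<Rightarrow> real"
    and act :: "nat \<Rightarrow> 'a \<Rightarrow> bool" and L\<^sub>1 :: "'a \<Rightarrow> nat"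
  defines "A \<equiv> assoc_prob \<alpha> lam P N N\<^sub>1 N\<^sub>2 \<gamma>"
  defines "p\<^sub>a \<equiv> active_prob (A Helper * lam\<^sub>u / lam Helper)"
  defines "\<delta> \<equiv> \<lambda>l::nat. 2 powr ((real l + 1) * R\<^sub>0 / W) - 1"
  assumes "2 < \<alpha>" "\<alpha> \<le> 4"
    and "\<And>i. 0 < lam i" "\<And>i. 0 < P i" "0 < lam\<^sub>u" "0 < W" "0 < R\<^sub>0" "0 \<le> noise" "0 \<le> \<gamma>"
    and "1 \<le> N" "1 \<le> N\<^sub>1" "1 \<le> N\<^sub>2" "N\<^sub>1 < N" "N\<^sub>2 \<le> N - N\<^sub>1"
    and "prob_space M"
    and ppp: "\<And>i. prob_space.homogeneous_ppp M (lam i) (X i)"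
    and fading: "\<And>i j. distributed M lborel (h i j) (exponential_density 1)"
    and active: "\<And>j. measure M {\<omega> \<in> space M. act j \<omega>} = p\<^sub>a"
    and load: "\<And>l. measure M {\<omega> \<in> space M. L\<^sub>1 \<omega> = l + 1} =
                 load_law (A Macro * lam\<^sub>u / lam Macro) l"
    and indep: "prob_space.indep_sets M (source_events M X h act L\<^sub>1) UNIV"
  shows "measure M {\<omega> \<in> space M.
           rate_Mp \<alpha> P noise W (\<lambda>i j. X i j \<omega>) (\<lambda>i j. h i j \<omega>) (\<lambda>j. act j \<omega>) (L\<^sub>1 \<omega>) \<ge> R\<^sub>0} =
         (LBINT z:{0<..}. \<Sum>l.
            2 * pi * lam Macro * z *
            exp (- (z powr \<alpha> * inverse (P Macro) * \<delta> l * noise)) *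
            exp (- (pi * lam Macro * z\<^sup>2 *
              (G (\<delta> l) \<alpha>
               + p\<^sub>a * (lam Helper / lam Macro) * (P Helper / P Macro) powr (2 / \<alpha>) * H (\<delta> l) \<alpha>
               + 1))) *
            load_law (A Macro * lam\<^sub>u / lam Macro) l)"
proof -
  interpret prob_space M by fact
  note \<alpha> = \<open>2 < \<alpha>\<close> and lam = \<open>\<And>i. 0 < lam i\<close> and P = \<open>\<And>i. 0 < P i\<close>
  note W = \<open>0 < W\<close> and R\<^sub>0 = \<open>0 < R\<^sub>0\<close> and noise = \<open>0 \<le> noise\<close>
  define Y where "Y = source_value X h act L\<^sub>1"
  have Y: "indep_vars (\<lambda>_. source_space) Y UNIV"
    unfolding Y_def using indep by (rule indep_vars_source_value)
  have Y_simps: "fst (Y (Locations i) \<omega>) = (\<lambda>j. X i j \<omega>)" "snd (Y (Fading i j) \<omega>) = h i j \<omega>"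
    "snd (Y (Activity j) \<omega>) = of_bool (act j \<omega>)" "snd (Y Load \<omega>) = real (L\<^sub>1 \<omega>)" for i j \<omega>
    by (auto simp: Y_def source_value_def)
  interpret F: fading M h act L\<^sub>1 "\<lambda>s \<omega>. case s of Locations i \<Rightarrow> 0 | Fading i j \<Rightarrow> h i j \<omega>
      | Activity j \<Rightarrow> of_bool (act j \<omega>) | Load \<Rightarrow> real (L\<^sub>1 \<omega>)" p\<^sub>a
  proof unfold_locales
    have "indep_vars (\<lambda>_. borel) (\<lambda>s \<omega>. snd (Y s \<omega>)) UNIV"
      by (rule indep_vars_compose2[OF Y]) simp
    also have "(\<lambda>s \<omega>. snd (Y s \<omega>)) = (\<lambda>s \<omega>. case s of Locations i \<Rightarrow> 0 | Fading i j \<Rightarrow> h i j \<omega>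
      | Activity j \<Rightarrow> of_bool (act j \<omega>) | Load \<Rightarrow> real (L\<^sub>1 \<omega>))"
      by (auto simp: fun_eq_iff Y_def source_value_def split: source.split)
    finally show "indep_vars (\<lambda>_. borel) (\<lambda>s \<omega>. case s of Locations i \<Rightarrow> 0 | Fading i j \<Rightarrow> h i j \<omega>
      | Activity j \<Rightarrow> of_bool (act j \<omega>) | Load \<Rightarrow> real (L\<^sub>1 \<omega>)) UNIV" .
  qed (use fading active in auto)
  have [measurable]: "X i j \<in> borel_measurable M" for i j
    using ppp[of i] by (auto simp: homogeneous_ppp_def)
  define q where "q = load_law (A Macro * lam\<^sub>u / lam Macro)"
  \<comment> \<open>The index l stands for the load l + 1, in agreement with \<open>load_law\<close>
    and \<delta>.\<close>
  have q: "prob {\<omega> \<in> space M. L\<^sub>1 \<omega> = Suc l} = q l" for l using load[of l] by (simp add: q_def)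
  then have q0: "0 \<le> q l" for l by (metis measure_nonneg)
  have \<delta>: "0 < \<delta> l" for l
    unfolding \<delta>_def using W R\<^sub>0 by (simp add: gr_one_powr)
  define rate where "rate x \<omega> l = rate_Mp \<alpha> P noise W x (\<lambda>i j. h i j \<omega>) (\<lambda>j. act j \<omega>) l" for x \<omega> l
  define E where "E l = {\<omega> \<in> space M. L\<^sub>1 \<omega> = Suc l \<and> R\<^sub>0 \<le> rate (\<lambda>i j. X i j \<omega>) \<omega> (Suc l)}" for l
  have [measurable]: "(\<lambda>\<omega>. rate (\<lambda>i j. X i j \<omega>) \<omega> l) \<in> borel_measurable M" for l
    unfolding rate_def by (rule measurable_rate_Mp) auto
  have [measurable]: "E l \<in> events" for l unfolding E_def by measurable
  define I where "I l z = 2 * pi * lam Macro * z *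
            exp (- (z powr \<alpha> * inverse (P Macro) * \<delta> l * noise)) *
            exp (- (pi * lam Macro * z\<^sup>2 *
              (G (\<delta> l) \<alpha>
               + p\<^sub>a * (lam Helper / lam Macro) * (P Helper / P Macro) powr (2 / \<alpha>) * H (\<delta> l) \<alpha>
               + 1)))" for l z
  have [measurable]: "I l \<in> borel_measurable borel" for l unfolding I_def by measurable
  have I0: "0 \<le> I l z" if "0 < z" for l z
    using that lam[of Macro] unfolding I_def by (intro mult_nonneg_nonneg) auto
  have good: "AE \<omega> in M. \<forall>i. (\<forall>k. X i k \<omega> \<noteq> 0) \<and> summable (\<lambda>k. norm (X i k \<omega>) powr - \<alpha>)"
  proof -
    have "AE \<omega> in M. (\<forall>k. X i k \<omega> \<noteq> 0) \<and> summable (\<lambda>k. norm (X i k \<omega>) powr - \<alpha>)" for i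
      using ppp_points_nonzero[OF ppp] ppp_path_loss_summable[OF ppp lam \<alpha>] by eventually_elim auto
    from this[of Macro] this[of Helper] show ?thesis
    proof eventually_elim
      fix \<omega>
      assume *: "(\<forall>k. X Macro k \<omega> \<noteq> 0) \<and> summable (\<lambda>k. norm (X Macro k \<omega>) powr - \<alpha>)"
        "(\<forall>k. X Helper k \<omega> \<noteq> 0) \<and> summable (\<lambda>k. norm (X Helper k \<omega>) powr - \<alpha>)"
      show "\<forall>i. (\<forall>k. X i k \<omega> \<noteq> 0) \<and> summable (\<lambda>k. norm (X i k \<omega>) powr - \<alpha>)"
      proof
        show "(\<forall>k. X i k \<omega> \<noteq> 0) \<and> summable (\<lambda>k. norm (X i k \<omega>) powr - \<alpha>)" for i
          using * by (cases i) blast+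
      qed
    qed
  qed
  have E: "emeasure M (E l) = ennreal (q l) * (\<integral>\<^sup>+z\<in>{0<..}. ennreal (I l z) \<partial>lborel)" for l
  proof -
    let ?A = "range Locations" and ?N = "\<lambda>B. PiM B (\<lambda>_ :: source. source_space)"
    define z where "z \<omega> = norm (X Macro (serving \<alpha> P (\<lambda>_ j. X Macro j \<omega>)) \<omega>)" for \<omega>
    define \<Phi> where "\<Phi> \<omega> = ennreal (exp (- (\<delta> l * z \<omega> powr \<alpha> / P Macro * noise))) *
      (ennreal (1 + \<delta> l) * iprod (\<lambda>k. 1 / (1 + \<delta> l * (z \<omega> / norm (X Macro k \<omega>)) powr \<alpha>)) *
       iprod (\<lambda>k. 1 - p\<^sub>a + p\<^sub>a / (1 + \<delta> l * z \<omega> powr \<alpha> / P Macro * P Helper * norm (X Helper k \<omega>) powr - \<alpha>)))" for \<omega>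
    \<comment> \<open>The activity is stored as a real 0 or 1, hence the comparison with 1.\<close>
    define f where "f = (\<lambda>(u :: source \<Rightarrow> (nat \<Rightarrow> real^2) \<times> real, v :: source \<Rightarrow> (nat \<Rightarrow> real^2) \<times> real). indicator {R\<^sub>0..}
        (rate_Mp \<alpha> P noise W (\<lambda>i j. fst (u (Locations i)) j) (\<lambda>i j. snd (v (Fading i j)))
          (\<lambda>j. snd (v (Activity j)) = 1) (Suc l)) * indicator {real (Suc l)} (snd (v Load)) :: ennreal)"
    \<comment> \<open>The locations of both tiers are frozen against all other sources here; the two
      tiers are separated from each other only when \<Phi> is averaged.\<close>
    have UV: "indep_var (?N ?A) (\<lambda>\<omega>. restrict (\<lambda>s. Y s \<omega>) ?A) (?N (- ?A)) (\<lambda>\<omega>. restrict (\<lambda>s. Y s \<omega>) (- ?A))"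
      by (rule indep_var_restrict[OF Y]) auto
    have comp: "(\<lambda>u. u s) \<in> measurable (?N B) source_space" if "s \<in> B" for s B
      using that by (rule measurable_component_singleton)
    have mx: "(\<lambda>w. fst (fst w (Locations i)) j) \<in> borel_measurable (?N ?A \<Otimes>\<^sub>M ?N (- ?A))" for i j
    proof -
      have "(\<lambda>w. fst (fst w (Locations i))) \<in> measurable (?N ?A \<Otimes>\<^sub>M ?N (- ?A)) (PiM UNIV (\<lambda>_. borel))"
        by (intro measurable_compose[OF measurable_compose[OF measurable_fst comp] measurable_fst]) auto
      then show ?thesis by (rule measurable_compose) (auto intro: measurable_component_singleton)
    qed
    have ms: "(\<lambda>w. snd (snd w s)) \<in> borel_measurable (?N ?A \<Otimes>\<^sub>M ?N (- ?A))" if "s \<notin> ?A" for s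
      using that by (intro measurable_compose[OF measurable_compose[OF measurable_snd comp] measurable_snd]) auto
    have "(\<lambda>w. rate_Mp \<alpha> P noise W (\<lambda>i j. fst (fst w (Locations i)) j) (\<lambda>i j. snd (snd w (Fading i j)))
          (\<lambda>j. snd (snd w (Activity j)) = 1) (Suc l)) \<in> borel_measurable (?N ?A \<Otimes>\<^sub>M ?N (- ?A))"
    proof (rule measurable_rate_Mp[OF mx ms])
      show "Measurable.pred (?N ?A \<Otimes>\<^sub>M ?N (- ?A)) (\<lambda>w. snd (snd w (Activity j)) = 1)" for j
        unfolding pred_def by (intro borel_measurable_eq ms borel_measurable_const) auto
    qed auto
    then have f: "f \<in> borel_measurable (?N ?A \<Otimes>\<^sub>M ?N (- ?A))"
      unfolding f_def case_prod_unfold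
      by (intro borel_measurable_times_ennreal)
        (rule measurable_compose[where N = borel and g = "indicator _"], (fact | auto intro: ms))+
    have f_eq: "f (restrict (\<lambda>s. Y s \<omega>) ?A, restrict (\<lambda>s. Y s \<omega>') (- ?A)) =
        indicator {\<omega>' \<in> space M. L\<^sub>1 \<omega>' = Suc l \<and> R\<^sub>0 \<le> rate (\<lambda>i j. X i j \<omega>) \<omega>' (Suc l)} \<omega>'"
      if "\<omega>' \<in> space M" for \<omega> \<omega>'
      using that by (auto simp: f_def Y_simps rate_def indicator_def image_iff simp del: of_nat_Suc)
    have "emeasure M (E l) = (\<integral>\<^sup>+\<omega>. indicator (E l) \<omega> \<partial>M)" by simp
    also have "\<dots> = (\<integral>\<^sup>+\<omega>. f (restrict (\<lambda>s. Y s \<omega>) ?A, restrict (\<lambda>s. Y s \<omega>) (- ?A)) \<partial>M)"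
      by (intro nn_integral_cong) (simp add: f_eq E_def indicator_def)
    also have "\<dots> = (\<integral>\<^sup>+\<omega>. \<integral>\<^sup>+\<omega>'. f (restrict (\<lambda>s. Y s \<omega>) ?A, restrict (\<lambda>s. Y s \<omega>') (- ?A)) \<partial>M \<partial>M)"
      by (rule nn_integral_indep_var[OF UV f])
    also have "\<dots> = (\<integral>\<^sup>+\<omega>. ennreal (q l) * \<Phi> \<omega> \<partial>M)"
      using good
    proof (intro nn_integral_cong_AE, eventually_elim)
      fix \<omega> assume good: "\<forall>i. (\<forall>k. X i k \<omega> \<noteq> 0) \<and> summable (\<lambda>k. norm (X i k \<omega>) powr - \<alpha>)"
      have [measurable]: "(\<lambda>\<omega>'. rate (\<lambda>i j. X i j \<omega>) \<omega>' (Suc l)) \<in> borel_measurable M"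
        unfolding rate_def by (rule measurable_rate_Mp[of "\<lambda>i j _. X i j \<omega>" M h act "\<lambda>_. Suc l"]) auto
      have z: "norm (X Macro (serving \<alpha> P (\<lambda>i j. X i j \<omega>)) \<omega>) = z \<omega>"
        by (simp add: z_def serving_def)
      have d: "2 powr (real (Suc l) * R\<^sub>0 / W) - 1 = \<delta> l" by (simp add: \<delta>_def add.commute)
      have "(\<integral>\<^sup>+\<omega>'. f (restrict (\<lambda>s. Y s \<omega>) ?A, restrict (\<lambda>s. Y s \<omega>') (- ?A)) \<partial>M) =
          emeasure M {\<omega>' \<in> space M. L\<^sub>1 \<omega>' = Suc l \<and> R\<^sub>0 \<le> rate (\<lambda>i j. X i j \<omega>) \<omega>' (Suc l)}"
        by (subst nn_integral_indicator[symmetric], measurable) (intro nn_integral_cong f_eq)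
      also have "\<dots> = ennreal (q l) * \<Phi> \<omega>"
        using F.success_given_locations[of \<alpha> P W R\<^sub>0 noise "Suc l" "\<lambda>i j. X i j \<omega>"] \<alpha> P W R\<^sub>0 noise good
        by (simp only: rate_def \<Phi>_def z d emeasure_eq_measure q mult.assoc) simp
      finally show "(\<integral>\<^sup>+\<omega>'. f (restrict (\<lambda>s. Y s \<omega>) ?A, restrict (\<lambda>s. Y s \<omega>') (- ?A)) \<partial>M) = ennreal (q l) * \<Phi> \<omega>" .
    qed
    also have "\<dots> = ennreal (q l) * (\<integral>\<^sup>+\<omega>. \<Phi> \<omega> \<partial>M)"
    proof (rule nn_integral_cmult)
      have \<sigma>: "(\<lambda>\<omega>. serving \<alpha> P (\<lambda>_ j. X Macro j \<omega>)) \<in> measurable M (count_space UNIV)"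
        unfolding serving_def by measurable
      have "(\<lambda>\<omega>. X Macro (serving \<alpha> P (\<lambda>_ j. X Macro j \<omega>)) \<omega>) \<in> borel_measurable M"
        by (rule measurable_compose_countable[OF _ \<sigma>]) simp
      then have [measurable]: "z \<in> borel_measurable M" unfolding z_def by measurable
      show "\<Phi> \<in> borel_measurable M" unfolding \<Phi>_def by measurable
    qed
    also have "(\<integral>\<^sup>+\<omega>. \<Phi> \<omega> \<partial>M) = (\<integral>\<^sup>+z\<in>{0<..}. ennreal (I l z) \<partial>lborel)"
      unfolding \<Phi>_def z_def I_def
    proof (rule mean_success_over_locations[OF ppp ppp _ \<alpha> lam P \<delta> noise F.p01])
      let ?g = "\<lambda>i (u :: source \<Rightarrow> (nat \<Rightarrow> real^2) \<times> real). fst (u (Locations i))"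
      have "indep_var (PiM UNIV (\<lambda>_. borel)) (?g Macro \<circ> (\<lambda>\<omega>. restrict (\<lambda>s. Y s \<omega>) {Locations Macro}))
          (PiM UNIV (\<lambda>_. borel)) (?g Helper \<circ> (\<lambda>\<omega>. restrict (\<lambda>s. Y s \<omega>) {Locations Helper}))"
        by (rule indep_var_compose[OF indep_var_restrict[OF Y]])
          (auto intro!: measurable_compose[OF comp measurable_fst])
      then show "indep_var (PiM UNIV (\<lambda>_. borel)) (\<lambda>\<omega> j. X Macro j \<omega>) (PiM UNIV (\<lambda>_. borel)) (\<lambda>\<omega> j. X Helper j \<omega>)"
        by (simp add: comp_def Y_simps)
    qed
    finally show ?thesis .
  qed
  \<comment> \<open>A real \<open>suminf\<close> represents the series only if it converges. Both
    exponents are nonpositive, so the terms are dominated by 2 pi lam z times the load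
    probabilities.\<close>
  have Iq_summable: "summable (\<lambda>l. I l z * q l)" if "0 < z" for z
  proof -
    have "(\<lambda>l. prob {\<omega> \<in> space M. L\<^sub>1 \<omega> = Suc l}) sums prob (\<Union>l. {\<omega> \<in> space M. L\<^sub>1 \<omega> = Suc l})"
      by (rule finite_measure_UNION) (auto simp: disjoint_family_on_def)
    then have q_sum: "summable q" by (simp add: q sums_summable)
    have "I l z \<le> 2 * pi * lam Macro * z" for l
    proof -
      have "0 \<le> G (\<delta> l) \<alpha> + p\<^sub>a * (lam Helper / lam Macro) * (P Helper / P Macro) powr (2 / \<alpha>) * H (\<delta> l) \<alpha> + 1"
        using nn_integral_G(2)[OF \<alpha> \<delta> zero_less_one, of l] H_nonneg[OF \<alpha>] F.p01 lam[of Macro] lam[of Helper]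
        by (intro add_nonneg_nonneg mult_nonneg_nonneg divide_nonneg_nonneg powr_ge_zero) auto
      then have "0 \<le> pi * lam Macro * z\<^sup>2 * (G (\<delta> l) \<alpha> + p\<^sub>a * (lam Helper / lam Macro) * (P Helper / P Macro) powr (2 / \<alpha>) * H (\<delta> l) \<alpha> + 1)"
        using lam[of Macro] by (intro mult_nonneg_nonneg) auto
      moreover have "0 \<le> z powr \<alpha> * inverse (P Macro) * \<delta> l * noise"
        using P[of Macro] \<delta>[of l] noise by simp
      ultimately show ?thesis
        unfolding I_def using that lam[of Macro] by (intro mult_left_le[THEN order_trans, OF _ _ mult_left_le]) auto
    qed
    then show "summable (\<lambda>l. I l z * q l)"
      using that q0 I0 by (intro summable_comparison_test'[OF summable_mult[OF q_sum], of 0 _ "2 * pi * lam Macro * z"])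
        (auto simp: abs_mult mult_right_mono)
  qed
  let ?Ev = "{\<omega> \<in> space M. rate_Mp \<alpha> P noise W (\<lambda>i j. X i j \<omega>) (\<lambda>i j. h i j \<omega>) (\<lambda>j. act j \<omega>) (L\<^sub>1 \<omega>) \<ge> R\<^sub>0}"
  have "?Ev = (\<Union>l. E l)"
  proof (intro set_eqI iffI)
    fix \<omega> assume \<omega>: "\<omega> \<in> ?Ev"
    \<comment> \<open>Division by zero makes the rate 0 at load 0, which is below the target, so the
      events \<open>E l\<close> cover \<open>?Ev\<close> without using that a load of 0 is a null
      event.\<close>
    then have "L\<^sub>1 \<omega> \<noteq> 0" using R\<^sub>0 by (intro notI) (simp add: rate_Mp_def)
    then obtain l where "L\<^sub>1 \<omega> = Suc l" by (auto simp: gr0_conv_Suc)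
    with \<omega> show "\<omega> \<in> (\<Union>l. E l)" by (auto simp: E_def rate_def)
  qed (auto simp: E_def rate_def)
  moreover have "emeasure M (\<Union>l. E l) = (\<Sum>l. emeasure M (E l))"
    by (rule suminf_emeasure[symmetric]) (auto simp: disjoint_family_on_def E_def)
  ultimately have "emeasure M ?Ev = (\<Sum>l. ennreal (q l) * (\<integral>\<^sup>+z\<in>{0<..}. ennreal (I l z) \<partial>lborel))"
    by (simp add: E)
  also have "\<dots> = (\<Sum>l. \<integral>\<^sup>+z. ennreal (q l) * (ennreal (I l z) * indicator {0<..} z) \<partial>lborel)"
    by (intro suminf_cong nn_integral_cmult[symmetric]) measurable
  also have "\<dots> = (\<integral>\<^sup>+z. (\<Sum>l. ennreal (q l) * (ennreal (I l z) * indicator {0<..} z)) \<partial>lborel)"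
    by (rule nn_integral_suminf[symmetric]) measurable
  also have "\<dots> = (\<integral>\<^sup>+z. ennreal (indicator {0<..} z *\<^sub>R (\<Sum>l. I l z * q l)) \<partial>lborel)"
  proof (rule nn_integral_cong)
    fix z :: real
    show "(\<Sum>l. ennreal (q l) * (ennreal (I l z) * indicator {0<..} z)) = ennreal (indicator {0<..} z *\<^sub>R (\<Sum>l. I l z * q l))"
    proof (cases "0 < z")
      case True
      have "(\<Sum>l. ennreal (I l z * q l)) = ennreal (\<Sum>l. I l z * q l)"
        using True q0 I0 by (intro suminf_ennreal2 Iq_summable) auto
      then show ?thesis using True q0 I0 by (simp add: ennreal_mult mult.commute)
    qed simp
  qed
  finally have "measure M ?Ev = enn2real (\<integral>\<^sup>+z. ennreal (indicator {0<..} z *\<^sub>R (\<Sum>l. I l z * q l)) \<partial>lborel)"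
    by (simp add: measure_def)
  \<comment> \<open>The nonnegative integral is the probability of \<open>?Ev\<close>, hence finite,
    and \<open>enn2real\<close> returns its true value.\<close>
  also have "\<dots> = (LBINT z:{0<..}. \<Sum>l. I l z * q l)"
    unfolding set_lebesgue_integral_def
    by (rule integral_eq_nn_integral[symmetric])
      (auto intro!: AE_I2 suminf_nonneg mult_nonneg_nonneg Iq_summable I0 q0 simp: indicator_def)
  finally show ?thesis unfolding I_def q_def .
qed

end
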